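(* Assume the setting of the binary recovery problem (context), with $m=\alpha n$, $k=\beta n$, $0<\beta<\alpha\le 1$ fixed and $n\to\infty$. Then $$I^{(bin)}_{err}(\alpha,\beta):=\lim_{n\to\infty}\frac{\log P_{err}}{n}\le \min_{c_3\ge0}\Big(-\frac{c_3^2}{2}+I_{sph}+\min_{\nu\ge 0,\ \gamma> c_3/2}\big((1-\beta)\log w_1+\beta\log w_2+c_3\gamma\big)\Big)=:I^{(bin,ub)}_{err,u}(\alpha,\beta),$$ where $\hat\gamma=\frac{c_3-\sqrt{c_3^2+4\alpha}}{4}$, $I_{sph}=\hat\gamma c_3-\frac{\alpha}{2}\log\big(1-\frac{c_3}{2\hat\gamma}\big)$, and $$w_1=\tfrac12\Big(\tfrac{e^{\frac{c_3\nu^2/(4\gamma)}{1-c_3/(2\gamma)}}}{\sqrt{1-c_3/(2\gamma)}}\operatorname{erfc}\Big(\tfrac{\nu}{\sqrt2\sqrt{1-c_3/(2\gamma)}}\Big)+\operatorname{erf}\big(\tfrac{\nu}{\sqrt2}\big)+1\Big),\quad w_2=\tfrac12\Big(\tfrac{e^{\frac{c_3\nu^2/(4\gamma)}{1-c_3/(2\gamma)}}}{\sqrt{1-c_3/(2\gamma)}}\operatorname{erfc}\Big(\tfrac{-\nu}{\sqrt2\sqrt{1-c_3/(2\gamma)}}\Big)+\operatorname{erf}\big(\tfrac{-\nu}{\sqrt2}\big)+1\Big).$$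
   Context: Binary recovery problem: $A\in\mathbb{R}^{m\times n}$ has i.i.d. standard normal entries; $\tilde x\in\{0,1\}^n$ has exactly $k$ ones at arbitrary fixed positions; $y=A\tilde x$; the binary $\ell_1$ program is: minimize $\|x\|_1$ subject to $Ax=y$, $0\le x_i\le1$ for all $i$. $P_{err}$ is the probability that $\tilde x$ is not the (unique) solution of the binary $\ell_1$ program. $\operatorname{erf}(t)=\frac{2}{\sqrt\pi}\int_0^te^{-s^2}ds$, $\operatorname{erfc}=1-\operatorname{erf}$. *)

theory Defs
  imports "HOL-Probability.Probability"
begin

definition erf :: "real \<Rightarrow> real" where
  "erf t = 2 / sqrt pi * interval_lebesgue_integral lborel 0 (ereal t) (\<lambda>s. exp (- (s\<^sup>2)))"

definition erfc :: "real \<Rightarrow> real" where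
  "erfc t = 1 - erf t"

definition gauss_mat :: "nat \<Rightarrow> nat \<Rightarrow> (nat \<times> nat \<Rightarrow> real) measure" where
  "gauss_mat m n = PiM ({..<m} \<times> {..<n}) (\<lambda>_. density lborel std_normal_density)"

definition xtilde :: "nat set \<Rightarrow> nat \<Rightarrow> real" where
  "xtilde S j = (if j \<in> S then 1 else 0)"

text \<open>Failure event: xtilde S is NOT the unique solution of
  minimize sum |x_j| s.t. A x = A xtilde, 0 <= x_j <= 1.
  Since xtilde S is feasible, this means another feasible x with
  l1 norm at most that of xtilde S exists.\<close>
definition bin_l1_fail :: "nat \<Rightarrow> nat \<Rightarrow> nat set \<Rightarrow> (nat \<times> nat \<Rightarrow> real) \<Rightarrow> bool" where
  "bin_l1_fail m n S A \<longleftrightarrow>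
     (\<exists>x :: nat \<Rightarrow> real.
        (\<forall>j<n. 0 \<le> x j \<and> x j \<le> 1) \<and>
        (\<forall>i<m. (\<Sum>j<n. A (i, j) * x j) = (\<Sum>j<n. A (i, j) * xtilde S j)) \<and>
        (\<exists>j<n. x j \<noteq> xtilde S j) \<and>
        (\<Sum>j<n. \<bar>x j\<bar>) \<le> (\<Sum>j<n. \<bar>xtilde S j\<bar>))"

definition P_err :: "nat \<Rightarrow> nat \<Rightarrow> nat set \<Rightarrow> real" where
  "P_err m n S = measure (gauss_mat m n) {A \<in> space (gauss_mat m n). bin_l1_fail m n S A}"

definition ln_ereal :: "real \<Rightarrow> ereal" where
  "ln_ereal p = (if p \<le> 0 then - \<infinity> else ereal (ln p))"

definition gamma_hat :: "real \<Rightarrow> real \<Rightarrow> real" where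
  "gamma_hat \<alpha> c3 = (c3 - sqrt (c3\<^sup>2 + 4 * \<alpha>)) / 4"

definition I_sph :: "real \<Rightarrow> real \<Rightarrow> real" where
  "I_sph \<alpha> c3 = gamma_hat \<alpha> c3 * c3 - \<alpha> / 2 * ln (1 - c3 / (2 * gamma_hat \<alpha> c3))"

definition w1 :: "real \<Rightarrow> real \<Rightarrow> real \<Rightarrow> real" where
  "w1 c3 \<nu> \<gamma> = 1/2 * (exp ((c3 * \<nu>\<^sup>2 / (4 * \<gamma>)) / (1 - c3 / (2 * \<gamma>))) / sqrt (1 - c3 / (2 * \<gamma>))
        * erfc (\<nu> / (sqrt 2 * sqrt (1 - c3 / (2 * \<gamma>)))) + erf (\<nu> / sqrt 2) + 1)"

definition w2 :: "real \<Rightarrow> real \<Rightarrow> real \<Rightarrow> real" where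
  "w2 c3 \<nu> \<gamma> = 1/2 * (exp ((c3 * \<nu>\<^sup>2 / (4 * \<gamma>)) / (1 - c3 / (2 * \<gamma>))) / sqrt (1 - c3 / (2 * \<gamma>))
        * erfc (- \<nu> / (sqrt 2 * sqrt (1 - c3 / (2 * \<gamma>)))) + erf (- \<nu> / sqrt 2) + 1)"

definition I_bin_ub :: "real \<Rightarrow> real \<Rightarrow> ereal" where
  "I_bin_ub \<alpha> \<beta> =
     (INF c3 \<in> {0..}. ereal (- c3\<^sup>2 / 2 + I_sph \<alpha> c3) +
        (INF p \<in> {(\<nu>, \<gamma>). \<nu> \<ge> 0 \<and> \<gamma> > c3 / 2}.
           ereal ((1 - \<beta>) * ln (w1 c3 (fst p) (snd p)) + \<beta> * ln (w2 c3 (fst p) (snd p)) + c3 * snd p)))"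

end

theory Submission
  imports Defs
begin

text \<open>
  Failure of the program means that the kernel of \<open>A\<close> meets the cone of directions \<open>w\<close> with
  \<open>w\<^sub>j \<le> 0\<close> on the support, \<open>w\<^sub>j \<ge> 0\<close> off it and \<open>\<Sum>\<^sub>j w\<^sub>j \<le> 0\<close>. Gordon's inequality, in the
  form \<open>E max\<^sub>w exp (- c (|A w| + g\<^sub>0)) \<le> E max\<^sub>w exp (- c (|g| + h \<bullet> w))\<close> for unit vectors \<open>w\<close>, bounds the
  failure probability by \<open>exp (- c\<^sup>2 / 2) E exp (- c |g|) E max\<^sub>w exp (- c h \<bullet> w)\<close>. With \<open>c = c\<^sub>3 \<surd>n\<close> the
  second factor has rate \<open>I_sph\<close>, and Lagrange duality with multipliers \<open>\<nu>\<close> (for the sum constraint) and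
  \<open>\<gamma>\<close> (for the norm) turns the third one into a product of one-dimensional integrals, \<open>w1\<close> and \<open>w2\<close>.

  Gordon's inequality is proved by Lindeberg swapping. The maximum over a finite set of unit vectors
  is replaced by \<open>M\<^sup>q\<close>, \<open>M = \<Sum>\<^sub>w exp (- c/q (\<surd>(1 + |v\<^sub>w|\<^sup>2) + z\<^sub>w))\<close>, and one process is exchanged for the
  other in \<open>N\<close> independent increments of variance \<open>1/N\<close>. Both processes have the same law for a single
  \<open>w\<close>, so the expectation of \<open>M\<close> does not change; the concave function \<open>M\<^sup>q\<close> then sees only the second
  moment of the relative increment of \<open>M\<close>, whose change is the nonnegative quantity
  \<open>\<Sum>\<^sub>w\<^sub>,\<^sub>w\<^sub>' p\<^sub>w p\<^sub>w\<^sub>' (1 - n\<^sub>w \<bullet> n\<^sub>w\<^sub>') (1 - w \<bullet> w')\<close>, up to an error of order \<open>N powr (- 3/2)\<close> per step.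
\<close>

section \<open>Products of standard Gaussian measures\<close>

text \<open>Swapping increments, instead of differentiating an interpolated expectation, reduces the
  comparison to Taylor bounds, Gaussian second moments and the stability of the Gaussian law. Both
  processes live on one matrix indexed by \<open>{..m} \<times> {..n}\<close>, so the exchange only
  changes the variances of its entries. The error of a step must be integrable and uniform in the
  base point; hence all expansions are relative, with \<open>f A\<close> in front and an exponential
  of the l1 norm of the increment as error. The 1 under the root makes the norm smooth at the
  origin; on the kernel it raises the norm from 0 to 1, which costs a factor exp c = exp (c3 sqrt
  n), invisible at scale n. The term - c3^2 / 2 comes from the moment exp (c^2 / 2) of the auxiliary
  scalar g0, which multiplies the failure probability. Infinite sets of directions are reached
  through a countable dense subset, since the finite bound does not depend on the number of vectors.
  The factor E exp (- c |g|) is bounded through finitely many tangents in |g|^2, so that the final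
  integrand is a product over matrix entries.\<close>

abbreviation std_gauss :: "real measure" where
  "std_gauss \<equiv> density lborel std_normal_density"

abbreviation gauss_PiM :: "'a set \<Rightarrow> ('a \<Rightarrow> real) measure" where
  "gauss_PiM K \<equiv> PiM K (\<lambda>_. std_gauss)"

lemma prob_space_std_gauss: "prob_space std_gauss"
  by (rule prob_space_normal_density) simp

lemma product_sigma_finite_std_gauss: "product_sigma_finite (\<lambda>_. std_gauss)"
  unfolding product_sigma_finite_def
  by (intro allI prob_space_imp_sigma_finite prob_space_std_gauss)

lemma prob_space_gauss_PiM: "prob_space (gauss_PiM K)"
  by (intro prob_space_PiM prob_space_std_gauss)

lemma measurable_gauss_PiM_component:
  "k \<in> K \<Longrightarrow> (\<lambda>\<omega>. \<omega> k) \<in> borel_measurable (gauss_PiM K)"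
  using measurable_component_singleton[of k K "\<lambda>_. std_gauss"] by (simp cong: measurable_cong_sets)

lemma distributed_gauss_PiM_component:
  assumes "k \<in> K"
  shows "distributed (gauss_PiM K) lborel (\<lambda>\<omega>. \<omega> k) std_normal_density"
proof -
  have "distr (gauss_PiM K) std_gauss (\<lambda>\<omega>. \<omega> k) = std_gauss"
    using distr_PiM_component[of K "\<lambda>_. std_gauss" k] prob_space_std_gauss assms by simp
  moreover have "distr (gauss_PiM K) std_gauss (\<lambda>\<omega>. \<omega> k) = distr (gauss_PiM K) lborel (\<lambda>\<omega>. \<omega> k)"
    by (rule distr_cong) auto
  ultimately show ?thesis
    using assms by (simp add: distributed_def cong: measurable_cong_sets)
qed

lemma indep_vars_gauss_PiM:
  assumes "K \<noteq> {}"
  shows "prob_space.indep_vars (gauss_PiM K) (\<lambda>_. borel) (\<lambda>k \<omega>. \<omega> k) K"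
proof -
  interpret prob_space "gauss_PiM K" by (rule prob_space_gauss_PiM)
  have "distr (gauss_PiM K) (\<Pi>\<^sub>M i\<in>K. borel) (\<lambda>x. \<lambda>i\<in>K. x i) = distr (gauss_PiM K) (gauss_PiM K) (\<lambda>x. x)"
    by (rule distr_cong) (auto intro!: sets_PiM_cong simp: space_PiM PiE_def extensional_restrict)
  also have "\<dots> = gauss_PiM K" by simp
  also have "\<dots> = (\<Pi>\<^sub>M i\<in>K. distr (gauss_PiM K) borel (\<lambda>\<omega>. \<omega> i))"
  proof (intro PiM_cong refl)
    fix k assume "k \<in> K"
    then have "distr (gauss_PiM K) lborel (\<lambda>\<omega>. \<omega> k) = std_gauss"
      using distributed_gauss_PiM_component[of k K] by (simp add: distributed_def)
    moreover have "distr (gauss_PiM K) lborel (\<lambda>\<omega>. \<omega> k) = distr (gauss_PiM K) borel (\<lambda>\<omega>. \<omega> k)"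
      by (rule distr_cong) auto
    ultimately show "std_gauss = distr (gauss_PiM K) borel (\<lambda>\<omega>. \<omega> k)" by simp
  qed
  finally show ?thesis
    using assms by (subst indep_vars_iff_distr_eq_PiM') auto
qed

lemma distributed_gauss_PiM_linear:
  fixes c :: "'a \<Rightarrow> real"
  assumes "finite K" and pos: "(\<Sum>k\<in>K. (c k)\<^sup>2) > 0"
  shows "distributed (gauss_PiM K) lborel (\<lambda>\<omega>. \<Sum>k\<in>K. c k * \<omega> k) (normal_density 0 (sqrt (\<Sum>k\<in>K. (c k)\<^sup>2)))"
proof -
  \<comment> \<open>\<open>normal_density\<close> with standard deviation 0 is not a probability
    density, so zero coefficients are discarded before independent normals are added.\<close>
  define L where "L = {k\<in>K. c k \<noteq> 0}"
  have L: "finite L" "L \<subseteq> K" using \<open>finite K\<close> by (auto simp: L_def)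
  have K: "K \<noteq> {}" using pos by auto
  have "L \<noteq> {}"
    using pos by (auto simp: L_def intro: ccontr sum.neutral)
  interpret prob_space "gauss_PiM K" by (rule prob_space_gauss_PiM)
  have "indep_vars (\<lambda>_. borel) (\<lambda>k \<omega>. c k * \<omega> k) L"
    by (rule indep_vars_compose2[where Y="\<lambda>k x. c k * x", OF indep_vars_subset[OF indep_vars_gauss_PiM[OF K] L(2)]]) auto
  moreover have "distributed (gauss_PiM K) lborel (\<lambda>\<omega>. c k * \<omega> k) (normal_density 0 \<bar>c k\<bar>)" if "k \<in> L" for k
    using normal_density_affine[OF distributed_gauss_PiM_component[of k K], of "c k" 0] that
    by (simp add: L_def)
  ultimately have "distributed (gauss_PiM K) lborel (\<lambda>\<omega>. \<Sum>k\<in>L. c k * \<omega> k)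
      (normal_density (\<Sum>k\<in>L. 0) (sqrt (\<Sum>k\<in>L. \<bar>c k\<bar>\<^sup>2)))"
    using L(1) \<open>L \<noteq> {}\<close> by (intro sum_indep_normal) (auto simp: L_def)
  moreover have "(\<Sum>k\<in>L. c k * \<omega> k) = (\<Sum>k\<in>K. c k * \<omega> k)" for \<omega>
    unfolding L_def by (rule sum.mono_neutral_left) (use \<open>finite K\<close> in auto)
  moreover have "(\<Sum>k\<in>L. (c k)\<^sup>2) = (\<Sum>k\<in>K. (c k)\<^sup>2)"
    unfolding L_def by (rule sum.mono_neutral_left) (use \<open>finite K\<close> in auto)
  ultimately show ?thesis by simp
qed

lemma
  fixes c :: "'a \<Rightarrow> real"
  assumes "finite K"
  shows integrable_gauss_PiM_linear_sq: "integrable (gauss_PiM K) (\<lambda>\<omega>. (\<Sum>k\<in>K. c k * \<omega> k)\<^sup>2)"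
    and integral_gauss_PiM_linear_sq: "(\<integral>\<omega>. (\<Sum>k\<in>K. c k * \<omega> k)\<^sup>2 \<partial>gauss_PiM K) = (\<Sum>k\<in>K. (c k)\<^sup>2)"
proof -
  interpret prob_space "gauss_PiM K" by (rule prob_space_gauss_PiM)
  have "integrable (gauss_PiM K) (\<lambda>\<omega>. (\<Sum>k\<in>K. c k * \<omega> k)\<^sup>2) \<and>
    (\<integral>\<omega>. (\<Sum>k\<in>K. c k * \<omega> k)\<^sup>2 \<partial>gauss_PiM K) = (\<Sum>k\<in>K. (c k)\<^sup>2)"
  proof (cases "(\<Sum>k\<in>K. (c k)\<^sup>2) > 0")
    case True
    note D = distributed_gauss_PiM_linear[OF \<open>finite K\<close> True]
    have s: "0 < sqrt (\<Sum>k\<in>K. (c k)\<^sup>2)" using True by simp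
    have "integrable (gauss_PiM K) (\<lambda>\<omega>. (\<Sum>k\<in>K. c k * \<omega> k)\<^sup>2)"
      using distributed_integrable[OF D, of "\<lambda>x. x\<^sup>2"] integrable_normal_moment[OF s, of 0 2]
      by (simp add: normal_density_nonneg)
    moreover have "expectation (\<lambda>\<omega>. \<Sum>k\<in>K. c k * \<omega> k) = 0"
      by (rule normal_distributed_expectation[OF s D])
    moreover have "variance (\<lambda>\<omega>. \<Sum>k\<in>K. c k * \<omega> k) = (sqrt (\<Sum>k\<in>K. (c k)\<^sup>2))\<^sup>2"
      by (rule normal_distributed_variance[OF s D])
    ultimately show ?thesis using True by simp
  next
    case False
    then have "(\<Sum>k\<in>K. (c k)\<^sup>2) = 0" by (simp add: sum_nonneg order_antisym)
    then have "\<forall>k\<in>K. c k = 0" using \<open>finite K\<close> by (simp add: sum_nonneg_eq_0_iff)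
    then show ?thesis by simp
  qed
  then show "integrable (gauss_PiM K) (\<lambda>\<omega>. (\<Sum>k\<in>K. c k * \<omega> k)\<^sup>2)"
    "(\<integral>\<omega>. (\<Sum>k\<in>K. c k * \<omega> k)\<^sup>2 \<partial>gauss_PiM K) = (\<Sum>k\<in>K. (c k)\<^sup>2)" by auto
qed

text \<open>Different rows use disjoint coordinates, hence are independent, and a unit combination
  of standard Gaussians is standard. This yields both the two-term stability law (one row, two
  columns) and the equality in law of the two blocks for a fixed unit vector.\<close>

lemma distr_gauss_PiM_rows:
  fixes c :: "'a \<Rightarrow> 'b \<Rightarrow> real"
  assumes "finite I" "I \<noteq> {}" "finite J" and c: "\<And>i. i \<in> I \<Longrightarrow> (\<Sum>j\<in>J. (c i j)\<^sup>2) = 1"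
  shows "distr (gauss_PiM (I \<times> J)) (\<Pi>\<^sub>M i\<in>I. borel) (\<lambda>\<omega>. \<lambda>i\<in>I. \<Sum>j\<in>J. c i j * \<omega> (i, j)) = gauss_PiM I"
proof -
  have "J \<noteq> {}" using c \<open>I \<noteq> {}\<close> by force
  interpret prob_space "gauss_PiM (I \<times> J)" by (rule prob_space_gauss_PiM)
  have ind: "indep_vars (\<lambda>_. borel) (\<lambda>k \<omega>. \<omega> k) (I \<times> J)"
    using assms \<open>J \<noteq> {}\<close> by (intro indep_vars_gauss_PiM) auto
  have "indep_vars (\<lambda>i. PiM ({i} \<times> J) (\<lambda>_. borel)) (\<lambda>i \<omega>. restrict (\<lambda>k. \<omega> k) ({i} \<times> J)) I"
    by (rule indep_vars_restrict[OF ind]) (auto simp: disjoint_family_on_def)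
  then have "indep_vars (\<lambda>_. borel) (\<lambda>i \<omega>. \<Sum>j\<in>J. c i j * (restrict (\<lambda>k. \<omega> k) ({i} \<times> J)) (i, j)) I"
    by (rule indep_vars_compose2) simp
  then have rows: "indep_vars (\<lambda>_. borel) (\<lambda>i \<omega>. \<Sum>j\<in>J. c i j * \<omega> (i, j)) I"
    by simp
  have row: "distr (gauss_PiM (I \<times> J)) borel (\<lambda>\<omega>. \<Sum>j\<in>J. c i j * \<omega> (i, j)) = std_gauss" if "i \<in> I" for i
  proof -
    define c' where "c' = (\<lambda>k. if fst k = i then c i (snd k) else 0)"
    have collapse: "(\<Sum>k\<in>I \<times> J. if fst k = i then f k else 0) = (\<Sum>j\<in>J. f (i, j))" for f :: "'a \<times> 'b \<Rightarrow> real"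
    proof -
      have "(\<Sum>k\<in>I \<times> J. if fst k = i then f k else 0) = (\<Sum>k\<in>{i} \<times> J. f k)"
        using assms that by (intro sum.mono_neutral_cong_right) auto
      also have "\<dots> = (\<Sum>j\<in>J. f (i, j))"
        by (rule sum.reindex_bij_witness[of _ "\<lambda>j. (i, j)" snd]) auto
      finally show ?thesis .
    qed
    have "(\<Sum>k\<in>I \<times> J. (c' k)\<^sup>2) = (\<Sum>k\<in>I \<times> J. if fst k = i then (c i (snd k))\<^sup>2 else 0)"
      unfolding c'_def by (intro sum.cong) auto
    also have "\<dots> = 1" using c[OF that] by (subst collapse) simp
    finally have c'2: "(\<Sum>k\<in>I \<times> J. (c' k)\<^sup>2) = 1" .
    have c'1: "(\<Sum>k\<in>I \<times> J. c' k * \<omega> k) = (\<Sum>j\<in>J. c i j * \<omega> (i, j))" for \<omega>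
    proof -
      have "(\<Sum>k\<in>I \<times> J. c' k * \<omega> k) = (\<Sum>k\<in>I \<times> J. if fst k = i then c i (snd k) * \<omega> k else 0)"
        unfolding c'_def by (intro sum.cong) auto
      also have "\<dots> = (\<Sum>j\<in>J. c i j * \<omega> (i, j))" by (subst collapse) simp
      finally show ?thesis .
    qed
    have D: "distributed (gauss_PiM (I \<times> J)) lborel (\<lambda>\<omega>. \<Sum>j\<in>J. c i j * \<omega> (i, j)) std_normal_density"
      using distributed_gauss_PiM_linear[of "I \<times> J" c'] assms by (simp add: c'1 c'2)
    have "distr (gauss_PiM (I \<times> J)) borel (\<lambda>\<omega>. \<Sum>j\<in>J. c i j * \<omega> (i, j)) =
        distr (gauss_PiM (I \<times> J)) lborel (\<lambda>\<omega>. \<Sum>j\<in>J. c i j * \<omega> (i, j))"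
      by (rule distr_cong) auto
    also note distributed_distr_eq_density[OF D]
    finally show ?thesis .
  qed
  have rv: "(\<lambda>\<omega>. \<Sum>j\<in>J. c i j * \<omega> (i, j)) \<in> borel_measurable (gauss_PiM (I \<times> J))" if "i \<in> I" for i
    using that by (intro borel_measurable_sum borel_measurable_times measurable_gauss_PiM_component) auto
  have "distr (gauss_PiM (I \<times> J)) (\<Pi>\<^sub>M i\<in>I. borel) (\<lambda>\<omega>. \<lambda>i\<in>I. \<Sum>j\<in>J. c i j * \<omega> (i, j)) =
      (\<Pi>\<^sub>M i\<in>I. distr (gauss_PiM (I \<times> J)) borel (\<lambda>\<omega>. \<Sum>j\<in>J. c i j * \<omega> (i, j)))"
    using indep_vars_iff_distr_eq_PiM'[of I "\<lambda>i \<omega>. \<Sum>j\<in>J. c i j * \<omega> (i, j)" "\<lambda>_. borel"]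
      \<open>I \<noteq> {}\<close> rows rv by blast
  also have "\<dots> = gauss_PiM I" by (intro PiM_cong row) simp
  finally show ?thesis .
qed

lemma
  shows integrable_std_gauss_exp: "integrable std_gauss (\<lambda>x. exp (c * x))"
    and integral_std_gauss_exp: "(\<integral>x. exp (c * x) \<partial>std_gauss) = exp (c\<^sup>2 / 2)"
proof -
  have eq: "std_normal_density x * exp (c * x) = exp (c\<^sup>2 / 2) * normal_density c 1 x" for x
    by (simp add: normal_density_def exp_add[symmetric] power2_eq_square field_simps)
  have "integrable lborel (\<lambda>x. exp (c\<^sup>2 / 2) * normal_density c 1 x)" by simp
  then show "integrable std_gauss (\<lambda>x. exp (c * x))"
    by (subst integrable_density) (auto simp: eq)
  show "(\<integral>x. exp (c * x) \<partial>std_gauss) = exp (c\<^sup>2 / 2)"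
    by (subst integral_density) (auto simp: eq)
qed

lemma integrable_std_gauss_exp_abs: "integrable std_gauss (\<lambda>x. exp (c * \<bar>x\<bar>))"
proof (rule Bochner_Integration.integrable_bound)
  show "integrable std_gauss (\<lambda>x. exp (c * x) + exp (- c * x))"
    using integrable_std_gauss_exp[of c] integrable_std_gauss_exp[of "- c"] by (intro Bochner_Integration.integrable_add)
  show "AE x in std_gauss. norm (exp (c * \<bar>x\<bar>)) \<le> norm (exp (c * x) + exp (- c * x))"
    proof (intro AE_I2)
    fix x :: real
    show "norm (exp (c * \<bar>x\<bar>)) \<le> norm (exp (c * x) + exp (- c * x))"
      by (cases "x \<ge> 0") (simp_all add: abs_of_pos add_pos_pos)
  qed
qed auto

lemma integrable_gauss_PiM_exp_abs:
  assumes "finite K"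
  shows "integrable (gauss_PiM K) (\<lambda>\<omega>. exp (c * (\<Sum>k\<in>K. \<bar>\<omega> k\<bar>)))"
proof -
  interpret product_sigma_finite "\<lambda>_::'a. std_gauss" by (rule product_sigma_finite_std_gauss)
  show ?thesis
    using product_integrable_prod[OF assms, of "\<lambda>_ x. exp (c * \<bar>x\<bar>)"] integrable_std_gauss_exp_abs assms
    by (simp add: exp_sum[symmetric] sum_distrib_left)
qed

lemma nn_integral_std_gauss_stable:
  assumes [measurable]: "G \<in> borel_measurable borel"
  shows "(\<integral>\<^sup>+x. \<integral>\<^sup>+y. G (a * x + b * y) \<partial>std_gauss \<partial>std_gauss) = (\<integral>\<^sup>+x. G (sqrt (a\<^sup>2 + b\<^sup>2) * x) \<partial>std_gauss)"
proof (cases "a = 0 \<and> b = 0")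
  case True
  interpret prob_space std_gauss by (rule prob_space_std_gauss)
  from True show ?thesis using emeasure_space_1 by simp
next
  case False
  define r where "r = sqrt (a\<^sup>2 + b\<^sup>2)"
  have r: "r > 0" using False by (auto simp: r_def sum_power2_gt_zero_iff)
  have r2: "r\<^sup>2 = a\<^sup>2 + b\<^sup>2" by (simp add: r_def)
  \<comment> \<open>A single row indexed by \<open>unit\<close> with two columns indexed by
    \<open>bool\<close>; dividing by r makes it a unit row, and the factor r is put back inside
    \<open>G\<close>.\<close>
  define c where "c = (\<lambda>(_::unit) j. (if j then a else b) / r)"
  have "(\<Sum>j\<in>UNIV. (c () j)\<^sup>2) = 1"
    using False by (simp add: c_def UNIV_bool power_divide add_divide_distrib[symmetric] r2)
  then have *: "distr (gauss_PiM ({()} \<times> UNIV)) (\<Pi>\<^sub>M i\<in>{()}. borel) (\<lambda>\<omega>. \<lambda>i\<in>{()}. \<Sum>j\<in>UNIV. c i j * \<omega> (i, j)) = gauss_PiM {()}"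
    by (intro distr_gauss_PiM_rows) auto
  interpret P: product_sigma_finite "\<lambda>_::unit. std_gauss" by (rule product_sigma_finite_std_gauss)
  interpret Q: product_sigma_finite "\<lambda>_::unit \<times> bool. std_gauss" by (rule product_sigma_finite_std_gauss)
  have "(\<integral>\<^sup>+x. G (r * x) \<partial>std_gauss) = (\<integral>\<^sup>+\<omega>. G (r * \<omega> ()) \<partial>gauss_PiM {()})"
    by (rule P.product_nn_integral_singleton[symmetric]) simp
  also have "\<dots> = (\<integral>\<^sup>+\<omega>. G (r * (\<Sum>j\<in>UNIV. c () j * \<omega> ((), j))) \<partial>gauss_PiM ({()} \<times> UNIV))"
    by (subst *[symmetric], subst nn_integral_distr) auto
  also have "\<dots> = (\<integral>\<^sup>+\<omega>. G (a * \<omega> ((), True) + b * \<omega> ((), False)) \<partial>gauss_PiM {((), False), ((), True)})"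
    using r by (intro nn_integral_cong_simp arg_cong2[where f=nn_integral] arg_cong2[where f=PiM] ext)
       (auto simp: c_def UNIV_bool algebra_simps)
  also have "\<dots> = (\<integral>\<^sup>+x. \<integral>\<^sup>+\<omega>. G (a * fun_upd \<omega> ((), True) x ((), True) + b * fun_upd \<omega> ((), True) x ((), False)) \<partial>gauss_PiM {((), False)} \<partial>std_gauss)"
    by (subst insert_commute, subst Q.product_nn_integral_insert_rev) auto
  also have "\<dots> = (\<integral>\<^sup>+x. \<integral>\<^sup>+\<omega>. G (a * x + b * \<omega> ((), False)) \<partial>gauss_PiM {((), False)} \<partial>std_gauss)"
    by simp
  also have "\<dots> = (\<integral>\<^sup>+x. \<integral>\<^sup>+y. G (a * x + b * y) \<partial>std_gauss \<partial>std_gauss)"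
    by (intro nn_integral_cong Q.product_nn_integral_singleton) simp
  finally show ?thesis by (simp add: r_def)
qed

text \<open>Variances add coordinate by coordinate. This is what splits an interpolating Gaussian
  matrix into a large part and an independent small increment.\<close>

lemma nn_integral_gauss_PiM_stable:
  assumes "finite K" and G: "G \<in> borel_measurable (\<Pi>\<^sub>M k\<in>K. borel)"
  shows "(\<integral>\<^sup>+\<omega>. \<integral>\<^sup>+\<omega>'. G (\<lambda>k\<in>K. a k * \<omega> k + b k * \<omega>' k) \<partial>gauss_PiM K \<partial>gauss_PiM K) =
    (\<integral>\<^sup>+\<omega>. G (\<lambda>k\<in>K. sqrt ((a k)\<^sup>2 + (b k)\<^sup>2) * \<omega> k) \<partial>gauss_PiM K)"
  using assms
proof (induction K arbitrary: G)
  case empty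
  then show ?case by (simp add: PiM_empty)
next
  case (insert i K)
  interpret product_sigma_finite "\<lambda>_::'a. std_gauss" by (rule product_sigma_finite_std_gauss)
  interpret N: prob_space std_gauss by (rule prob_space_std_gauss)
  interpret F: prob_space "gauss_PiM K" by (rule prob_space_gauss_PiM)
  interpret pair_sigma_finite "std_gauss" "gauss_PiM K" ..
  note [measurable] = insert.prems
  have [measurable_cong]: "sets (gauss_PiM K) = sets (\<Pi>\<^sub>M k\<in>K. borel)" for K :: "'a set"
    by (intro sets_PiM_cong) auto
  have [measurable]: "(\<lambda>(y, f). f(i := y)) \<in> borel \<Otimes>\<^sub>M PiM K (\<lambda>_. borel) \<rightarrow>\<^sub>M PiM (insert i K) (\<lambda>_. borel :: real measure)"
    by (simp add: split_beta) 
  let ?h = "\<lambda>\<omega> \<omega>' x y. G ((\<lambda>k\<in>K. a k * \<omega> k + b k * \<omega>' k)(i := a i * x + b i * y))"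
  have upd: "(\<lambda>k\<in>insert i K. a k * fun_upd \<omega> i x k + b k * fun_upd \<omega>' i y k) = fun_upd (\<lambda>k\<in>K. a k * \<omega> k + b k * \<omega>' k) i (a i * x + b i * y)" for \<omega> \<omega>' x y
    using insert.hyps by (auto simp: fun_eq_iff)
  have "(\<integral>\<^sup>+\<omega>. \<integral>\<^sup>+\<omega>'. G (\<lambda>k\<in>insert i K. a k * \<omega> k + b k * \<omega>' k) \<partial>gauss_PiM (insert i K) \<partial>gauss_PiM (insert i K))
     = (\<integral>\<^sup>+x. \<integral>\<^sup>+\<omega>. \<integral>\<^sup>+y. \<integral>\<^sup>+\<omega>'. ?h \<omega> \<omega>' x y \<partial>gauss_PiM K \<partial>std_gauss \<partial>gauss_PiM K \<partial>std_gauss)"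
  proof -
    have inner: "(\<integral>\<^sup>+\<omega>'. G (\<lambda>k\<in>insert i K. a k * fun_upd \<omega> i x k + b k * \<omega>' k) \<partial>gauss_PiM (insert i K)) =
        (\<integral>\<^sup>+y. \<integral>\<^sup>+\<omega>'. ?h \<omega> \<omega>' x y \<partial>gauss_PiM K \<partial>std_gauss)" for \<omega> x
    proof -
      have "(\<lambda>\<omega>'. G (\<lambda>k\<in>insert i K. a k * fun_upd \<omega> i x k + b k * \<omega>' k)) \<in> borel_measurable (gauss_PiM (insert i K))"
        by (intro measurable_compose[OF measurable_restrict insert.prems]) auto
      from product_nn_integral_insert_rev[OF insert.hyps(1,2) this]
      show ?thesis by (simp only: upd)
    qed
    interpret H: prob_space "gauss_PiM (insert i K)" by (rule prob_space_gauss_PiM)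
    have "(\<lambda>\<omega>. \<integral>\<^sup>+\<omega>'. G (\<lambda>k\<in>insert i K. a k * \<omega> k + b k * \<omega>' k) \<partial>gauss_PiM (insert i K)) \<in> borel_measurable (gauss_PiM (insert i K))"
      by (intro H.borel_measurable_nn_integral) (unfold split_beta, intro measurable_compose[OF measurable_restrict insert.prems], auto)
    from product_nn_integral_insert_rev[OF insert.hyps(1,2) this]
    show ?thesis by (simp only: inner)
  qed
  \<comment> \<open>Exchanging the integrals over y and \<omega> groups the two copies over
    \<open>K\<close> for fixed x and y, where the induction hypothesis applies; the one-dimensional
    law then merges x and y.\<close>
  also have "\<dots> = (\<integral>\<^sup>+x. \<integral>\<^sup>+y. \<integral>\<^sup>+\<omega>. \<integral>\<^sup>+\<omega>'. ?h \<omega> \<omega>' x y \<partial>gauss_PiM K \<partial>gauss_PiM K \<partial>std_gauss \<partial>std_gauss)"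
    by (intro nn_integral_cong, rule Fubini') simp
  also have "\<dots> = (\<integral>\<^sup>+x. \<integral>\<^sup>+y. \<integral>\<^sup>+\<omega>. G ((\<lambda>k\<in>K. sqrt ((a k)\<^sup>2 + (b k)\<^sup>2) * \<omega> k)(i := a i * x + b i * y)) \<partial>gauss_PiM K \<partial>std_gauss \<partial>std_gauss)"
  proof (intro arg_cong[where f="nn_integral std_gauss"] ext)
    fix x y
    show "(\<integral>\<^sup>+\<omega>. \<integral>\<^sup>+\<omega>'. ?h \<omega> \<omega>' x y \<partial>gauss_PiM K \<partial>gauss_PiM K) =
      (\<integral>\<^sup>+\<omega>. G ((\<lambda>k\<in>K. sqrt ((a k)\<^sup>2 + (b k)\<^sup>2) * \<omega> k)(i := a i * x + b i * y)) \<partial>gauss_PiM K)"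
      by (rule insert.IH[of "\<lambda>f. G (fun_upd f i (a i * x + b i * y))"]) simp
  qed
  also have "\<dots> = (\<integral>\<^sup>+x. \<integral>\<^sup>+\<omega>. G ((\<lambda>k\<in>K. sqrt ((a k)\<^sup>2 + (b k)\<^sup>2) * \<omega> k)(i := sqrt ((a i)\<^sup>2 + (b i)\<^sup>2) * x)) \<partial>gauss_PiM K \<partial>std_gauss)"
    by (rule nn_integral_std_gauss_stable[of "\<lambda>z. \<integral>\<^sup>+\<omega>. G ((\<lambda>k\<in>K. sqrt ((a k)\<^sup>2 + (b k)\<^sup>2) * \<omega> k)(i := z)) \<partial>gauss_PiM K"]) simp
  also have "\<dots> = (\<integral>\<^sup>+x. \<integral>\<^sup>+\<omega>. G (\<lambda>k\<in>insert i K. sqrt ((a k)\<^sup>2 + (b k)\<^sup>2) * fun_upd \<omega> i x k) \<partial>gauss_PiM K \<partial>std_gauss)"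
    using insert.hyps by (intro nn_integral_cong arg_cong[where f=G]) (auto simp: fun_eq_iff)
  also have "\<dots> = (\<integral>\<^sup>+\<omega>. G (\<lambda>k\<in>insert i K. sqrt ((a k)\<^sup>2 + (b k)\<^sup>2) * \<omega> k) \<partial>gauss_PiM (insert i K))"
    using insert.hyps by (subst product_nn_integral_insert_rev) (simp_all del: fun_upd_apply)
  finally show ?case .
qed

section \<open>Second-order expansion of the smoothed functional\<close>

lemma exp_taylor1: "\<bar>exp x - 1 - x\<bar> \<le> x\<^sup>2 * exp \<bar>x\<bar>" for x :: real
proof -
  obtain t where t: "\<bar>t\<bar> \<le> \<bar>x\<bar>" "exp x = (\<Sum>m<2. x ^ m / fact m) + exp t / fact 2 * x ^ 2"
    using Maclaurin_exp_le[of x 2] by auto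
  have "exp t \<le> exp \<bar>x\<bar>" using t(1) by auto
  then have "exp t / 2 \<le> exp \<bar>x\<bar>" using exp_ge_zero[of "\<bar>x\<bar>"] exp_ge_zero[of t] by linarith
  then have "exp t / 2 * x\<^sup>2 \<le> exp \<bar>x\<bar> * x\<^sup>2" by (rule mult_right_mono) simp
  moreover have "exp x - 1 - x = exp t / 2 * x\<^sup>2"
    using t(2) by (simp add: numeral_eq_Suc)
  moreover have "0 \<le> exp t / 2 * x\<^sup>2" by simp
  ultimately show ?thesis by (metis abs_of_nonneg mult.commute)
qed

lemma exp_taylor2: "\<bar>exp x - 1 - x - x\<^sup>2 / 2\<bar> \<le> \<bar>x\<bar> ^ 3 * exp \<bar>x\<bar>" for x :: real
proof -
  obtain t where t: "\<bar>t\<bar> \<le> \<bar>x\<bar>" "exp x = (\<Sum>m<3. x ^ m / fact m) + exp t / fact 3 * x ^ 3"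
    using Maclaurin_exp_le[of x 3] by auto
  have "exp t \<le> exp \<bar>x\<bar>" using t(1) by auto
  then have "exp t / 6 \<le> exp \<bar>x\<bar>" using exp_ge_zero[of "\<bar>x\<bar>"] exp_ge_zero[of t] by linarith
  then have "exp t / 6 * \<bar>x\<bar> ^ 3 \<le> exp \<bar>x\<bar> * \<bar>x\<bar> ^ 3" by (rule mult_right_mono) simp
  moreover have "exp x - 1 - x - x\<^sup>2 / 2 = exp t / 6 * x ^ 3"
    using t(2) by (simp add: numeral_eq_Suc)
  then have "\<bar>exp x - 1 - x - x\<^sup>2 / 2\<bar> = exp t / 6 * \<bar>x\<bar> ^ 3"
    by (simp only: abs_mult power_abs) simp
  ultimately show ?thesis by (simp add: mult.commute)
qed

text \<open>Writing the sum as \<open>exp \<theta>\<close> makes its affine part exact, so only \<open>\<theta>\<^sup>2\<close> has to be expanded.\<close>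
lemma sum_exp_powr_expansion:
  fixes p D l :: "'w \<Rightarrow> real"
  assumes p: "\<And>w. w \<in> T \<Longrightarrow> p w \<ge> 0" "(\<Sum>w\<in>T. p w) = 1"
    and q: "0 \<le> q" "q \<le> 1" and s: "0 \<le> s" "s \<le> 1" and B: "0 \<le> B"
    and l: "\<And>w. w \<in> T \<Longrightarrow> \<bar>l w\<bar> \<le> B" and D: "\<And>w. w \<in> T \<Longrightarrow> \<bar>D w\<bar> \<le> s * B"
    and Dl: "\<And>w. w \<in> T \<Longrightarrow> \<bar>D w - s * l w\<bar> \<le> (s * B)\<^sup>2"
  shows "\<bar>(\<Sum>w\<in>T. p w * exp (D w)) powr q - ((1 - q) + q * (\<Sum>w\<in>T. p w * exp (D w))
      - q * (1 - q) / 2 * s\<^sup>2 * (\<Sum>w\<in>T. p w * l w)\<^sup>2)\<bar> \<le> 48 * s ^ 3 * exp (2 * B)"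
proof -
  define r where "r = (\<Sum>w\<in>T. p w * exp (D w))"
  define L where "L = (\<Sum>w\<in>T. p w * l w)"
  define \<theta> where "\<theta> = ln r"
  define b where "b = s * B"
  have b: "0 \<le> b" "b \<le> B" using s B by (auto simp: b_def mult_left_le_one_le)
  have mean_le: "\<bar>\<Sum>w\<in>T. p w * f w\<bar> \<le> C" if "\<And>w. w \<in> T \<Longrightarrow> \<bar>f w\<bar> \<le> C" for f C
  proof -
    have "\<bar>\<Sum>w\<in>T. p w * f w\<bar> \<le> (\<Sum>w\<in>T. p w * C)"
      by (rule sum_abs[THEN order_trans]) (intro sum_mono, simp add: abs_mult p(1) that mult_left_mono)
    also have "\<dots> = C" using p(2) by (simp add: sum_distrib_right[symmetric])
    finally show ?thesis .
  qed
  have r_le: "r \<le> exp b"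
  proof -
    have "r \<le> (\<Sum>w\<in>T. p w * exp b)"
      unfolding r_def using D p(1) by (intro sum_mono mult_left_mono) (auto simp: b_def abs_le_iff)
    also have "\<dots> = exp b" using p(2) by (simp add: sum_distrib_right[symmetric])
    finally show ?thesis .
  qed
  have r_ge: "r \<ge> exp (- b)"
  proof -
    have "exp (- b) = (\<Sum>w\<in>T. p w * exp (- b))" using p(2) by (simp add: sum_distrib_right[symmetric])
    also have "\<dots> \<le> r"
      unfolding r_def
    proof (intro sum_mono mult_left_mono)
      fix w assume "w \<in> T"
      from D[OF this] show "exp (- b) \<le> exp (D w)" by (simp add: b_def abs_le_iff)
    qed (use p(1) in auto)
    finally show ?thesis .
  qed
  have rpos: "r > 0" using r_ge exp_gt_zero[of "- b"] by linarith
  have r: "r = exp \<theta>" using rpos by (simp add: \<theta>_def)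
  have \<theta>: "\<bar>\<theta>\<bar> \<le> b" using r_le r_ge by (simp add: r abs_le_iff)
  have Lb: "\<bar>L\<bar> \<le> B" unfolding L_def by (rule mean_le) (rule l)
  have eb: "exp b \<le> exp B" "1 \<le> exp B" using b B by auto
  have sq_le: "x\<^sup>2 * exp \<bar>x\<bar> \<le> b\<^sup>2 * exp B" if "\<bar>x\<bar> \<le> b" for x
  proof (rule mult_mono)
    show "x\<^sup>2 \<le> b\<^sup>2" using power_mono[OF that, of 2] by simp
    show "exp \<bar>x\<bar> \<le> exp B" using that b by simp
  qed auto
  have cu_le: "\<bar>x\<bar> ^ 3 * exp \<bar>x\<bar> \<le> b ^ 3 * exp B" if "\<bar>x\<bar> \<le> b" for x
    using that b by (intro mult_mono power_mono) auto
  \<comment> \<open>The logarithm \<theta> is compared with s L in three moves: \<theta> with r - 1,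
    r - 1 with the \<open>p\<close>-mean of \<open>D\<close>, and that mean with s L. Each costs at
    most b^2 exp B.\<close>
  have lin: "\<bar>\<theta> - s * L\<bar> \<le> 3 * (b\<^sup>2 * exp B)"
  proof -
    have 1: "\<bar>r - 1 - \<theta>\<bar> \<le> b\<^sup>2 * exp B"
      using exp_taylor1[of \<theta>] sq_le[OF \<theta>] by (simp add: r)
    have "r - 1 - (\<Sum>w\<in>T. p w * D w) = (\<Sum>w\<in>T. p w * exp (D w)) - (\<Sum>w\<in>T. p w) - (\<Sum>w\<in>T. p w * D w)"
      by (simp add: r_def p(2))
    also have "\<dots> = (\<Sum>w\<in>T. p w * (exp (D w) - 1 - D w))"
      by (simp add: sum_subtractf right_diff_distrib)
    finally have 2: "\<bar>r - 1 - (\<Sum>w\<in>T. p w * D w)\<bar> \<le> b\<^sup>2 * exp B"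
      using mean_le[of "\<lambda>w. exp (D w) - 1 - D w" "b\<^sup>2 * exp B"] exp_taylor1 sq_le D
      unfolding b_def[symmetric] by (metis order_trans)
    have "(\<Sum>w\<in>T. p w * D w) - s * L = (\<Sum>w\<in>T. p w * (D w - s * l w))"
      by (simp add: L_def sum_subtractf algebra_simps sum_distrib_left)
    then have 3: "\<bar>(\<Sum>w\<in>T. p w * D w) - s * L\<bar> \<le> b\<^sup>2"
      using mean_le[of "\<lambda>w. D w - s * l w" "b\<^sup>2"] Dl unfolding b_def[symmetric] by simp
    have "b\<^sup>2 \<le> b\<^sup>2 * exp B" using eb(2) mult_left_mono[of 1 "exp B" "b\<^sup>2"] by simp
    with 1 2 3 show ?thesis by linarith
  qed
  have quad: "\<bar>\<theta>\<^sup>2 - s\<^sup>2 * L\<^sup>2\<bar> \<le> 6 * (b ^ 3 * exp B)"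
  proof -
    have "\<bar>s * L\<bar> \<le> b" using s Lb by (simp add: abs_mult b_def mult_left_mono)
    then have *: "\<bar>\<theta> + s * L\<bar> \<le> 2 * b" using \<theta> by linarith
    have "\<theta>\<^sup>2 - s\<^sup>2 * L\<^sup>2 = (\<theta> - s * L) * (\<theta> + s * L)" by (simp add: power2_eq_square algebra_simps)
    then have "\<bar>\<theta>\<^sup>2 - s\<^sup>2 * L\<^sup>2\<bar> = \<bar>\<theta> - s * L\<bar> * \<bar>\<theta> + s * L\<bar>" by (simp add: abs_mult)
    also have "\<dots> \<le> (3 * (b\<^sup>2 * exp B)) * (2 * b)" using lin * b by (intro mult_mono) auto
    finally show ?thesis by (simp add: power2_eq_square power3_eq_cube algebra_simps)
  qed
  have q\<theta>: "\<bar>q * \<theta>\<bar> \<le> b" using \<theta> q mult_mono[of q 1 "\<bar>\<theta>\<bar>" b] by (simp add: abs_mult)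
  have "r powr q = exp (q * \<theta>)" using rpos by (simp add: powr_def \<theta>_def)
  \<comment> \<open>With r^q = exp (q \<theta>) and r = exp \<theta> the affine terms cancel, and
    q^2 \<theta>^2 / 2 - q \<theta>^2 / 2 leaves the concavity term - q (1 - q) \<theta>^2 /
    2.\<close>
  then have "r powr q - ((1 - q) + q * r - q * (1 - q) / 2 * s\<^sup>2 * L\<^sup>2) =
      (exp (q * \<theta>) - 1 - q * \<theta> - (q * \<theta>)\<^sup>2 / 2) - q * (exp \<theta> - 1 - \<theta> - \<theta>\<^sup>2 / 2)
        - q * (1 - q) / 2 * (\<theta>\<^sup>2 - s\<^sup>2 * L\<^sup>2)"
    by (simp add: r power2_eq_square field_simps)
  then have "\<bar>r powr q - ((1 - q) + q * r - q * (1 - q) / 2 * s\<^sup>2 * L\<^sup>2)\<bar> \<le> \<bar>exp (q * \<theta>) - 1 - q * \<theta> - (q * \<theta>)\<^sup>2 / 2\<bar> + \<bar>q * (exp \<theta> - 1 - \<theta> - \<theta>\<^sup>2 / 2)\<bar>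
      + \<bar>q * (1 - q) / 2 * (\<theta>\<^sup>2 - s\<^sup>2 * L\<^sup>2)\<bar>" by linarith
  also have "\<dots> \<le> b ^ 3 * exp B + b ^ 3 * exp B + 6 * (b ^ 3 * exp B)"
  proof (intro add_mono)
    show "\<bar>exp (q * \<theta>) - 1 - q * \<theta> - (q * \<theta>)\<^sup>2 / 2\<bar> \<le> b ^ 3 * exp B"
      using exp_taylor2 cu_le[OF q\<theta>] by (rule order_trans)
    have "\<bar>exp \<theta> - 1 - \<theta> - \<theta>\<^sup>2 / 2\<bar> \<le> b ^ 3 * exp B"
      using exp_taylor2 cu_le[OF \<theta>] by (rule order_trans)
    then show "\<bar>q * (exp \<theta> - 1 - \<theta> - \<theta>\<^sup>2 / 2)\<bar> \<le> b ^ 3 * exp B"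
      using q mult_mono[of q 1 "\<bar>exp \<theta> - 1 - \<theta> - \<theta>\<^sup>2 / 2\<bar>" "b ^ 3 * exp B"] by (simp add: abs_mult)
    have "\<bar>q * (1 - q) / 2\<bar> \<le> 1" using q mult_mono[of q 1 "1 - q" 1] by (simp add: abs_mult)
    then show "\<bar>q * (1 - q) / 2 * (\<theta>\<^sup>2 - s\<^sup>2 * L\<^sup>2)\<bar> \<le> 6 * (b ^ 3 * exp B)"
      using quad mult_mono[of "\<bar>q * (1 - q) / 2\<bar>" 1 "\<bar>\<theta>\<^sup>2 - s\<^sup>2 * L\<^sup>2\<bar>" "6 * (b ^ 3 * exp B)"]
      unfolding abs_mult[of "q * (1 - q) / 2"] by simp
  qed
  also have "\<dots> = 8 * s ^ 3 * (B ^ 3 * exp B)" by (simp add: b_def power_mult_distrib)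
  \<comment> \<open>The cubic term of the exponential series gives B^3 <= 6 exp B. A purely
    exponential error suits the later use, where B is a multiple of an l1 norm with finite
    exponential moments.\<close>
  also have "\<dots> \<le> 8 * s ^ 3 * (6 * exp B * exp B)"
  proof -
    obtain t where "exp B = (\<Sum>m<4. B ^ m / fact m) + exp t / fact 4 * B ^ 4"
      using Maclaurin_exp_le[of B 4] by auto
    then have "exp B = 1 + B + B\<^sup>2 / 2 + B ^ 3 / 6 + exp t / 24 * B ^ 4"
      by (simp add: numeral_eq_Suc)
    moreover have "0 \<le> exp t / 24 * B ^ 4" "0 \<le> B\<^sup>2 / 2" by auto
    ultimately have "B ^ 3 / 6 \<le> exp B" using B by linarith
    then have "B ^ 3 \<le> 6 * exp B" by simp
    then show ?thesis using s by (intro mult_left_mono mult_right_mono) auto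
  qed
  also have "\<dots> = 48 * s ^ 3 * exp (2 * B)" by (simp add: mult_exp_exp)
  finally show ?thesis by (simp add: r_def L_def)
qed

section \<open>The smoothed Euclidean norm: Lipschitz bound and first-order expansion\<close>

definition smooth_norm :: "nat \<Rightarrow> (nat \<Rightarrow> real) \<Rightarrow> real" where
  "smooth_norm m v = sqrt (1 + (\<Sum>i<m. (v i)\<^sup>2))"

lemma smooth_norm_ge_1: "smooth_norm m v \<ge> 1"
  by (simp add: smooth_norm_def sum_nonneg)

lemma smooth_norm_sq: "(smooth_norm m v)\<^sup>2 = 1 + (\<Sum>i<m. (v i)\<^sup>2)"
  by (simp add: smooth_norm_def sum_nonneg add_nonneg_nonneg)

text \<open>The extra 1 becomes a fixed coordinate with index m, so that the triangle inequality of
  \<open>L2_set\<close> gives the Lipschitz bound.\<close>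

lemma smooth_norm_L2: "smooth_norm m v = L2_set (\<lambda>i. if i < m then v i else 1) {..m}"
  unfolding smooth_norm_def L2_set_def lessThan_Suc_atMost[symmetric] by (simp add: add.commute)

lemma smooth_norm_add_le: "smooth_norm m (\<lambda>i. v i + d i) \<le> smooth_norm m v + L2_set d {..<m}"
proof -
  have "smooth_norm m (\<lambda>i. v i + d i) = L2_set (\<lambda>i. (if i < m then v i else 1) + (if i < m then d i else 0)) {..m}"
    unfolding smooth_norm_L2 by (intro L2_set_cong) auto
  also have "\<dots> \<le> smooth_norm m v + L2_set (\<lambda>i. if i < m then d i else 0) {..m}"
    unfolding smooth_norm_L2 by (rule L2_set_triangle_ineq)
  also have "L2_set (\<lambda>i. if i < m then d i else 0) {..m} = L2_set d {..<m}"
    unfolding L2_set_def lessThan_Suc_atMost[symmetric] by simp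
  finally show ?thesis .
qed

lemma smooth_norm_lipschitz: "\<bar>smooth_norm m (\<lambda>i. v i + d i) - smooth_norm m v\<bar> \<le> L2_set d {..<m}"
  using smooth_norm_add_le[of m v d] smooth_norm_add_le[of m "\<lambda>i. v i + d i" "\<lambda>i. - d i"]
  by (simp add: L2_set_def)

definition smooth_dir :: "nat \<Rightarrow> (nat \<Rightarrow> real) \<Rightarrow> nat \<Rightarrow> real" where
  "smooth_dir m v i = v i / smooth_norm m v"

lemma smooth_dir_norm: "(\<Sum>i<m. (smooth_dir m v i)\<^sup>2) \<le> 1"
proof -
  have "(\<Sum>i<m. (smooth_dir m v i)\<^sup>2) = (\<Sum>i<m. (v i)\<^sup>2) / (smooth_norm m v)\<^sup>2"
    by (simp add: smooth_dir_def power_divide sum_divide_distrib)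
  also have "\<dots> \<le> 1" unfolding smooth_norm_sq by (simp add: sum_nonneg divide_le_eq_1 add_pos_nonneg)
  finally show ?thesis .
qed

text \<open>Since the square of the smoothed norm is a polynomial, the remainder is exactly (N^2 -
  (a' - a)^2) / (2 a). The Lipschitz bound keeps the numerator between 0 and N^2, and a >= 1 removes
  the denominator.\<close>

lemma smooth_norm_expansion:
  "\<bar>smooth_norm m (\<lambda>i. v i + d i) - smooth_norm m v - (\<Sum>i<m. smooth_dir m v i * d i)\<bar> \<le> (L2_set d {..<m})\<^sup>2"
proof -
  define a where "a = smooth_norm m v"
  define a' where "a' = smooth_norm m (\<lambda>i. v i + d i)"
  define N where "N = L2_set d {..<m}"
  define S where "S = (\<Sum>i<m. v i * d i)"
  have a: "a \<ge> 1" unfolding a_def by (rule smooth_norm_ge_1)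
  have N2: "N\<^sup>2 = (\<Sum>i<m. (d i)\<^sup>2)" unfolding N_def L2_set_def by (simp add: sum_nonneg)
  have "a'\<^sup>2 = a\<^sup>2 + 2 * S + N\<^sup>2"
    unfolding a'_def a_def smooth_norm_sq N2 S_def
    by (simp add: power2_sum sum.distrib sum_distrib_left algebra_simps)
  then have "a' - a - S / a = (N\<^sup>2 - (a' - a)\<^sup>2) / (2 * a)"
    using a by (simp add: field_simps power2_eq_square)
  moreover have "(\<Sum>i<m. smooth_dir m v i * d i) = S / a"
    by (simp add: smooth_dir_def S_def a_def sum_divide_distrib)
  moreover have "\<bar>(N\<^sup>2 - (a' - a)\<^sup>2) / (2 * a)\<bar> \<le> N\<^sup>2"
  proof -
    have "\<bar>a' - a\<bar> \<le> N" unfolding a'_def a_def N_def by (rule smooth_norm_lipschitz)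
    then have "(a' - a)\<^sup>2 \<le> N\<^sup>2" using power_mono[of "\<bar>a' - a\<bar>" N 2] by simp
    then have "\<bar>N\<^sup>2 - (a' - a)\<^sup>2\<bar> \<le> N\<^sup>2" by simp
    moreover have "N\<^sup>2 * 1 \<le> N\<^sup>2 * (2 * a)" using a by (intro mult_left_mono) auto
    ultimately show ?thesis using a by (simp add: abs_divide divide_le_eq)
  qed
  ultimately show ?thesis by (simp add: a_def a'_def N_def)
qed

section \<open>Exponents of the two processes and their increments\<close>

definition mat_vec :: "nat \<Rightarrow> (nat \<times> nat \<Rightarrow> real) \<Rightarrow> (nat \<Rightarrow> real) \<Rightarrow> nat \<Rightarrow> real" where
  "mat_vec n A w i = (\<Sum>j\<le>n. A (i, j) * w j)"

text \<open>Row m supplies the scalar term of either process, the rows i < m the vector under the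
  norm. Vectors carry a final entry at index n, equal to 1 in the intended use, through which column
  n enters as an independent vector.\<close>

definition gordon_exponent :: "real \<Rightarrow> nat \<Rightarrow> nat \<Rightarrow> (nat \<times> nat \<Rightarrow> real) \<Rightarrow> (nat \<Rightarrow> real) \<Rightarrow> real" where
  "gordon_exponent lam m n A w = - lam * (smooth_norm m (mat_vec n A w) + mat_vec n A w m)"

definition gordon_exponent_deriv :: "real \<Rightarrow> nat \<Rightarrow> nat \<Rightarrow> (nat \<times> nat \<Rightarrow> real) \<Rightarrow> (nat \<Rightarrow> real) \<Rightarrow> (nat \<times> nat \<Rightarrow> real) \<Rightarrow> real" where
  "gordon_exponent_deriv lam m n A w d =
     - lam * ((\<Sum>i<m. smooth_dir m (mat_vec n A w) i * mat_vec n d w i) + mat_vec n d w m)"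

lemma mat_vec_add: "mat_vec n (\<lambda>k. A k + s * d k) w i = mat_vec n A w i + s * mat_vec n d w i"
  by (simp add: mat_vec_def sum.distrib algebra_simps sum_distrib_left)

lemma mat_vec_abs_le:
  assumes "\<And>j. j \<le> n \<Longrightarrow> \<bar>w j\<bar> \<le> 1"
  shows "(\<Sum>i<m. \<bar>mat_vec n d w i\<bar>) + \<bar>mat_vec n d w m\<bar> \<le> (\<Sum>k\<in>{..m} \<times> {..n}. \<bar>d k\<bar>)"
proof -
  have "(\<Sum>i<m. \<bar>mat_vec n d w i\<bar>) + \<bar>mat_vec n d w m\<bar> = (\<Sum>i\<le>m. \<bar>mat_vec n d w i\<bar>)"
    by (simp add: lessThan_Suc_atMost[symmetric])
  also have "\<dots> \<le> (\<Sum>i\<le>m. \<Sum>j\<le>n. \<bar>d (i, j)\<bar>)"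
    unfolding mat_vec_def
  proof (intro sum_mono order_trans[OF sum_abs])
    fix i j assume "j \<in> {..n}"
    then show "\<bar>d (i, j) * w j\<bar> \<le> \<bar>d (i, j)\<bar>"
      using assms[of j] mult_left_mono[of "\<bar>w j\<bar>" 1 "\<bar>d (i, j)\<bar>"] by (simp add: abs_mult)
  qed
  also have "\<dots> = (\<Sum>k\<in>{..m} \<times> {..n}. \<bar>d k\<bar>)"
    by (simp add: sum.cartesian_product)
  finally show ?thesis .
qed

text \<open>The weight 1 + \<open>lam\<close> serves all three estimates: the first-order bounds use
  only \<open>lam\<close>, and the quadratic remainder fits into the square of \<open>s * b\<close>
  because lam <= (1 + lam)^2. The l1 norm of \<open>d\<close> is chosen because its exponential
  factorizes over the entries.\<close>

lemma
  fixes d :: "nat \<times> nat \<Rightarrow> real" and m n :: nat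
  assumes w: "\<And>j. j \<le> n \<Longrightarrow> \<bar>w j\<bar> \<le> 1" and lam: "lam \<ge> 0" and s: "0 \<le> s"
  defines "b \<equiv> (1 + lam) * (\<Sum>k\<in>{..m} \<times> {..n}. \<bar>d k\<bar>)"
  shows gordon_exponent_deriv_le: "\<bar>gordon_exponent_deriv lam m n A w d\<bar> \<le> b"
    and gordon_exponent_lipschitz:
      "\<bar>gordon_exponent lam m n (\<lambda>k. A k + s * d k) w - gordon_exponent lam m n A w\<bar> \<le> s * b"
    and gordon_exponent_expansion:
      "\<bar>gordon_exponent lam m n (\<lambda>k. A k + s * d k) w - gordon_exponent lam m n A w
        - s * gordon_exponent_deriv lam m n A w d\<bar> \<le> (s * b)\<^sup>2"
proof -
  define b0 where "b0 = (\<Sum>k\<in>{..m} \<times> {..n}. \<bar>d k\<bar>)"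
  define v where "v = mat_vec n A w"
  define e where "e = mat_vec n d w"
  have b0: "b0 \<ge> 0" unfolding b0_def by (simp add: sum_nonneg)
  have e: "(\<Sum>i<m. \<bar>e i\<bar>) + \<bar>e m\<bar> \<le> b0"
    unfolding e_def b0_def by (rule mat_vec_abs_le) (rule w)
  have e1: "(\<Sum>i<m. \<bar>e i\<bar>) \<le> b0" using e by linarith
  have lb: "lam * b0 \<le> b" unfolding b_def b0_def[symmetric] using b0 by (simp add: algebra_simps)
  have dir: "\<bar>smooth_dir m v i\<bar> \<le> 1" if "i < m" for i
  proof -
    have "(smooth_dir m v i)\<^sup>2 \<le> (\<Sum>i<m. (smooth_dir m v i)\<^sup>2)"
      using that by (intro member_le_sum) auto
    then have "(smooth_dir m v i)\<^sup>2 \<le> 1" using smooth_dir_norm[of m v] by linarith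
    then show ?thesis by (simp add: abs_square_le_1)
  qed
  have "\<bar>(\<Sum>i<m. smooth_dir m v i * e i) + e m\<bar> \<le> (\<Sum>i<m. \<bar>e i\<bar>) + \<bar>e m\<bar>"
  proof (rule order_trans[OF abs_triangle_ineq], rule add_right_mono, rule order_trans[OF sum_abs], rule sum_mono)
    fix i assume "i \<in> {..<m}"
    then show "\<bar>smooth_dir m v i * e i\<bar> \<le> \<bar>e i\<bar>"
      using dir[of i] mult_right_mono[of "\<bar>smooth_dir m v i\<bar>" 1 "\<bar>e i\<bar>"] by (simp add: abs_mult)
  qed
  then have "lam * \<bar>(\<Sum>i<m. smooth_dir m v i * e i) + e m\<bar> \<le> lam * b0"
    using e lam by (intro mult_left_mono) auto
  then show "\<bar>gordon_exponent_deriv lam m n A w d\<bar> \<le> b"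
    unfolding gordon_exponent_deriv_def v_def[symmetric] e_def[symmetric] using lam lb
    by (simp add: abs_mult)
  have mv: "mat_vec n (\<lambda>k. A k + s * d k) w = (\<lambda>i. v i + s * e i)"
    by (simp add: fun_eq_iff mat_vec_add v_def e_def)
  have L2: "L2_set (\<lambda>i. s * e i) {..<m} \<le> s * (\<Sum>i<m. \<bar>e i\<bar>)"
    using L2_set_le_sum_abs[of "\<lambda>i. s * e i" "{..<m}"] s by (simp add: abs_mult sum_distrib_left)
  have "\<bar>smooth_norm m (\<lambda>i. v i + s * e i) - smooth_norm m v + s * e m\<bar> \<le> s * b0"
  proof -
    have "\<bar>smooth_norm m (\<lambda>i. v i + s * e i) - smooth_norm m v\<bar> + \<bar>s * e m\<bar> \<le> s * ((\<Sum>i<m. \<bar>e i\<bar>) + \<bar>e m\<bar>)"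
      using smooth_norm_lipschitz[of m v "\<lambda>i. s * e i"] L2 s by (simp add: abs_mult algebra_simps)
    also have "\<dots> \<le> s * b0" using e s by (intro mult_left_mono)
    finally show ?thesis by linarith
  qed
  then have "lam * \<bar>smooth_norm m (\<lambda>i. v i + s * e i) - smooth_norm m v + s * e m\<bar> \<le> lam * (s * b0)"
    using lam by (intro mult_left_mono)
  also have "\<dots> = s * (lam * b0)" by simp
  also have "\<dots> \<le> s * b" using lb s by (intro mult_left_mono)
  finally have "\<bar>lam * (smooth_norm m (\<lambda>i. v i + s * e i) - smooth_norm m v + s * e m)\<bar> \<le> s * b"
    using lam by (simp add: abs_mult)
  moreover have "gordon_exponent lam m n (\<lambda>k. A k + s * d k) w - gordon_exponent lam m n A w
      = - (lam * (smooth_norm m (\<lambda>i. v i + s * e i) - smooth_norm m v + s * e m))"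
    unfolding gordon_exponent_def mv v_def[symmetric] by (simp add: algebra_simps)
  ultimately show "\<bar>gordon_exponent lam m n (\<lambda>k. A k + s * d k) w - gordon_exponent lam m n A w\<bar> \<le> s * b"
    by simp
  let ?R = "smooth_norm m (\<lambda>i. v i + s * e i) - smooth_norm m v - (\<Sum>i<m. smooth_dir m v i * (s * e i))"
  have "\<bar>?R\<bar> \<le> (s * b0)\<^sup>2"
  proof -
    have "L2_set (\<lambda>i. s * e i) {..<m} \<le> s * b0" using L2 mult_left_mono[OF e1 s] by linarith
    then have "(L2_set (\<lambda>i. s * e i) {..<m})\<^sup>2 \<le> (s * b0)\<^sup>2" by (intro power_mono) auto
    then show ?thesis using smooth_norm_expansion[of m v "\<lambda>i. s * e i"] by linarith
  qed
  then have "lam * \<bar>?R\<bar> \<le> lam * (s * b0)\<^sup>2" using lam by (intro mult_left_mono)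
  also have "\<dots> \<le> (1 + lam)\<^sup>2 * (s * b0)\<^sup>2"
  proof (rule mult_right_mono)
    show "lam \<le> (1 + lam)\<^sup>2" using lam by (simp add: power2_eq_square algebra_simps)
  qed simp
  also have "\<dots> = (s * b)\<^sup>2" by (simp add: b_def b0_def power_mult_distrib)
  finally have "\<bar>lam * ?R\<bar> \<le> (s * b)\<^sup>2" using lam by (simp add: abs_mult)
  moreover have "gordon_exponent lam m n (\<lambda>k. A k + s * d k) w - gordon_exponent lam m n A w
        - s * gordon_exponent_deriv lam m n A w d = - (lam * ?R)"
    unfolding gordon_exponent_def gordon_exponent_deriv_def mv v_def[symmetric] e_def[symmetric]
    by (simp add: algebra_simps sum_distrib_left sum_negf)
  ultimately show "\<bar>gordon_exponent lam m n (\<lambda>k. A k + s * d k) w - gordon_exponent lam m n A w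
        - s * gordon_exponent_deriv lam m n A w d\<bar> \<le> (s * b)\<^sup>2" by simp
qed

section \<open>Gordon's comparison inequality\<close>

lemma sum_atMost_eq_lessThan_add: "(\<Sum>j\<le>n. f j) = (\<Sum>j<n. f j) + f n" for f :: "nat \<Rightarrow> real"
  by (simp add: lessThan_Suc_atMost[symmetric])

lemma sum_prod_le_1:
  fixes f g :: "nat \<Rightarrow> real"
  assumes "(\<Sum>i<n. (f i)\<^sup>2) \<le> 1" "(\<Sum>i<n. (g i)\<^sup>2) \<le> 1"
  shows "(\<Sum>i<n. f i * g i) \<le> 1"
proof -
  have "(\<Sum>i<n. f i * g i) \<le> (\<Sum>i<n. ((f i)\<^sup>2 + (g i)\<^sup>2) / 2)"
    using sum_squares_bound by (intro sum_mono) (simp add: mult.assoc field_simps)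
  also have "\<dots> \<le> 1" using assms by (simp add: sum.distrib sum_divide_distrib[symmetric])
  finally show ?thesis .
qed

text \<open>On the index set \<open>{..m} \<times> {..n}\<close> the first block carries an \<open>m \<times> n\<close> matrix and the scalar in
  the corner \<open>(m, n)\<close>, the second one the vector in column \<open>n\<close> and the vector in row \<open>m\<close>: for a
  vector \<open>w\<close> with \<open>w n = 1\<close>, multiplying by the masked matrix gives Gordon's two processes.\<close>
definition gordon_block :: "nat \<Rightarrow> nat \<Rightarrow> bool \<Rightarrow> nat \<times> nat \<Rightarrow> real" where
  "gordon_block m n c k = of_bool (((fst k < m) = (snd k < n)) = c)"

text \<open>\<open>lam\<close> plays the role of c/q. The range of \<open>q\<close> makes the power
  concave, which decides the direction of the comparison.\<close>

locale gordon =
  fixes T :: "(nat \<Rightarrow> real) set" and m n :: nat and lam q :: real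
  assumes finite_T: "finite T" and T_ne: "T \<noteq> {}"
    and T_last: "\<And>w. w \<in> T \<Longrightarrow> w n = 1" and T_unit: "\<And>w. w \<in> T \<Longrightarrow> (\<Sum>j<n. (w j)\<^sup>2) = 1"
    and lam: "lam \<ge> 0" and q: "0 \<le> q" "q \<le> 1"
begin

abbreviation K :: "(nat \<times> nat) set" where "K \<equiv> {..m} \<times> {..n}"
abbreviation E where "E \<equiv> gordon_exponent lam m n"
abbreviation E' where "E' \<equiv> gordon_exponent_deriv lam m n"
abbreviation blk where "blk \<equiv> gordon_block m n"

definition M :: "(nat \<times> nat \<Rightarrow> real) \<Rightarrow> real" where
  "M A = (\<Sum>w\<in>T. exp (E A w))"

definition f :: "(nat \<times> nat \<Rightarrow> real) \<Rightarrow> real" where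
  "f A = M A powr q"

definition size :: "(nat \<times> nat \<Rightarrow> real) \<Rightarrow> real" where
  "size d = (1 + lam) * (\<Sum>k\<in>K. \<bar>d k\<bar>)"

text \<open>Gaussian mean of the error exp (2 B) of the expansion, at B = \<open>size\<close>. It
  does not involve the base point, which makes the swapping steps uniform.\<close>

definition G :: real where
  "G = (\<integral>\<omega>. exp (2 * size \<omega>) \<partial>gauss_PiM K)"

lemma T_le_1:
  assumes "w \<in> T" "j \<le> n" shows "\<bar>w j\<bar> \<le> 1"
proof (cases "j = n")
  case False
  then have "(w j)\<^sup>2 \<le> (\<Sum>j<n. (w j)\<^sup>2)" using assms by (intro member_le_sum) auto
  then show ?thesis using T_unit[OF assms(1)] by (simp add: abs_square_le_1)
next
  case True
  then show ?thesis using T_last[OF assms(1)] by simp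
qed

lemma M_pos: "M A > 0"
  unfolding M_def using finite_T T_ne by (intro sum_pos) auto

lemma f_pos: "f A > 0"
  unfolding f_def using M_pos[of A] by simp

lemma size_nonneg: "size d \<ge> 0"
  unfolding size_def using lam by (intro mult_nonneg_nonneg) (auto simp: sum_nonneg)

lemma size_mono:
  assumes "\<And>k. k \<in> K \<Longrightarrow> \<bar>d k\<bar> \<le> \<bar>e k\<bar>"
  shows "size d \<le> size e"
  unfolding size_def using lam assms by (intro mult_left_mono sum_mono) auto

lemma blk_cases: "blk c k = 0 \<or> blk c k = 1"
  by (auto simp: gordon_block_def)

lemma size_blk: "size (\<lambda>k. blk c k * \<omega> k) \<le> size \<omega>"
proof (rule size_mono)
  fix k show "\<bar>blk c k * \<omega> k\<bar> \<le> \<bar>\<omega> k\<bar>" using blk_cases[of c k] by auto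
qed

text \<open>Points of the product space are \<open>undefined\<close> outside \<open>K\<close>,
  whereas masked or shifted matrices are not; as \<open>f\<close> reads only entries in
  \<open>K\<close>, restricting its argument is harmless.\<close>

lemma f_cong:
  assumes "\<And>k. k \<in> K \<Longrightarrow> A k = B k"
  shows "f A = f B"
proof -
  have "mat_vec n A w i = mat_vec n B w i" if "i \<le> m" for w i
    using assms that by (auto simp: mat_vec_def intro!: sum.cong)
  then have "E A w = E B w" for w
    by (auto simp: gordon_exponent_def smooth_norm_def)
  then show ?thesis by (simp add: f_def M_def)
qed

lemma exp_E_measurable:
  assumes B: "\<And>k. k \<in> K \<Longrightarrow> (\<lambda>\<omega>. B \<omega> k) \<in> borel_measurable N"
  shows "(\<lambda>\<omega>. exp (E (B \<omega>) w)) \<in> borel_measurable N"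
proof -
  have mv: "(\<lambda>\<omega>. mat_vec n (B \<omega>) w i) \<in> borel_measurable N" if "i \<le> m" for i
    unfolding mat_vec_def using that by (intro borel_measurable_sum borel_measurable_times B) auto
  have [measurable]: "(\<lambda>\<omega>. smooth_norm m (mat_vec n (B \<omega>) w)) \<in> borel_measurable N"
    unfolding smooth_norm_def
    by (rule measurable_compose[OF _ borel_measurable_sqrt])
       (intro borel_measurable_add borel_measurable_sum borel_measurable_power borel_measurable_const mv, simp)
  note [measurable] = mv[OF order_refl]
  show ?thesis unfolding gordon_exponent_def by measurable
qed

lemma f_measurable:
  assumes "\<And>k. k \<in> K \<Longrightarrow> (\<lambda>\<omega>. B \<omega> k) \<in> borel_measurable N"
  shows "(\<lambda>\<omega>. f (B \<omega>)) \<in> borel_measurable N"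
proof -
  have [measurable]: "(\<lambda>\<omega>. M (B \<omega>)) \<in> borel_measurable N"
    unfolding M_def by (intro borel_measurable_sum exp_E_measurable assms)
  show ?thesis unfolding f_def by measurable
qed

lemma exp_E_growth:
  assumes "w \<in> T"
  shows "exp (E (\<lambda>k. A k + d k) w) \<le> exp (E A w) * exp (size d)"
  using gordon_exponent_lipschitz[of n w lam 1 m A d] T_le_1[OF assms] lam
  unfolding size_def exp_add[symmetric] by (simp add: abs_le_iff)

text \<open>Each summand of \<open>M\<close> grows by a factor of at most
  \<open>exp (size d)\<close>, and a power q <= 1 cannot enlarge that factor. This gives the
  dominating function for integrability and a bound on \<open>f\<close> valid along the whole
  interpolation.\<close>

lemma f_growth: "f (\<lambda>k. A k + d k) \<le> f A * exp (size d)"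
proof -
  have "M (\<lambda>k. A k + d k) \<le> M A * exp (size d)"
    unfolding M_def sum_distrib_right by (intro sum_mono exp_E_growth)
  then have "f (\<lambda>k. A k + d k) \<le> (M A * exp (size d)) powr q"
    unfolding f_def using q M_pos[of "\<lambda>k. A k + d k"] by (intro powr_mono2) auto
  also have "\<dots> = f A * exp (q * size d)"
    unfolding f_def using M_pos[of A] by (simp add: powr_mult exp_powr_real mult.commute)
  also have "\<dots> \<le> f A * exp (size d)"
    using q size_nonneg[of d] f_pos[of A] mult_right_mono[of q 1 "size d"] by (intro mult_left_mono) auto
  finally show ?thesis .
qed

lemma integrable_exp_size: "integrable (gauss_PiM K) (\<lambda>\<omega>. exp (c * size \<omega>))"
  using integrable_gauss_PiM_exp_abs[of K "c * (1 + lam)"] by (simp add: size_def mult.assoc)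

lemma gauss_PiM_measurable_affine:
  "k \<in> K \<Longrightarrow> (\<lambda>\<omega>. A k + s * (blk c k * \<omega> k)) \<in> borel_measurable (gauss_PiM K)"
  by (intro borel_measurable_add borel_measurable_times measurable_gauss_PiM_component) auto

lemma
  assumes s: "0 \<le> s" "s \<le> 1"
  shows integrable_f: "integrable (gauss_PiM K) (\<lambda>\<omega>. f (\<lambda>k. A k + s * (blk c k * \<omega> k)))"
    and integrable_exp_E: "w \<in> T \<Longrightarrow> integrable (gauss_PiM K) (\<lambda>\<omega>. exp (E (\<lambda>k. A k + s * (blk c k * \<omega> k)) w))"
proof -
  have sz: "size (\<lambda>k. s * (blk c k * \<omega> k)) \<le> size \<omega>" for \<omega>
  proof (rule size_mono)
    fix k show "\<bar>s * (blk c k * \<omega> k)\<bar> \<le> \<bar>\<omega> k\<bar>"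
      using blk_cases[of c k] s mult_right_mono[of s 1 "\<bar>\<omega> k\<bar>"] by (auto simp: abs_mult)
  qed
  have I: "integrable (gauss_PiM K) (\<lambda>\<omega>. a * exp (size \<omega>))" for a
    using integrable_exp_size[of 1] by simp
  show "integrable (gauss_PiM K) (\<lambda>\<omega>. f (\<lambda>k. A k + s * (blk c k * \<omega> k)))"
  proof (rule Bochner_Integration.integrable_bound[OF I[of "f A"]])
    show "AE \<omega> in gauss_PiM K. norm (f (\<lambda>k. A k + s * (blk c k * \<omega> k))) \<le> norm (f A * exp (size \<omega>))"
    proof (rule AE_I2)
      fix \<omega>
      have "f (\<lambda>k. A k + s * (blk c k * \<omega> k)) \<le> f A * exp (size (\<lambda>k. s * (blk c k * \<omega> k)))" by (rule f_growth)
      also have "\<dots> \<le> f A * exp (size \<omega>)" using sz f_pos[of A] by simp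
      finally show "norm (f (\<lambda>k. A k + s * (blk c k * \<omega> k))) \<le> norm (f A * exp (size \<omega>))"
        using f_pos[of "\<lambda>k. A k + s * (blk c k * \<omega> k)"] f_pos[of A] by simp
    qed
  qed (rule f_measurable, rule gauss_PiM_measurable_affine)
  show "integrable (gauss_PiM K) (\<lambda>\<omega>. exp (E (\<lambda>k. A k + s * (blk c k * \<omega> k)) w))" if "w \<in> T"
  proof (rule Bochner_Integration.integrable_bound[OF I[of "exp (E A w)"]])
    show "AE \<omega> in gauss_PiM K. norm (exp (E (\<lambda>k. A k + s * (blk c k * \<omega> k)) w)) \<le> norm (exp (E A w) * exp (size \<omega>))"
    proof (rule AE_I2)
      fix \<omega>
      have "exp (E (\<lambda>k. A k + s * (blk c k * \<omega> k)) w) \<le> exp (E A w) * exp (size (\<lambda>k. s * (blk c k * \<omega> k)))"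
        by (rule exp_E_growth[OF that])
      also have "\<dots> \<le> exp (E A w) * exp (size \<omega>)" using sz by simp
      finally show "norm (exp (E (\<lambda>k. A k + s * (blk c k * \<omega> k)) w)) \<le> norm (exp (E A w) * exp (size \<omega>))"
        by simp
    qed
  qed (rule exp_E_measurable, rule gauss_PiM_measurable_affine)
qed

text \<open>Gibbs weights of the exponents: the logarithmic derivative of \<open>M\<close> is the
  mean of \<open>E'\<close> under them.\<close>

definition p :: "(nat \<times> nat \<Rightarrow> real) \<Rightarrow> (nat \<Rightarrow> real) \<Rightarrow> real" where
  "p A w = exp (E A w) / M A"

lemma p_nonneg: "p A w \<ge> 0"
  using M_pos[of A] by (simp add: p_def)

lemma sum_p: "(\<Sum>w\<in>T. p A w) = 1"
  using M_pos[of A] by (simp add: p_def sum_divide_distrib[symmetric] M_def)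

definition dir :: "(nat \<times> nat \<Rightarrow> real) \<Rightarrow> (nat \<Rightarrow> real) \<Rightarrow> nat \<Rightarrow> real" where
  "dir A w i = (if i < m then smooth_dir m (mat_vec n A w) i else 1)"

text \<open>Gradient of \<open>ln M\<close> in the matrix entries; \<open>dir\<close> is 1 at index
  m because row m enters the exponent linearly.\<close>

definition grad :: "(nat \<times> nat \<Rightarrow> real) \<Rightarrow> nat \<times> nat \<Rightarrow> real" where
  "grad A k = - lam * (\<Sum>w\<in>T. p A w * (dir A w (fst k) * w (snd k)))"

lemma sum_p_E': "(\<Sum>w\<in>T. p A w * E' A w d) = (\<Sum>k\<in>K. grad A k * d k)"
proof -
  have "E' A w d = (\<Sum>k\<in>K. - lam * (dir A w (fst k) * w (snd k)) * d k)" for w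
  proof -
    have "E' A w d = - lam * (\<Sum>i\<le>m. dir A w i * mat_vec n d w i)"
      by (simp add: gordon_exponent_deriv_def sum_atMost_eq_lessThan_add dir_def)
    also have "\<dots> = (\<Sum>i\<le>m. \<Sum>j\<le>n. - lam * (dir A w i * w j) * d (i, j))"
      by (simp add: mat_vec_def sum_distrib_left mult_ac)
    finally show ?thesis by (simp add: sum.cartesian_product split_beta)
  qed
  then have "(\<Sum>w\<in>T. p A w * E' A w d) = (\<Sum>w\<in>T. \<Sum>k\<in>K. p A w * (- lam * (dir A w (fst k) * w (snd k)) * d k))"
    by (simp add: sum_distrib_left)
  also have "\<dots> = (\<Sum>k\<in>K. \<Sum>w\<in>T. p A w * (- lam * (dir A w (fst k) * w (snd k)) * d k))"
    by (rule sum.swap)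
  also have "\<dots> = (\<Sum>k\<in>K. grad A k * d k)"
    unfolding grad_def by (intro sum.cong refl) (simp add: sum_distrib_left sum_distrib_right mult_ac)
  finally show ?thesis .
qed

text \<open>Once the squares are expanded over pairs w, w', the signed sum over entries factors into
  a row sum and a column sum. Each is an inner product of vectors of length at most 1, minus 1 from
  the last index, hence nonpositive, so the product is nonnegative.\<close>

lemma grad_blocks: "(\<Sum>k\<in>K. (grad A k * blk False k)\<^sup>2) \<le> (\<Sum>k\<in>K. (grad A k * blk True k)\<^sup>2)"
proof -
  \<comment> \<open>The sign a i * b j is 1 on the block \<open>True\<close> and -1 on the block
    \<open>False\<close>, and it separates rows from columns.\<close>
  define a b :: "nat \<Rightarrow> real" where "a i = (if i < m then 1 else - 1)" and "b j = (if j < n then 1 else - 1)" for i j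
  have "(\<Sum>k\<in>K. (grad A k * blk True k)\<^sup>2) - (\<Sum>k\<in>K. (grad A k * blk False k)\<^sup>2)
      = (\<Sum>k\<in>K. a (fst k) * b (snd k) * (grad A k)\<^sup>2)"
    unfolding sum_subtractf[symmetric] by (intro sum.cong) (auto simp: a_def b_def gordon_block_def)
  also have "\<dots> = lam\<^sup>2 * (\<Sum>k\<in>K. \<Sum>w\<in>T. \<Sum>w'\<in>T. p A w * p A w' *
      (a (fst k) * (dir A w (fst k) * dir A w' (fst k)) * (b (snd k) * (w (snd k) * w' (snd k)))))"
    unfolding grad_def power2_eq_square
    by (simp add: sum_distrib_left sum_distrib_right mult_ac)
  also have "(\<Sum>k\<in>K. \<Sum>w\<in>T. \<Sum>w'\<in>T. p A w * p A w' *
      (a (fst k) * (dir A w (fst k) * dir A w' (fst k)) * (b (snd k) * (w (snd k) * w' (snd k)))))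
    = (\<Sum>w\<in>T. \<Sum>w'\<in>T. \<Sum>k\<in>K. p A w * p A w' *
      (a (fst k) * (dir A w (fst k) * dir A w' (fst k)) * (b (snd k) * (w (snd k) * w' (snd k)))))"
    by (subst sum.swap, intro sum.cong refl, rule sum.swap)
  also have "\<dots> = (\<Sum>w\<in>T. \<Sum>w'\<in>T. p A w * p A w' *
      ((\<Sum>i\<le>m. a i * (dir A w i * dir A w' i)) * (\<Sum>j\<le>n. b j * (w j * w' j))))"
  proof (intro sum.cong refl)
    fix w w'
    have "(\<Sum>i\<le>m. a i * (dir A w i * dir A w' i)) * (\<Sum>j\<le>n. b j * (w j * w' j)) =
        (\<Sum>k\<in>K. a (fst k) * (dir A w (fst k) * dir A w' (fst k)) * (b (snd k) * (w (snd k) * w' (snd k))))"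
      unfolding sum_product by (simp add: sum.cartesian_product split_beta)
    then show "(\<Sum>k\<in>K. p A w * p A w' *
        (a (fst k) * (dir A w (fst k) * dir A w' (fst k)) * (b (snd k) * (w (snd k) * w' (snd k))))) =
      p A w * p A w' * ((\<Sum>i\<le>m. a i * (dir A w i * dir A w' i)) * (\<Sum>j\<le>n. b j * (w j * w' j)))"
      by (simp only: sum_distrib_left)
  qed
  finally have eq: "(\<Sum>k\<in>K. (grad A k * blk True k)\<^sup>2) - (\<Sum>k\<in>K. (grad A k * blk False k)\<^sup>2) = lam\<^sup>2 * (\<Sum>w\<in>T. \<Sum>w'\<in>T. p A w * p A w' *
      ((\<Sum>i\<le>m. a i * (dir A w i * dir A w' i)) * (\<Sum>j\<le>n. b j * (w j * w' j))))" .
  have "0 \<le> (\<Sum>w\<in>T. \<Sum>w'\<in>T. p A w * p A w' *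
      ((\<Sum>i\<le>m. a i * (dir A w i * dir A w' i)) * (\<Sum>j\<le>n. b j * (w j * w' j))))"
  proof (intro sum_nonneg mult_nonneg_nonneg[of "p A _ * p A _"] mult_nonneg_nonneg[of "p A _" "p A _"] p_nonneg)
    fix w w' assume w: "w \<in> T" "w' \<in> T"
    have "(\<Sum>i\<le>m. a i * (dir A w i * dir A w' i)) =
        (\<Sum>i<m. smooth_dir m (mat_vec n A w) i * smooth_dir m (mat_vec n A w') i) - 1"
      by (simp add: sum_atMost_eq_lessThan_add a_def dir_def)
    also have "\<dots> \<le> 0" using sum_prod_le_1[OF smooth_dir_norm smooth_dir_norm] by simp
    finally have 1: "(\<Sum>i\<le>m. a i * (dir A w i * dir A w' i)) \<le> 0" .
    have "(\<Sum>j\<le>n. b j * (w j * w' j)) = (\<Sum>j<n. w j * w' j) - 1"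
      using T_last[OF w(1)] T_last[OF w(2)] by (simp add: sum_atMost_eq_lessThan_add b_def)
    also have "\<dots> \<le> 0" using sum_prod_le_1[of w n w'] T_unit[OF w(1)] T_unit[OF w(2)] by simp
    finally show "0 \<le> (\<Sum>i\<le>m. a i * (dir A w i * dir A w' i)) * (\<Sum>j\<le>n. b j * (w j * w' j))"
      using 1 by (intro mult_nonpos_nonpos)
  qed
  then have "0 \<le> lam\<^sup>2 * (\<Sum>w\<in>T. \<Sum>w'\<in>T. p A w * p A w' *
      ((\<Sum>i\<le>m. a i * (dir A w i * dir A w' i)) * (\<Sum>j\<le>n. b j * (w j * w' j))))" by simp
  then show ?thesis unfolding eq[symmetric] by simp
qed

lemma f_expansion:
  assumes s: "0 \<le> s" "s \<le> 1"
  shows "\<bar>f (\<lambda>k. A k + s * d k) - f A * ((1 - q) + q * (M (\<lambda>k. A k + s * d k) / M A)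
      - q * (1 - q) / 2 * s\<^sup>2 * (\<Sum>k\<in>K. grad A k * d k)\<^sup>2)\<bar> \<le> f A * (48 * s ^ 3 * exp (2 * size d))"
proof -
  let ?D = "\<lambda>w. E (\<lambda>k. A k + s * d k) w - E A w"
  have r: "(\<Sum>w\<in>T. p A w * exp (?D w)) = M (\<lambda>k. A k + s * d k) / M A"
    by (simp add: p_def M_def[of "\<lambda>k. A k + s * d k"] exp_diff sum_divide_distrib)
  have "\<bar>(\<Sum>w\<in>T. p A w * exp (?D w)) powr q - ((1 - q) + q * (\<Sum>w\<in>T. p A w * exp (?D w))
      - q * (1 - q) / 2 * s\<^sup>2 * (\<Sum>w\<in>T. p A w * E' A w d)\<^sup>2)\<bar> \<le> 48 * s ^ 3 * exp (2 * size d)"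
    using p_nonneg sum_p q s size_nonneg
  proof (rule sum_exp_powr_expansion)
    fix w assume w: "w \<in> T"
    note * = T_le_1[OF w] lam s(1)
    show "\<bar>E' A w d\<bar> \<le> size d" unfolding size_def by (rule gordon_exponent_deriv_le[OF *]) 
    show "\<bar>?D w\<bar> \<le> s * size d" unfolding size_def by (rule gordon_exponent_lipschitz[OF *])
    show "\<bar>?D w - s * E' A w d\<bar> \<le> (s * size d)\<^sup>2" unfolding size_def by (rule gordon_exponent_expansion[OF *])
  qed
  then have "\<bar>(M (\<lambda>k. A k + s * d k) / M A) powr q - ((1 - q) + q * (M (\<lambda>k. A k + s * d k) / M A)
      - q * (1 - q) / 2 * s\<^sup>2 * (\<Sum>k\<in>K. grad A k * d k)\<^sup>2)\<bar> \<le> 48 * s ^ 3 * exp (2 * size d)"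
    unfolding r sum_p_E' .
  moreover have "(M (\<lambda>k. A k + s * d k) / M A) powr q = f (\<lambda>k. A k + s * d k) / f A"
    unfolding f_def using M_pos[of A] M_pos[of "\<lambda>k. A k + s * d k"] by (simp add: powr_divide)
  ultimately have "f A * \<bar>f (\<lambda>k. A k + s * d k) / f A - ((1 - q) + q * (M (\<lambda>k. A k + s * d k) / M A)
      - q * (1 - q) / 2 * s\<^sup>2 * (\<Sum>k\<in>K. grad A k * d k)\<^sup>2)\<bar> \<le> f A * (48 * s ^ 3 * exp (2 * size d))"
    using f_pos[of A] by (intro mult_left_mono) auto
  moreover have "f A * \<bar>x / f A - y\<bar> = \<bar>x - f A * y\<bar>" for x y
  proof -
    have "f A * \<bar>x / f A - y\<bar> = \<bar>f A * (x / f A - y)\<bar>" using f_pos[of A] by (simp add: abs_mult)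
    also have "f A * (x / f A - y) = x - f A * y" using f_pos[of A] by (simp add: right_diff_distrib)
    finally show ?thesis .
  qed
  ultimately show ?thesis by simp
qed

text \<open>For i < m the block \<open>True\<close> keeps the first n entries of w, a unit vector,
  and drops the final 1; for i = m it keeps only that 1. The block \<open>False\<close> does the
  opposite.\<close>

lemma blk_row:
  assumes "w \<in> T" "i \<in> {..m}"
  shows "(\<Sum>j\<in>{..n}. (blk c (i, j) * w j)\<^sup>2) = 1"
  using assms T_last[OF assms(1)] T_unit[OF assms(1)]
  by (cases c; cases "i < m") (simp_all add: sum_atMost_eq_lessThan_add gordon_block_def)

text \<open>For a single unit vector both blocks produce a standard Gaussian vector, so \<open>M\<close>, unlike \<open>f\<close>,
  does not distinguish them.\<close>
lemma integral_exp_E_blocks: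
  assumes "w \<in> T" "0 \<le> s" "s \<le> 1"
  shows "(\<integral>\<omega>. exp (E (\<lambda>k. A k + s * (blk True k * \<omega> k)) w) \<partial>gauss_PiM K) =
    (\<integral>\<omega>. exp (E (\<lambda>k. A k + s * (blk False k * \<omega> k)) w) \<partial>gauss_PiM K)"
proof -
  define F where "F = (\<lambda>z. exp (- lam * (smooth_norm m (\<lambda>i. mat_vec n A w i + s * z i) + (mat_vec n A w m + s * z m))))"
  have F: "F \<in> borel_measurable (\<Pi>\<^sub>M i\<in>{..m}. borel)"
    unfolding F_def smooth_norm_def by measurable
  have "(\<integral>\<omega>. exp (E (\<lambda>k. A k + s * (blk c k * \<omega> k)) w) \<partial>gauss_PiM K) = (\<integral>z. F z \<partial>gauss_PiM {..m})" for c
  proof -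
    let ?r = "\<lambda>\<omega>. \<lambda>i\<in>{..m}. \<Sum>j\<in>{..n}. (blk c (i, j) * w j) * \<omega> (i, j)"
    have "mat_vec n (\<lambda>k. A k + s * (blk c k * \<omega> k)) w i = mat_vec n A w i + s * ?r \<omega> i" if "i \<le> m" for \<omega> i
      using that unfolding mat_vec_add by (simp add: mat_vec_def mult_ac)
    then have *: "exp (E (\<lambda>k. A k + s * (blk c k * \<omega> k)) w) = F (?r \<omega>)" for \<omega>
      unfolding gordon_exponent_def F_def smooth_norm_def by simp
    have "(\<integral>z. F z \<partial>gauss_PiM {..m}) = (\<integral>z. F z \<partial>distr (gauss_PiM K) (\<Pi>\<^sub>M i\<in>{..m}. borel) ?r)"
      using blk_row[OF \<open>w \<in> T\<close>] by (subst distr_gauss_PiM_rows) auto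
    also have "\<dots> = (\<integral>\<omega>. F (?r \<omega>) \<partial>gauss_PiM K)"
    proof (rule integral_distr)
      show "?r \<in> gauss_PiM K \<rightarrow>\<^sub>M (\<Pi>\<^sub>M i\<in>{..m}. borel)"
        by (intro measurable_restrict borel_measurable_sum borel_measurable_times measurable_gauss_PiM_component) auto
    qed (rule F)
    finally show ?thesis by (simp only: *)
  qed
  then show ?thesis by metis
qed

lemma integral_M_blocks:
  assumes "0 \<le> s" "s \<le> 1"
  shows "(\<integral>\<omega>. M (\<lambda>k. A k + s * (blk True k * \<omega> k)) \<partial>gauss_PiM K) =
    (\<integral>\<omega>. M (\<lambda>k. A k + s * (blk False k * \<omega> k)) \<partial>gauss_PiM K)"
  unfolding M_def using assms
  by (subst (1 2) Bochner_Integration.integral_sum) (auto intro!: integrable_exp_E sum.cong integral_exp_E_blocks)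

text \<open>The two quadratic approximations \<open>Q\<close> contain the same mean of
  \<open>M\<close>, so their expectations differ only in the subtracted second moment, which is the
  larger one for \<open>True\<close>. Replacing \<open>f\<close> by \<open>Q\<close> twice, at 48
  s^3 each, gives the constant 96.\<close>

lemma f_swap_step:
  assumes s: "0 \<le> s" "s \<le> 1"
  shows "(\<integral>\<omega>. f (\<lambda>k. A k + s * (blk True k * \<omega> k)) \<partial>gauss_PiM K) \<le>
    (\<integral>\<omega>. f (\<lambda>k. A k + s * (blk False k * \<omega> k)) \<partial>gauss_PiM K) + f A * (96 * s ^ 3 * G)"
proof -
  interpret prob_space "gauss_PiM K" by (rule prob_space_gauss_PiM)
  define Q where "Q c \<omega> = f A * ((1 - q) + q * (M (\<lambda>k. A k + s * (blk c k * \<omega> k)) / M A)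
      - q * (1 - q) / 2 * s\<^sup>2 * (\<Sum>k\<in>K. (grad A k * blk c k) * \<omega> k)\<^sup>2)" for c \<omega>
  have bound: "\<bar>f (\<lambda>k. A k + s * (blk c k * \<omega> k)) - Q c \<omega>\<bar> \<le> f A * (48 * s ^ 3) * exp (2 * size \<omega>)" for c \<omega>
  proof -
    have "\<bar>f (\<lambda>k. A k + s * (blk c k * \<omega> k)) - Q c \<omega>\<bar> \<le> f A * (48 * s ^ 3 * exp (2 * size (\<lambda>k. blk c k * \<omega> k)))"
      using f_expansion[OF s, of A "\<lambda>k. blk c k * \<omega> k"] unfolding Q_def by (simp add: mult.assoc)
    also have "\<dots> \<le> f A * (48 * s ^ 3 * exp (2 * size \<omega>))"
      using size_blk[of c \<omega>] f_pos[of A] s by (intro mult_left_mono) auto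
    finally show ?thesis by (simp add: mult.assoc)
  qed
  have iM: "integrable (gauss_PiM K) (\<lambda>\<omega>. M (\<lambda>k. A k + s * (blk c k * \<omega> k)))" for c
    unfolding M_def using s by (intro Bochner_Integration.integrable_sum integrable_exp_E)
  have iL: "integrable (gauss_PiM K) (\<lambda>\<omega>. (\<Sum>k\<in>K. (grad A k * blk c k) * \<omega> k)\<^sup>2)" for c
    by (rule integrable_gauss_PiM_linear_sq) simp
  have iQ: "integrable (gauss_PiM K) (Q c)" for c
    unfolding Q_def using iM iL by auto
  have QE: "(\<integral>\<omega>. Q c \<omega> \<partial>gauss_PiM K) = f A * ((1 - q) + q * ((\<integral>\<omega>. M (\<lambda>k. A k + s * (blk c k * \<omega> k)) \<partial>gauss_PiM K) / M A)
      - q * (1 - q) / 2 * s\<^sup>2 * (\<Sum>k\<in>K. (grad A k * blk c k)\<^sup>2))" for c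
  proof -
    have "(\<integral>\<omega>. (\<Sum>k\<in>K. (grad A k * blk c k) * \<omega> k)\<^sup>2 \<partial>gauss_PiM K) = (\<Sum>k\<in>K. (grad A k * blk c k)\<^sup>2)"
      by (rule integral_gauss_PiM_linear_sq) simp
    then show ?thesis
      unfolding Q_def using iM[of c] iL[of c] by (simp add: prob_space)
  qed
  have "(\<integral>\<omega>. Q True \<omega> \<partial>gauss_PiM K) \<le> (\<integral>\<omega>. Q False \<omega> \<partial>gauss_PiM K)"
  proof -
    have "q * (1 - q) / 2 * s\<^sup>2 * (\<Sum>k\<in>K. (grad A k * blk False k)\<^sup>2) \<le> q * (1 - q) / 2 * s\<^sup>2 * (\<Sum>k\<in>K. (grad A k * blk True k)\<^sup>2)"
      using q by (intro mult_left_mono grad_blocks) auto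
    then show ?thesis unfolding QE integral_M_blocks[OF s]
      using f_pos[of A] by (intro mult_left_mono) auto
  qed
  moreover have "(\<integral>\<omega>. f (\<lambda>k. A k + s * (blk True k * \<omega> k)) \<partial>gauss_PiM K) \<le> 
      (\<integral>\<omega>. Q True \<omega> + f A * (48 * s ^ 3) * exp (2 * size \<omega>) \<partial>gauss_PiM K)"
    using bound[of True]
    by (intro integral_mono integrable_f s Bochner_Integration.integrable_add iQ integrable_mult_right integrable_exp_size)
       (simp add: abs_le_iff algebra_simps)
  moreover have "(\<integral>\<omega>. Q False \<omega> \<partial>gauss_PiM K) \<le>
      (\<integral>\<omega>. f (\<lambda>k. A k + s * (blk False k * \<omega> k)) + f A * (48 * s ^ 3) * exp (2 * size \<omega>) \<partial>gauss_PiM K)"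
    using bound[of False]
    by (intro integral_mono integrable_f s Bochner_Integration.integrable_add iQ integrable_mult_right integrable_exp_size)
       (simp add: abs_le_iff algebra_simps)
  moreover have "(\<integral>\<omega>. Q True \<omega> + f A * (48 * s ^ 3) * exp (2 * size \<omega>) \<partial>gauss_PiM K)
      = (\<integral>\<omega>. Q True \<omega> \<partial>gauss_PiM K) + f A * (48 * s ^ 3) * G"
    unfolding G_def using iQ integrable_exp_size[of 2] by simp
  moreover have "(\<integral>\<omega>. f (\<lambda>k. A k + s * (blk False k * \<omega> k)) + f A * (48 * s ^ 3) * exp (2 * size \<omega>) \<partial>gauss_PiM K)
      = (\<integral>\<omega>. f (\<lambda>k. A k + s * (blk False k * \<omega> k)) \<partial>gauss_PiM K) + f A * (48 * s ^ 3) * G"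
    unfolding G_def using integrable_f[OF s] integrable_exp_size[of 2] by simp
  ultimately show ?thesis by simp
qed

lemma f_swap_step_nn:
  assumes s: "0 \<le> s" "s \<le> 1"
  shows "(\<integral>\<^sup>+\<omega>. f (\<lambda>k. A k + s * (blk True k * \<omega> k)) \<partial>gauss_PiM K) \<le>
    (\<integral>\<^sup>+\<omega>. f (\<lambda>k. A k + s * (blk False k * \<omega> k)) \<partial>gauss_PiM K) + ennreal (f A) * ennreal (96 * s ^ 3 * G)"
proof -
  have G: "G \<ge> 0" unfolding G_def by (rule Bochner_Integration.integral_nonneg) simp
  have "(\<integral>\<^sup>+\<omega>. f (\<lambda>k. A k + s * (blk c k * \<omega> k)) \<partial>gauss_PiM K) =
      ennreal (\<integral>\<omega>. f (\<lambda>k. A k + s * (blk c k * \<omega> k)) \<partial>gauss_PiM K)" for c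
    using f_pos by (intro nn_integral_eq_integral integrable_f s AE_I2) (auto intro: less_imp_le)
  moreover have "0 \<le> (\<integral>\<omega>. f (\<lambda>k. A k + s * (blk False k * \<omega> k)) \<partial>gauss_PiM K)"
    using f_pos by (intro Bochner_Integration.integral_nonneg) (auto intro: less_imp_le)
  ultimately show ?thesis
    using f_swap_step[OF s, of A] f_pos[of A] G s
    by (simp add: ennreal_mult[symmetric] ennreal_plus[symmetric] less_imp_le del: ennreal_plus)
qed

lemma nn_integral_f_stable:
  "(\<integral>\<^sup>+\<omega>. \<integral>\<^sup>+\<omega>'. f (\<lambda>k. a k * \<omega> k + b k * \<omega>' k) \<partial>gauss_PiM K \<partial>gauss_PiM K) =
    (\<integral>\<^sup>+\<omega>. f (\<lambda>k. sqrt ((a k)\<^sup>2 + (b k)\<^sup>2) * \<omega> k) \<partial>gauss_PiM K)"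
proof -
  have meas: "(\<lambda>B. ennreal (f B)) \<in> borel_measurable (\<Pi>\<^sub>M k\<in>K. borel)"
    by (intro measurable_compose[OF f_measurable measurable_ennreal]) simp
  have "f (restrict B K) = f B" for B
    by (rule f_cong) simp
  then show ?thesis
    using nn_integral_gauss_PiM_stable[OF _ meas, of a b] by (simp only: finite_SigmaI finite_atMost)
qed

lemma gordon_comparison:
  "(\<integral>\<^sup>+\<omega>. f (\<lambda>k. blk True k * \<omega> k) \<partial>gauss_PiM K) \<le> (\<integral>\<^sup>+\<omega>. f (\<lambda>k. blk False k * \<omega> k) \<partial>gauss_PiM K)"
proof (rule ennreal_le_epsilon)
  fix e :: real assume "e > 0"
  have G: "G \<ge> 0" unfolding G_def by (rule Bochner_Integration.integral_nonneg) simp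
  define C where "C = f (\<lambda>_. 0) * G * (96 * G)"
  have C: "C \<ge> 0" using G f_pos[of "\<lambda>_. 0"] by (simp add: C_def)
  \<comment> \<open>Chosen so that C / sqrt N <= e; the added 1 forces N >= 1.\<close>
  obtain N :: nat where N: "real N > (C / e)\<^sup>2 + 1" using reals_Archimedean2 by blast
  then have N1: "real N \<ge> 1" by (smt (verit) zero_le_power2)
  define s where "s = 1 / sqrt (real N)"
  have s: "0 \<le> s" "s \<le> 1" using N1 by (auto simp: s_def)
  have s2: "s\<^sup>2 = 1 / real N" using N1 by (simp add: s_def power_divide)
  \<comment> \<open>Interpolation by variances: j/N on the block \<open>True\<close> and (N - j)/N
    on the block \<open>False\<close>, so index 0 is the pure \<open>False\<close> process and index
    N the pure \<open>True\<close> one.\<close>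
  define \<Phi> where "\<Phi> j = (\<integral>\<^sup>+\<omega>. f (\<lambda>k. sqrt (blk True k * (real j / real N) + blk False k * (real (N - j) / real N)) * \<omega> k) \<partial>gauss_PiM K)" for j
  have step: "\<Phi> (Suc j) \<le> \<Phi> j + ennreal (f (\<lambda>_. 0) * G) * ennreal (96 * s ^ 3 * G)" if "j < N" for j
  proof -
    \<comment> \<open>The standard deviation of the part shared by \<Phi> j and \<Phi> (Suc j); the
      missing variance 1/N goes to the block \<open>True\<close> in one case and to the block
      \<open>False\<close> in the other.\<close>
    define t where "t k = sqrt (blk True k * (real j / real N) + blk False k * (real (N - Suc j) / real N))" for k
    have t2: "(t k)\<^sup>2 = blk True k * (real j / real N) + blk False k * (real (N - Suc j) / real N)" for k
      unfolding t_def by (rule real_sqrt_pow2) (simp add: gordon_block_def)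
    have t1: "\<bar>t k\<bar> \<le> 1" for k
    proof -
      have "(t k)\<^sup>2 \<le> 1" unfolding t2 using that by (auto simp: gordon_block_def)
      then show ?thesis by (simp add: abs_square_le_1)
    qed
    have X: "\<Phi> (Suc j) = (\<integral>\<^sup>+\<omega>. \<integral>\<^sup>+\<omega>'. f (\<lambda>k. t k * \<omega> k + s * (blk True k * \<omega>' k)) \<partial>gauss_PiM K \<partial>gauss_PiM K)"
    proof -
      have "(t k)\<^sup>2 + (s * blk True k)\<^sup>2 = blk True k * (real (Suc j) / real N) + blk False k * (real (N - Suc j) / real N)" for k
        unfolding t2 power_mult_distrib s2 by (auto simp: gordon_block_def add_divide_distrib)
      then show ?thesis
        using nn_integral_f_stable[of t "\<lambda>k. s * blk True k"] by (simp add: \<Phi>_def mult.assoc)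
    qed
    have Y: "\<Phi> j = (\<integral>\<^sup>+\<omega>. \<integral>\<^sup>+\<omega>'. f (\<lambda>k. t k * \<omega> k + s * (blk False k * \<omega>' k)) \<partial>gauss_PiM K \<partial>gauss_PiM K)"
    proof -
      have "(t k)\<^sup>2 + (s * blk False k)\<^sup>2 = blk True k * (real j / real N) + blk False k * (real (N - j) / real N)" for k
        unfolding t2 power_mult_distrib s2 using that
        by (auto simp: gordon_block_def add_divide_distrib[symmetric] of_nat_diff)
      then show ?thesis
        using nn_integral_f_stable[of t "\<lambda>k. s * blk False k"] by (simp add: \<Phi>_def mult.assoc)
    qed
    interpret prob_space "gauss_PiM K" by (rule prob_space_gauss_PiM)
    have [measurable]: "(\<lambda>\<omega>. f (\<lambda>k. t k * \<omega> k)) \<in> borel_measurable (gauss_PiM K)"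
      by (intro f_measurable borel_measurable_times measurable_gauss_PiM_component) auto
    have [measurable]: "(\<lambda>\<omega>. \<integral>\<^sup>+\<omega>'. f (\<lambda>k. t k * \<omega> k + s * (blk False k * \<omega>' k)) \<partial>gauss_PiM K) \<in> borel_measurable (gauss_PiM K)"
    proof (rule borel_measurable_nn_integral)
      have "(\<lambda>x. f (\<lambda>k. t k * fst x k + s * (blk False k * snd x k))) \<in> borel_measurable (gauss_PiM K \<Otimes>\<^sub>M gauss_PiM K)"
      proof (rule f_measurable)
        fix k assume k: "k \<in> K"
        have "(\<lambda>x. fst x k) \<in> borel_measurable (gauss_PiM K \<Otimes>\<^sub>M gauss_PiM K)"
          by (rule measurable_compose[OF measurable_fst measurable_gauss_PiM_component[OF k]])
        moreover have "(\<lambda>x. snd x k) \<in> borel_measurable (gauss_PiM K \<Otimes>\<^sub>M gauss_PiM K)"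
          by (rule measurable_compose[OF measurable_snd measurable_gauss_PiM_component[OF k]])
        ultimately show "(\<lambda>x. t k * fst x k + s * (blk False k * snd x k)) \<in> borel_measurable (gauss_PiM K \<Otimes>\<^sub>M gauss_PiM K)"
          by (intro borel_measurable_add borel_measurable_times borel_measurable_const)
      qed
      then show "(\<lambda>(\<omega>, \<omega>'). ennreal (f (\<lambda>k. t k * \<omega> k + s * (blk False k * \<omega>' k)))) \<in> borel_measurable (gauss_PiM K \<Otimes>\<^sub>M gauss_PiM K)"
        unfolding split_beta by (intro measurable_compose[OF _ measurable_ennreal])
    qed
    have "\<Phi> (Suc j) \<le> (\<integral>\<^sup>+\<omega>. (\<integral>\<^sup>+\<omega>'. f (\<lambda>k. t k * \<omega> k + s * (blk False k * \<omega>' k)) \<partial>gauss_PiM K)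
        + ennreal (f (\<lambda>k. t k * \<omega> k)) * ennreal (96 * s ^ 3 * G) \<partial>gauss_PiM K)"
      unfolding X by (intro nn_integral_mono f_swap_step_nn s)
    also have "\<dots> = \<Phi> j + (\<integral>\<^sup>+\<omega>. f (\<lambda>k. t k * \<omega> k) \<partial>gauss_PiM K) * ennreal (96 * s ^ 3 * G)"
      unfolding Y by (subst nn_integral_add) (auto simp: nn_integral_multc)
    \<comment> \<open>As |t k| <= 1, the mean of \<open>f\<close> at the shared part is at most
      \<open>f\<close> at the zero matrix times \<open>G\<close>, for every j.\<close>
    also have "(\<integral>\<^sup>+\<omega>. f (\<lambda>k. t k * \<omega> k) \<partial>gauss_PiM K) \<le> (\<integral>\<^sup>+\<omega>. ennreal (f (\<lambda>_. 0) * exp (2 * size \<omega>)) \<partial>gauss_PiM K)"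
    proof (intro nn_integral_mono ennreal_leI)
      fix \<omega>
      have "size (\<lambda>k. t k * \<omega> k) \<le> size \<omega>"
        using t1 by (intro size_mono) (simp add: abs_mult mult_left_le_one_le)
      then have "size (\<lambda>k. t k * \<omega> k) \<le> 2 * size \<omega>" using size_nonneg[of \<omega>] by linarith
      then have "f (\<lambda>_. 0) * exp (size (\<lambda>k. t k * \<omega> k)) \<le> f (\<lambda>_. 0) * exp (2 * size \<omega>)"
        using f_pos[of "\<lambda>_. 0"] by simp
      then show "f (\<lambda>k. t k * \<omega> k) \<le> f (\<lambda>_. 0) * exp (2 * size \<omega>)"
        using f_growth[of "\<lambda>_. 0" "\<lambda>k. t k * \<omega> k"] by simp
    qed
    also have "\<dots> = ennreal (f (\<lambda>_. 0) * G)"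
      unfolding G_def using f_pos[of "\<lambda>_. 0"] integrable_exp_size[of 2]
      by (subst nn_integral_eq_integral) auto
    finally show ?thesis by (simp add: mult_right_mono add_left_mono)
  qed
  have "\<Phi> j \<le> \<Phi> 0 + of_nat j * (ennreal (f (\<lambda>_. 0) * G) * ennreal (96 * s ^ 3 * G))" if "j \<le> N" for j
    using that
  proof (induction j)
    case (Suc j)
    then have "\<Phi> (Suc j) \<le> (\<Phi> 0 + of_nat j * (ennreal (f (\<lambda>_. 0) * G) * ennreal (96 * s ^ 3 * G)))
        + ennreal (f (\<lambda>_. 0) * G) * ennreal (96 * s ^ 3 * G)"
      by (intro order_trans[OF step] add_right_mono) auto
    then show ?case by (simp add: algebra_simps)
  qed simp
  then have "\<Phi> N \<le> \<Phi> 0 + of_nat N * (ennreal (f (\<lambda>_. 0) * G) * ennreal (96 * s ^ 3 * G))" by simp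
  also have "of_nat N * (ennreal (f (\<lambda>_. 0) * G) * ennreal (96 * s ^ 3 * G)) = ennreal (real N * (f (\<lambda>_. 0) * G * (96 * s ^ 3 * G)))"
    using f_pos[of "\<lambda>_. 0"] G s by (simp add: ennreal_mult[symmetric] ennreal_of_nat_eq_real_of_nat less_imp_le)
  \<comment> \<open>N errors of order s^3 with s^2 = 1/N add up to order s.\<close>
  also have "real N * (f (\<lambda>_. 0) * G * (96 * s ^ 3 * G)) = C * s"
  proof -
    have "real N * (f (\<lambda>_. 0) * G * (96 * s ^ 3 * G)) = C * s * (real N * s\<^sup>2)"
      by (simp add: C_def power3_eq_cube power2_eq_square)
    then show ?thesis using N1 by (simp add: s2)
  qed
  also have "C * s \<le> e"
  proof -
    have "(C / e)\<^sup>2 \<le> real N" using N by linarith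
    then have "C / e \<le> sqrt (real N)" by (rule real_le_rsqrt)
    then show ?thesis using \<open>e > 0\<close> N1 by (simp add: s_def field_simps)
  qed
  finally have "\<Phi> N \<le> \<Phi> 0 + ennreal e" by (simp add: add_left_mono ennreal_leI)
  moreover have "sqrt (blk c k) = blk c k" for c k
    using blk_cases[of c k] by auto
  ultimately show "(\<integral>\<^sup>+\<omega>. f (\<lambda>k. blk True k * \<omega> k) \<partial>gauss_PiM K) \<le> (\<integral>\<^sup>+\<omega>. f (\<lambda>k. blk False k * \<omega> k) \<partial>gauss_PiM K) + ennreal e"
    using N1 by (simp add: \<Phi>_def)
qed

end

section \<open>Escape through a mesh\<close>

text \<open>Coordinates outside \<open>insert k L\<close> integrate to 1, and coordinate k is
  independent of those in \<open>L\<close>. This detaches the scalar in the corner (m, n) from the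
  matrix block and produces the factor exp (c^2 / 2).\<close>

lemma nn_integral_gauss_PiM_split_coord:
  fixes F :: "('a \<Rightarrow> real) \<Rightarrow> ennreal"
  assumes "finite K" "L \<subseteq> K" "k \<in> K" "k \<notin> L"
    and F: "F \<in> borel_measurable (gauss_PiM L)" and g: "g \<in> borel_measurable borel"
  shows "(\<integral>\<^sup>+\<omega>. F (restrict \<omega> L) * g (\<omega> k) \<partial>gauss_PiM K) = (\<integral>\<^sup>+\<omega>. F \<omega> \<partial>gauss_PiM L) * (\<integral>\<^sup>+x. g x \<partial>std_gauss)"
proof -
  interpret product_prob_space "\<lambda>_::'a. std_gauss" K
    by (intro product_prob_spaceI prob_space_std_gauss)
  have L: "finite L" using assms by (auto intro: finite_subset)
  let ?L = "insert k L"
  have r: "(\<lambda>\<omega>. restrict \<omega> L) \<in> gauss_PiM ?L \<rightarrow>\<^sub>M gauss_PiM L"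
    by (rule measurable_restrict_subset) auto
  have gk: "(\<lambda>\<omega>. g (\<omega> k)) \<in> borel_measurable (gauss_PiM ?L)"
    using g by (intro measurable_compose[OF measurable_gauss_PiM_component]) auto
  have Fr: "(\<lambda>\<omega>. F (restrict \<omega> L)) \<in> borel_measurable (gauss_PiM ?L)"
    by (rule measurable_compose[OF r F])
  have meas: "(\<lambda>\<omega>. F (restrict \<omega> L) * g (\<omega> k)) \<in> borel_measurable (gauss_PiM ?L)"
    using Fr gk by (rule borel_measurable_times_ennreal)
  have "(\<integral>\<^sup>+\<omega>. F (restrict \<omega> L) * g (\<omega> k) \<partial>gauss_PiM K) =
      (\<integral>\<^sup>+\<omega>. F (restrict (restrict \<omega> ?L) L) * g (restrict \<omega> ?L k) \<partial>gauss_PiM K)"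
  proof -
    have "insert k L \<inter> L = L" by auto
    then show ?thesis by (simp add: restrict_restrict)
  qed
  also have "\<dots> = (\<integral>\<^sup>+\<omega>. F (restrict \<omega> L) * g (\<omega> k) \<partial>gauss_PiM ?L)"
  proof -
    have "gauss_PiM ?L = distr (gauss_PiM K) (gauss_PiM ?L) (\<lambda>\<omega>. restrict \<omega> ?L)"
      using assms by (intro distr_restrict) auto
    moreover have "(\<integral>\<^sup>+\<omega>. F (restrict \<omega> L) * g (\<omega> k) \<partial>distr (gauss_PiM K) (gauss_PiM ?L) (\<lambda>\<omega>. restrict \<omega> ?L)) =
        (\<integral>\<^sup>+\<omega>. F (restrict (restrict \<omega> ?L) L) * g (restrict \<omega> ?L k) \<partial>gauss_PiM K)"
      using assms by (intro nn_integral_distr meas measurable_restrict_subset) auto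
    ultimately show ?thesis by simp
  qed
  also have "\<dots> = (\<integral>\<^sup>+\<omega>. (\<integral>\<^sup>+x. F (restrict (fun_upd \<omega> k x) L) * g (fun_upd \<omega> k x k) \<partial>std_gauss) \<partial>gauss_PiM L)"
    using L \<open>k \<notin> L\<close> meas by (rule product_nn_integral_insert)
  also have "\<dots> = (\<integral>\<^sup>+\<omega>. (\<integral>\<^sup>+x. F \<omega> * g x \<partial>std_gauss) \<partial>gauss_PiM L)"
  proof (rule nn_integral_cong)
    fix \<omega> assume "\<omega> \<in> space (gauss_PiM L)"
    then have "restrict (fun_upd \<omega> k x) L = \<omega>" for x
      using \<open>k \<notin> L\<close> by (auto simp: space_PiM PiE_def extensional_def fun_eq_iff)
    then show "(\<integral>\<^sup>+x. F (restrict (fun_upd \<omega> k x) L) * g (fun_upd \<omega> k x k) \<partial>std_gauss) = (\<integral>\<^sup>+x. F \<omega> * g x \<partial>std_gauss)"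
      by simp
  qed
  also have "\<dots> = (\<integral>\<^sup>+\<omega>. F \<omega> * (\<integral>\<^sup>+x. g x \<partial>std_gauss) \<partial>gauss_PiM L)"
    using g by (simp add: nn_integral_cmult)
  also have "\<dots> = (\<integral>\<^sup>+\<omega>. F \<omega> \<partial>gauss_PiM L) * (\<integral>\<^sup>+x. g x \<partial>std_gauss)"
    by (rule nn_integral_multc[OF F])
  finally show ?thesis .
qed

definition unit_hats :: "nat \<Rightarrow> (nat \<Rightarrow> real) set" where
  "unit_hats n = {w. w n = 1 \<and> (\<Sum>j<n. (w j)\<^sup>2) = 1}"

abbreviation mat_norm :: "nat \<Rightarrow> nat \<Rightarrow> (nat \<times> nat \<Rightarrow> real) \<Rightarrow> (nat \<Rightarrow> real) \<Rightarrow> real" where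
  "mat_norm m n A w \<equiv> smooth_norm m (\<lambda>i. \<Sum>j<n. A (i, j) * w j)"

lemma mat_norm_measurable: "(\<lambda>A. mat_norm m n A w) \<in> borel_measurable (gauss_mat m n)"
  unfolding gauss_mat_def smooth_norm_def
  by (rule measurable_compose[OF _ borel_measurable_sqrt])
     (intro borel_measurable_add borel_measurable_sum borel_measurable_power borel_measurable_times
        borel_measurable_const measurable_gauss_PiM_component, auto)

lemma root_card_le_2: "N \<ge> 1 \<Longrightarrow> real N powr (1 / real N) \<le> 2"
proof -
  assume N: "N \<ge> 1"
  have "real N \<le> 2 ^ N" by (simp add: less_imp_le of_nat_less_two_power)
  then have "real N powr (1 / real N) \<le> (2 ^ N) powr (1 / real N)"
    by (intro powr_mono2) auto
  also have "\<dots> = 2" using N by (simp add: powr_realpow[symmetric] powr_powr)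
  finally show ?thesis .
qed

text \<open>The exponent \<open>q\<close> of the smoothed maximum is \<open>1 / card T\<close>, so that passing to the maximum
  costs only a factor 2, independent of \<open>T\<close>.\<close>
lemma gordon_finite:
  assumes "finite T" "T \<noteq> {}" "T \<subseteq> unit_hats n" "c \<ge> 0"
    and U: "\<And>w h. w \<in> T \<Longrightarrow> exp (- c * (\<Sum>j<n. h j * w j)) \<le> U h"
  shows "(\<integral>\<^sup>+A. (SUP w\<in>T. ennreal (exp (- c * mat_norm m n A w))) \<partial>gauss_mat m n) * ennreal (exp (c\<^sup>2 / 2))
    \<le> (\<integral>\<^sup>+\<omega>. ennreal (2 * exp (- c * sqrt (\<Sum>i<m. (\<omega> (i, n))\<^sup>2)) * U (\<lambda>j. \<omega> (m, j))) \<partial>gauss_PiM ({..m} \<times> {..n}))"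
proof -
  define N where "N = card T"
  have N: "N \<ge> 1" using assms by (simp add: N_def Suc_le_eq card_gt_0_iff)
  \<comment> \<open>This is c/q for q = 1/N, so that the N-th root turns \<open>lam\<close> back
    into c.\<close>
  define lam where "lam = c * real N"
  interpret gordon T m n lam "1 / real N"
    using assms N by unfold_locales (auto simp: unit_hats_def lam_def)
  define H where "H A = (SUP w\<in>T. ennreal (exp (- c * mat_norm m n A w)))" for A
  let ?L = "{..<m} \<times> {..<n}"
  have H_restrict: "H (restrict \<omega> ?L) = H \<omega>" for \<omega>
    unfolding H_def smooth_norm_def by simp
  have H_meas: "H \<in> borel_measurable (gauss_PiM ?L)"
    unfolding H_def using \<open>finite T\<close> mat_norm_measurable[unfolded gauss_mat_def]
    by (intro borel_measurable_SUP countable_finite measurable_compose[OF _ measurable_ennreal] borel_measurable_exp[THEN measurable_compose[rotated]] borel_measurable_times) auto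
  have root: "exp (lam * x) powr (1 / real N) = exp (c * x)" for x
    using N by (simp add: lam_def exp_powr_real)
  have blk_mult: "mat_vec n (\<lambda>k. blk True k * \<omega> k) w i = (if i < m then \<Sum>j<n. \<omega> (i, j) * w j else \<omega> (m, n))"
    "mat_vec n (\<lambda>k. blk False k * \<omega> k) w i = (if i < m then \<omega> (i, n) else \<Sum>j<n. \<omega> (m, j) * w j)"
    if "w \<in> T" "i \<le> m" for \<omega> w i
    using that T_last[OF that(1)] by (auto simp: mat_vec_def sum_atMost_eq_lessThan_add gordon_block_def)
  have E_True: "E (\<lambda>k. blk True k * \<omega> k) w = lam * (- mat_norm m n \<omega> w - \<omega> (m, n))" if "w \<in> T" for \<omega> w
    unfolding gordon_exponent_def smooth_norm_def by (simp add: blk_mult[OF that]) (simp add: algebra_simps)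
  have E_False: "E (\<lambda>k. blk False k * \<omega> k) w = lam * (- smooth_norm m (\<lambda>i. \<omega> (i, n)) - (\<Sum>j<n. \<omega> (m, j) * w j))" if "w \<in> T" for \<omega> w
    unfolding gordon_exponent_def smooth_norm_def by (simp add: blk_mult[OF that]) (simp add: algebra_simps)
  have "(\<integral>\<^sup>+A. H A \<partial>gauss_PiM ?L) * ennreal (exp (c\<^sup>2 / 2)) =
      (\<integral>\<^sup>+A. H A \<partial>gauss_PiM ?L) * (\<integral>\<^sup>+x. ennreal (exp (- c * x)) \<partial>std_gauss)"
    using integral_std_gauss_exp[of "- c"] integrable_std_gauss_exp[of "- c"]
    by (subst nn_integral_eq_integral) auto
  also have "\<dots> = (\<integral>\<^sup>+\<omega>. H (restrict \<omega> ?L) * ennreal (exp (- c * \<omega> (m, n))) \<partial>gauss_PiM K)"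
    by (rule nn_integral_gauss_PiM_split_coord[symmetric]) (auto intro: H_meas)
  also have "\<dots> \<le> (\<integral>\<^sup>+\<omega>. f (\<lambda>k. blk True k * \<omega> k) \<partial>gauss_PiM K)"
  proof (rule nn_integral_mono)
    fix \<omega>
    have "ennreal (exp (- c * mat_norm m n \<omega> w)) * ennreal (exp (- c * \<omega> (m, n))) \<le> f (\<lambda>k. blk True k * \<omega> k)" if "w \<in> T" for w
    proof -
      have "exp (E (\<lambda>k. blk True k * \<omega> k) w) \<le> M (\<lambda>k. blk True k * \<omega> k)"
        unfolding M_def using that finite_T by (intro member_le_sum) auto
      then have "exp (E (\<lambda>k. blk True k * \<omega> k) w) powr (1 / real N) \<le> f (\<lambda>k. blk True k * \<omega> k)"
        unfolding f_def by (intro powr_mono2) auto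
      then have "exp (c * (- mat_norm m n \<omega> w - \<omega> (m, n))) \<le> f (\<lambda>k. blk True k * \<omega> k)"
        unfolding E_True[OF that] root .
      moreover have "exp (- c * mat_norm m n \<omega> w) * exp (- c * \<omega> (m, n)) = exp (c * (- mat_norm m n \<omega> w - \<omega> (m, n)))"
        unfolding mult_exp_exp by (simp add: right_diff_distrib)
      ultimately show ?thesis
        by (simp add: ennreal_mult[symmetric] ennreal_leI)
    qed
    then show "H (restrict \<omega> ?L) * ennreal (exp (- c * \<omega> (m, n))) \<le> f (\<lambda>k. blk True k * \<omega> k)"
      unfolding H_restrict unfolding H_def SUP_mult_right_ennreal by (intro SUP_least)
  qed
  also have "\<dots> \<le> (\<integral>\<^sup>+\<omega>. f (\<lambda>k. blk False k * \<omega> k) \<partial>gauss_PiM K)"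
    by (rule gordon_comparison)
  also have "\<dots> \<le> (\<integral>\<^sup>+\<omega>. ennreal (2 * exp (- c * sqrt (\<Sum>i<m. (\<omega> (i, n))\<^sup>2)) * U (\<lambda>j. \<omega> (m, j))) \<partial>gauss_PiM K)"
  proof (intro nn_integral_mono ennreal_leI)
    fix \<omega>
    let ?g = "sqrt (\<Sum>i<m. (\<omega> (i, n))\<^sup>2)" and ?B = "\<lambda>k. blk False k * \<omega> k"
    \<comment> \<open>On this side the sum is at most N times its largest term, whose prefactor
      becomes N^(1/N) <= 2.\<close>
    define V where "V = Max ((\<lambda>w. E ?B w) ` T)"
    have "V \<in> (\<lambda>w. E ?B w) ` T"
      unfolding V_def using finite_T T_ne by (intro Max_in) auto
    then obtain w1 where w1: "w1 \<in> T" "V = E ?B w1" by blast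
    have "M ?B \<le> (\<Sum>w\<in>T. exp V)"
      unfolding M_def V_def using finite_T by (intro sum_mono) auto
    also have "\<dots> = real N * exp V" by (simp add: N_def)
    finally have "f ?B \<le> (real N * exp V) powr (1 / real N)"
      unfolding f_def using M_pos[of ?B] by (intro powr_mono2) auto
    also have "\<dots> = real N powr (1 / real N) * (exp V powr (1 / real N))"
      by (simp add: powr_mult)
    also have "\<dots> \<le> 2 * (exp V powr (1 / real N))"
      by (intro mult_right_mono root_card_le_2 N) simp
    also have "exp V powr (1 / real N) = exp (- c * smooth_norm m (\<lambda>i. \<omega> (i, n))) * exp (- c * (\<Sum>j<n. \<omega> (m, j) * w1 j))"
      unfolding w1(2) E_False[OF w1(1)] root mult_exp_exp by (simp add: algebra_simps)
    also have "\<dots> \<le> exp (- c * ?g) * U (\<lambda>j. \<omega> (m, j))"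
    proof (intro mult_mono U[OF w1(1)])
      have "?g \<le> smooth_norm m (\<lambda>i. \<omega> (i, n))" unfolding smooth_norm_def by simp
      then show "exp (- c * smooth_norm m (\<lambda>i. \<omega> (i, n))) \<le> exp (- c * ?g)"
        using \<open>c \<ge> 0\<close> by (simp add: mult_left_mono)
    qed auto
    finally show "f ?B \<le> 2 * exp (- c * ?g) * U (\<lambda>j. \<omega> (m, j))" by simp
  qed
  finally show ?thesis unfolding H_def gauss_mat_def .
qed

lemma smooth_norm_mat_tendsto:
  assumes "\<And>j. j < n \<Longrightarrow> (\<lambda>k. x k j) \<longlonglongrightarrow> w j"
  shows "(\<lambda>k. mat_norm m n A (x k)) \<longlonglongrightarrow> mat_norm m n A w"
  unfolding smooth_norm_def using assms by (intro tendsto_intros) auto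

text \<open>If the kernel meets \<open>D\<close>, the supremum over \<open>D\<close> of the
  exponential of - c times the smoothed norm is at least exp (- c), whence the factor
  \<open>exp c\<close>. Finite subsets of a countable dense set exhaust this supremum; their bound
  is uniform, so monotone convergence applies. \<open>U\<close> is a majorant of the linear process,
  to be supplied by duality.\<close>

lemma gordon_escape:
  assumes D: "D \<subseteq> unit_hats n" and "c \<ge> 0"
    and U: "\<And>w h. w \<in> D \<Longrightarrow> exp (- c * (\<Sum>j<n. h j * w j)) \<le> U h"
    and Ev: "\<And>A. A \<in> Ev \<Longrightarrow> \<exists>w\<in>D. \<forall>i<m. (\<Sum>j<n. A (i, j) * w j) = 0"
  shows "emeasure (gauss_mat m n) Ev * ennreal (exp (c\<^sup>2 / 2))
    \<le> ennreal (exp c) * (\<integral>\<^sup>+\<omega>. ennreal (2 * exp (- c * sqrt (\<Sum>i<m. (\<omega> (i, n))\<^sup>2)) * U (\<lambda>j. \<omega> (m, j))) \<partial>gauss_PiM ({..m} \<times> {..n}))"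
    (is "emeasure ?N _ * _ \<le> _")
proof (cases "Ev \<in> sets ?N \<and> D \<noteq> {}")
  case False
  note disj = this
  \<comment> \<open>A set outside the sigma-algebra has \<open>emeasure\<close> 0 by convention, and
    without directions the event is empty.\<close>
  have "emeasure ?N Ev = 0"
  proof (cases "D = {}")
    case False
    with disj show ?thesis by (intro emeasure_notin_sets) simp
  next
    case True
    then have "Ev = {}" using Ev by blast
    then show ?thesis by simp
  qed
  then show ?thesis by (simp only: mult_zero_left zero_le)
next
  case True
  then have Ev_sets: "Ev \<in> sets ?N" and "D \<noteq> {}" by auto
  \<comment> \<open>Density refers to the product topology on \<open>nat \<Rightarrow> real\<close>,
    that is to coordinatewise convergence; \<open>mat_norm\<close> is continuous for it because it
    reads finitely many coordinates.\<close>
  obtain D0 where D0: "countable D0" "D0 \<subseteq> D" "D \<subseteq> closure D0" by (rule separable)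
  have D0_ne: "D0 \<noteq> {}" using D0(3) \<open>D \<noteq> {}\<close> by auto
  define e where "e = from_nat_into D0"
  have e: "range e = D0" unfolding e_def using D0(1) D0_ne by (rule range_from_nat_into[rotated])
  define H where "H l A = (SUP w\<in>e ` {..l}. ennreal (exp (- c * mat_norm m n A w)))" for l :: nat and A
  define R where "R = (\<integral>\<^sup>+\<omega>. ennreal (2 * exp (- c * sqrt (\<Sum>i<m. (\<omega> (i, n))\<^sup>2)) * U (\<lambda>j. \<omega> (m, j))) \<partial>gauss_PiM ({..m} \<times> {..n}))"
  have fin: "(\<integral>\<^sup>+A. H l A \<partial>?N) * ennreal (exp (c\<^sup>2 / 2)) \<le> R" for l
    unfolding H_def R_def
  proof (rule gordon_finite)
    show "e ` {..l} \<subseteq> unit_hats n" using e D0(2) D by blast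
    show "exp (- c * (\<Sum>j<n. h j * w j)) \<le> U h" if "w \<in> e ` {..l}" for w h
      using that e D0(2) by (intro U) blast
  qed (use \<open>c \<ge> 0\<close> in auto)
  have H_meas: "H l \<in> borel_measurable ?N" for l
    unfolding H_def using mat_norm_measurable
    by (intro borel_measurable_SUP countable_finite measurable_compose[OF _ measurable_ennreal] borel_measurable_exp[THEN measurable_compose[rotated]] borel_measurable_times) auto
  have incH: "incseq H"
    unfolding H_def incseq_def le_fun_def by (intro allI impI SUP_subset_mono image_mono) auto
  have "indicator Ev A \<le> ennreal (exp c) * (SUP l. H l A)" for A
  proof (cases "A \<in> Ev")
    case True
    then obtain w where w: "w \<in> D" "\<And>i. i < m \<Longrightarrow> (\<Sum>j<n. A (i, j) * w j) = 0" using Ev by blast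
    then have "w \<in> closure D0" using D0(3) by blast
    then obtain x where x: "\<And>k. x k \<in> D0" "x \<longlonglongrightarrow> w"
      unfolding closure_sequential by blast
    have "(\<lambda>k. x k j) \<longlonglongrightarrow> w j" for j
      by (rule continuous_on_tendsto_compose[OF continuous_on_product_coordinates x(2)]) auto
    then have "(\<lambda>k. mat_norm m n A (x k)) \<longlonglongrightarrow> mat_norm m n A w"
      by (intro smooth_norm_mat_tendsto)
    moreover have "mat_norm m n A w = 1" using w(2) by (simp add: smooth_norm_def)
    ultimately have lim: "(\<lambda>k. ennreal (exp (- c * mat_norm m n A (x k)))) \<longlonglongrightarrow> ennreal (exp (- c * 1))"
      by (intro tendsto_intros) simp
    have "ennreal (exp (- c * mat_norm m n A (x k))) \<le> (SUP l. H l A)" for k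
    proof -
      obtain l where "x k = e l" using x(1)[of k] e by auto
      then have "ennreal (exp (- c * mat_norm m n A (x k))) \<le> H l A"
        unfolding H_def by (intro SUP_upper) auto
      then show ?thesis by (meson SUP_upper UNIV_I order_trans)
    qed
    then have "ennreal (exp (- c * 1)) \<le> (SUP l. H l A)"
      by (intro LIMSEQ_le_const2[OF lim]) blast
    then have "ennreal (exp (- c)) \<le> (SUP l. H l A)" by simp
    then have "ennreal (exp c) * ennreal (exp (- c)) \<le> ennreal (exp c) * (SUP l. H l A)"
      by (intro mult_left_mono) auto
    then show ?thesis using True by (simp add: ennreal_mult[symmetric] mult_exp_exp)
  qed simp
  then have "(\<integral>\<^sup>+A. indicator Ev A \<partial>?N) \<le> (\<integral>\<^sup>+A. ennreal (exp c) * (SUP l. H l A) \<partial>?N)"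
    by (intro nn_integral_mono)
  then have "emeasure ?N Ev \<le> (\<integral>\<^sup>+A. ennreal (exp c) * (SUP l. H l A) \<partial>?N)"
    unfolding nn_integral_indicator[OF Ev_sets] .
  also have "\<dots> = ennreal (exp c) * (SUP l. (\<integral>\<^sup>+A. H l A \<partial>?N))"
  proof -
    have "(\<lambda>A. SUP l. H l A) \<in> borel_measurable ?N"
      by (rule borel_measurable_SUP[OF countableI_type]) (rule H_meas)
    then have "(\<integral>\<^sup>+A. ennreal (exp c) * (SUP l. H l A) \<partial>?N) = ennreal (exp c) * (\<integral>\<^sup>+A. (SUP l. H l A) \<partial>?N)"
      by (rule nn_integral_cmult)
    then show ?thesis
      by (simp only: nn_integral_monotone_convergence_SUP[OF incH H_meas])
  qed
  finally have "emeasure ?N Ev * ennreal (exp (c\<^sup>2 / 2)) \<le> ennreal (exp c) * (SUP l. (\<integral>\<^sup>+A. H l A \<partial>?N)) * ennreal (exp (c\<^sup>2 / 2))"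
    by (rule mult_right_mono) simp
  also have "\<dots> = ennreal (exp c) * (SUP l. (\<integral>\<^sup>+A. H l A \<partial>?N) * ennreal (exp (c\<^sup>2 / 2)))"
    by (simp add: SUP_mult_right_ennreal mult.assoc)
  also have "\<dots> \<le> ennreal (exp c) * R"
    by (intro mult_left_mono SUP_least fin) auto
  finally show ?thesis unfolding R_def .
qed

section \<open>One-dimensional integrals and duality\<close>

lemma erf_has_real_derivative: "(erf has_real_derivative 2 / sqrt pi * exp (- x\<^sup>2)) (at x)"
proof -
  \<comment> \<open>An interval with 0 and x in its interior turns the derivative within it into a
    two-sided one.\<close>
  define a b where "a = min 0 x - 1" and "b = max 0 x + 1"
  have "((\<lambda>u. LBINT y=ereal 0..ereal u. exp (- y\<^sup>2)) has_vector_derivative exp (- x\<^sup>2)) (at x within {a..b})"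
    by (rule interval_integral_FTC2) (auto simp: a_def b_def intro!: continuous_intros)
  then have "((\<lambda>u. LBINT y=0..ereal u. exp (- y\<^sup>2)) has_real_derivative exp (- x\<^sup>2)) (at x within {a..b})"
    by (simp add: has_real_derivative_iff_has_vector_derivative zero_ereal_def)
  then have "((\<lambda>u. LBINT y=0..ereal u. exp (- y\<^sup>2)) has_real_derivative exp (- x\<^sup>2)) (at x)"
    by (subst (asm) at_within_interior) (auto simp: a_def b_def)
  from DERIV_cmult[OF this, of "2 / sqrt pi"] show ?thesis
    unfolding erf_def[abs_def] .
qed

lemma erf_tendsto_at_top: "(erf \<longlongrightarrow> 1) at_top"
proof -
  have "((\<lambda>y. \<integral>x. indicator {..y} x *\<^sub>R (indicator {0..} x *\<^sub>R exp (- x\<^sup>2)) \<partial>lborel) \<longlongrightarrow> sqrt pi / 2) at_top"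
    using tendsto_integral_at_top[OF sets_lborel integrable.intros[OF gaussian_moment_0]]
    unfolding has_bochner_integral_integral_eq[OF gaussian_moment_0] .
  then have "((\<lambda>y. 2 / sqrt pi * (\<integral>x. indicator {..y} x *\<^sub>R (indicator {0..} x *\<^sub>R exp (- x\<^sup>2)) \<partial>lborel)) \<longlongrightarrow> 2 / sqrt pi * (sqrt pi / 2)) at_top"
    by (intro tendsto_intros)
  moreover have "\<forall>\<^sub>F y in at_top. 2 / sqrt pi * (\<integral>x. indicator {..y} x *\<^sub>R (indicator {0..} x *\<^sub>R exp (- x\<^sup>2)) \<partial>lborel) = erf y"
    using eventually_ge_at_top[of 0]
  proof eventually_elim
    case (elim y)
    have "(LBINT x=ereal 0..ereal y. exp (- x\<^sup>2)) = (LBINT x : {0..y}. exp (- x\<^sup>2))"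
      using elim by (rule interval_integral_Icc)
    also have "\<dots> = (\<integral>x. indicator {..y} x *\<^sub>R (indicator {0..} x *\<^sub>R exp (- x\<^sup>2)) \<partial>lborel)"
      unfolding set_lebesgue_integral_def by (intro Bochner_Integration.integral_cong) (auto split: split_indicator)
    finally show ?case by (simp add: erf_def zero_ereal_def)
  qed
  ultimately show ?thesis by (simp add: filterlim_cong)
qed

text \<open>For standard Gaussian x this is the mean of exp (a z^2 / 2), where z is the positive
  part of x - \<nu>. With a = c3 / (2 \<gamma>) its values at \<nu> and - \<nu> are
  \<open>w1\<close> and \<open>w2\<close>, so one computation serves both.\<close>

definition excess_mgf :: "real \<Rightarrow> real \<Rightarrow> real" where
  "excess_mgf a \<nu> = 1/2 * (exp (a * \<nu>\<^sup>2 / (2 * (1 - a))) / sqrt (1 - a) * erfc (\<nu> / (sqrt 2 * sqrt (1 - a))) + erf (\<nu> / sqrt 2) + 1)"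

lemma w1_eq_excess_mgf: "w1 c3 \<nu> \<gamma> = excess_mgf (c3 / (2 * \<gamma>)) \<nu>"
proof -
  have "(c3 * \<nu>\<^sup>2 / (4 * \<gamma>)) / d = c3 / (2 * \<gamma>) * \<nu>\<^sup>2 / (2 * d)" for d by simp
  then show ?thesis unfolding w1_def excess_mgf_def by simp
qed

lemma w2_eq_excess_mgf: "w2 c3 \<nu> \<gamma> = excess_mgf (c3 / (2 * \<gamma>)) (- \<nu>)"
proof -
  have "(c3 * \<nu>\<^sup>2 / (4 * \<gamma>)) / d = c3 / (2 * \<gamma>) * \<nu>\<^sup>2 / (2 * d)" for d by simp
  then show ?thesis unfolding w2_def excess_mgf_def by simp
qed

text \<open>Completing the square with r = sqrt (1 - a) turns the exponent into a constant minus
  half the square of r x + a \<nu> / r, so the integrand has an antiderivative in terms of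
  \<open>erf\<close>.\<close>

lemma nn_integral_excess_tail:
  assumes a: "0 \<le> a" "a < 1"
  shows "(\<integral>\<^sup>+x. ennreal (std_normal_density x * exp (a / 2 * (x - \<nu>)\<^sup>2)) * indicator {\<nu>..} x \<partial>lborel)
    = ennreal (1/2 * (exp (a * \<nu>\<^sup>2 / (2 * (1 - a))) / sqrt (1 - a) * erfc (\<nu> / (sqrt 2 * sqrt (1 - a)))))"
proof -
  define r where "r = sqrt (1 - a)"
  have r: "r > 0" and r2: "r\<^sup>2 = 1 - a" using a by (auto simp: r_def)
  define C where "C = exp (a * \<nu>\<^sup>2 / (2 * (1 - a))) / r"
  define F where "F x = C / 2 * erf ((r * x + a * \<nu> / r) / sqrt 2)" for x
  have exponent: "- x\<^sup>2 / 2 + a / 2 * (x - \<nu>)\<^sup>2 = a * \<nu>\<^sup>2 / (2 * (1 - a)) - ((r * x + a * \<nu> / r) / sqrt 2)\<^sup>2" for x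
  proof -
    have "((r * x + a * \<nu> / r) / sqrt 2)\<^sup>2 = (r\<^sup>2 * x\<^sup>2 + 2 * a * \<nu> * x + a\<^sup>2 * \<nu>\<^sup>2 / r\<^sup>2) / 2"
      using r by (simp add: power_divide power2_sum power_mult_distrib)
    also have "\<dots> = ((1 - a) * x\<^sup>2 + 2 * a * \<nu> * x + a\<^sup>2 * \<nu>\<^sup>2 / (1 - a)) / 2" by (simp add: r2)
    finally have *: "((r * x + a * \<nu> / r) / sqrt 2)\<^sup>2 = ((1 - a) * x\<^sup>2 + 2 * a * \<nu> * x + a\<^sup>2 * \<nu>\<^sup>2 / (1 - a)) / 2" .
    define X where "X = \<nu>\<^sup>2 / (1 - a)"
    have X: "\<nu>\<^sup>2 = X * (1 - a)" using a by (simp add: X_def)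
    have "a * \<nu>\<^sup>2 / (2 * (1 - a)) = a * X / 2" "a\<^sup>2 * \<nu>\<^sup>2 / (1 - a) = a\<^sup>2 * X"
      by (simp_all add: X_def)
    then show ?thesis unfolding * power2_diff X by (simp add: field_simps power2_eq_square)
  qed
  have dens: "std_normal_density x * exp (a / 2 * (x - \<nu>)\<^sup>2) =
      C / 2 * (2 / sqrt pi * exp (- ((r * x + a * \<nu> / r) / sqrt 2)\<^sup>2) * (r / sqrt 2))" for x
  proof -
    have "std_normal_density x * exp (a / 2 * (x - \<nu>)\<^sup>2) = 1 / sqrt (2 * pi) * exp (- x\<^sup>2 / 2 + a / 2 * (x - \<nu>)\<^sup>2)"
      by (simp add: std_normal_density_def mult_exp_exp)
    also have "\<dots> = 1 / sqrt (2 * pi) * (exp (a * \<nu>\<^sup>2 / (2 * (1 - a))) * exp (- ((r * x + a * \<nu> / r) / sqrt 2)\<^sup>2))"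
      unfolding exponent by (simp add: exp_add[symmetric])
    finally have eq: "std_normal_density x * exp (a / 2 * (x - \<nu>)\<^sup>2) = 1 / sqrt (2 * pi) * (exp (a * \<nu>\<^sup>2 / (2 * (1 - a))) * exp (- ((r * x + a * \<nu> / r) / sqrt 2)\<^sup>2))" .
    have gen: "1 / (k * l) * (C * r * E) = C / 2 * (2 / l * E * (r / k))" if "k > 0" "l > 0" for k l E :: real
      using that by (simp add: field_simps)
    have "1 / sqrt (2 * pi) * (C * r * exp (- ((r * x + a * \<nu> / r) / sqrt 2)\<^sup>2)) =
        C / 2 * (2 / sqrt pi * exp (- ((r * x + a * \<nu> / r) / sqrt 2)\<^sup>2) * (r / sqrt 2))"
      unfolding real_sqrt_mult by (rule gen) simp_all
    moreover have "exp (a * \<nu>\<^sup>2 / (2 * (1 - a))) = C * r" using r by (simp add: C_def)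
    ultimately show ?thesis unfolding eq by (simp only:)
  qed
  have "(\<integral>\<^sup>+x. ennreal (std_normal_density x * exp (a / 2 * (x - \<nu>)\<^sup>2)) * indicator {\<nu>..} x \<partial>lborel) = C / 2 - F \<nu>"
  proof (rule nn_integral_FTC_atLeast)
    show "(F has_real_derivative std_normal_density x * exp (a / 2 * (x - \<nu>)\<^sup>2)) (at x)" for x
    proof -
      have "((\<lambda>x. (r * x + a * \<nu> / r) / sqrt 2) has_real_derivative r / sqrt 2) (at x)"
        by (rule DERIV_cdivide) (auto intro!: derivative_eq_intros)
      then show ?thesis
        unfolding F_def dens by (intro DERIV_cmult DERIV_chain2[OF erf_has_real_derivative])
    qed
    have "filterlim (\<lambda>x. (r * x + a * \<nu> / r) / sqrt 2) at_top at_top"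
    proof -
      have "filterlim (\<lambda>x. r / sqrt 2 * x) at_top at_top"
        using r by (intro filterlim_tendsto_pos_mult_at_top[OF tendsto_const] filterlim_ident) auto
      then have "filterlim (\<lambda>x. (a * \<nu> / r) / sqrt 2 + r / sqrt 2 * x) at_top at_top"
        by (rule filterlim_tendsto_add_at_top[OF tendsto_const])
      then show ?thesis by (simp add: add_divide_distrib add.commute)
    qed
    then have "((\<lambda>x. C / 2 * erf ((r * x + a * \<nu> / r) / sqrt 2)) \<longlongrightarrow> C / 2 * 1) at_top"
      by (intro tendsto_intros filterlim_compose[OF erf_tendsto_at_top])
    then show "(F \<longlongrightarrow> C / 2) at_top" by (simp add: F_def[abs_def])
  qed auto
  \<comment> \<open>The argument at x = \<nu> simplifies because r^2 + a = 1.\<close>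
  moreover have "(r * \<nu> + a * \<nu> / r) / sqrt 2 = \<nu> / (sqrt 2 * r)"
  proof -
    have "r * \<nu> + a * \<nu> / r = (r\<^sup>2 + a) * \<nu> / r" using r by (simp add: field_simps power2_eq_square)
    then show ?thesis by (simp add: r2)
  qed
  then have "C / 2 - F \<nu> = 1/2 * (C * erfc (\<nu> / (sqrt 2 * r)))"
    by (simp add: F_def erfc_def algebra_simps)
  ultimately show ?thesis by (simp add: C_def r_def)
qed

lemma nn_integral_excess:
  assumes a: "0 \<le> a" "a < 1"
  shows "(\<integral>\<^sup>+x. ennreal (exp (a / 2 * (max 0 (x - \<nu>))\<^sup>2)) \<partial>std_gauss) = ennreal (excess_mgf a \<nu>)"
proof -
  interpret prob_space std_gauss by (rule prob_space_std_gauss)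
  define A where "A = 1/2 * (exp (a * \<nu>\<^sup>2 / (2 * (1 - a))) / sqrt (1 - a) * erfc (\<nu> / (sqrt 2 * sqrt (1 - a))))"
  define p where "p = 1/2 * erfc (\<nu> / sqrt 2)"
  have nonneg: "0 \<le> erfc x" for x
  proof -
    have "erf x \<le> 1"
    proof (rule tendsto_lowerbound[OF erf_tendsto_at_top])
      have mono: "erf x \<le> erf y" if "x \<le> y" for y
        using that by (rule DERIV_nonneg_imp_nondecreasing) (metis erf_has_real_derivative exp_ge_zero divide_nonneg_nonneg mult_nonneg_nonneg real_sqrt_ge_zero pi_ge_zero zero_le_numeral)
      show "\<forall>\<^sub>F y in at_top. erf x \<le> erf y" by (rule eventually_mono[OF eventually_ge_at_top[of x] mono])
    qed simp
    then show ?thesis by (simp add: erfc_def)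
  qed
  have A: "A \<ge> 0" unfolding A_def using a nonneg by simp
  have p: "p \<ge> 0" unfolding p_def using nonneg by simp
  \<comment> \<open>The case a = 0 of the tail formula is the Gaussian tail probability; below \<nu>
    the integrand is 1 and contributes 1 - p.\<close>
  have up: "emeasure std_gauss {\<nu>..} = ennreal p"
    using nn_integral_excess_tail[of 0 \<nu>] by (simp add: emeasure_density p_def)
  have "prob {\<nu>..} = p" using up p by (simp add: measure_def)
  then have "prob {..<\<nu>} = 1 - p"
    using prob_compl[of "{\<nu>..}"] by (simp add: Compl_eq_Diff_UNIV[symmetric] Compl_atLeast)
  then have low: "emeasure std_gauss {..<\<nu>} = ennreal (1 - p)"
    by (simp add: emeasure_eq_measure)
  have p1: "0 \<le> 1 - p" using \<open>prob {..<\<nu>} = 1 - p\<close> measure_nonneg by metis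
  have "(\<integral>\<^sup>+x. ennreal (exp (a / 2 * (max 0 (x - \<nu>))\<^sup>2)) \<partial>std_gauss)
      = (\<integral>\<^sup>+x. ennreal (std_normal_density x) * ennreal (exp (a / 2 * (max 0 (x - \<nu>))\<^sup>2)) \<partial>lborel)"
    by (subst nn_integral_density) auto
  also have "\<dots> = (\<integral>\<^sup>+x. ennreal (std_normal_density x * exp (a / 2 * (x - \<nu>)\<^sup>2)) * indicator {\<nu>..} x
      + ennreal (std_normal_density x) * indicator {..<\<nu>} x \<partial>lborel)"
    by (intro nn_integral_cong) (auto split: split_indicator simp: ennreal_mult normal_density_nonneg max_def)
  also have "\<dots> = ennreal A + ennreal (1 - p)"
    using low nn_integral_excess_tail[OF a, of \<nu>] by (subst nn_integral_add) (auto simp: A_def emeasure_density)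
  also have "\<dots> = ennreal (A + (1 - p))" using A p1 by simp
  also have "A + (1 - p) = excess_mgf a \<nu>"
    by (simp add: A_def p_def excess_mgf_def erfc_def algebra_simps)
  finally show ?thesis .
qed

lemma nn_integral_std_gauss_minus:
  assumes [measurable]: "f \<in> borel_measurable borel"
  shows "(\<integral>\<^sup>+x. f (- x) \<partial>std_gauss) = (\<integral>\<^sup>+x. f x \<partial>std_gauss)"
proof -
  have "(\<integral>\<^sup>+x. f x \<partial>std_gauss) = (\<integral>\<^sup>+x. ennreal (std_normal_density x) * f x \<partial>lborel)"
    by (subst nn_integral_density) auto
  also have "\<dots> = (\<integral>\<^sup>+x. ennreal (std_normal_density (- x)) * f (- x) \<partial>lborel)"
    by (subst nn_integral_real_affine[where c="-1" and t=0]) auto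
  also have "\<dots> = (\<integral>\<^sup>+x. f (- x) \<partial>std_gauss)"
    by (subst nn_integral_density) (auto simp: normal_density_def)
  finally show ?thesis ..
qed

text \<open>The integrand is at least 1. Nonnegative logarithms of \<open>w1\<close> and
  \<open>w2\<close> are what limits the cost of rounding k and n - k to a constant factor.\<close>

lemma excess_mgf_ge_1:
  assumes "0 \<le> a" "a < 1"
  shows "excess_mgf a \<nu> \<ge> 1"
proof -
  interpret prob_space std_gauss by (rule prob_space_std_gauss)
  have "(\<integral>\<^sup>+x. 1 \<partial>std_gauss) \<le> ennreal (excess_mgf a \<nu>)"
    unfolding nn_integral_excess[OF assms, symmetric] using assms by (intro nn_integral_mono) simp
  then have "ennreal 1 \<le> ennreal (excess_mgf a \<nu>)" using emeasure_space_1 by simp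
  then show ?thesis by (subst (asm) ennreal_le_iff2) auto
qed

lemma nn_integral_std_gauss_exp_square:
  assumes "t \<ge> 0"
  shows "(\<integral>\<^sup>+x. ennreal (exp (- t * x\<^sup>2 / 2)) \<partial>std_gauss) = ennreal (1 / sqrt (1 + t))"
proof -
  define \<sigma> where "\<sigma> = 1 / sqrt (1 + t)"
  have \<sigma>: "\<sigma> > 0" "\<sigma>\<^sup>2 = 1 / (1 + t)" using assms by (auto simp: \<sigma>_def power_divide)
  have "std_normal_density x * exp (- t * x\<^sup>2 / 2) = \<sigma> * normal_density 0 \<sigma> x" for x
  proof -
    have "\<sigma> * normal_density 0 \<sigma> x = 1 / sqrt (2 * pi) * exp (- x\<^sup>2 / (2 * \<sigma>\<^sup>2))"
      using \<sigma>(1) by (simp add: normal_density_def real_sqrt_mult)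
    also have "- x\<^sup>2 / (2 * \<sigma>\<^sup>2) = - x\<^sup>2 / 2 + - t * x\<^sup>2 / 2"
      unfolding \<sigma>(2) using assms by (simp add: field_simps)
    finally show ?thesis by (simp add: std_normal_density_def mult_exp_exp)
  qed
  then have "(\<integral>\<^sup>+x. ennreal (exp (- t * x\<^sup>2 / 2)) \<partial>std_gauss) = (\<integral>\<^sup>+x. ennreal (\<sigma> * normal_density 0 \<sigma> x) \<partial>lborel)"
    by (subst nn_integral_density) (auto simp: ennreal_mult[symmetric] normal_density_nonneg simp del: ennreal_mult)
  also have "\<dots> = ennreal (\<integral>x. \<sigma> * normal_density 0 \<sigma> x \<partial>lborel)"
    using \<sigma>(1) by (intro nn_integral_eq_integral) (auto simp: normal_density_nonneg)
  also have "\<dots> = ennreal \<sigma>" using \<sigma>(1) by simp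
  finally show ?thesis by (simp add: \<sigma>_def)
qed

section \<open>Descent directions and Lagrange duality\<close>

definition descent_hats :: "nat \<Rightarrow> nat set \<Rightarrow> (nat \<Rightarrow> real) set" where
  "descent_hats n S = {w \<in> unit_hats n. (\<forall>j<n. if j \<in> S then w j \<le> 0 else w j \<ge> 0) \<and> (\<Sum>j<n. w j) \<le> 0}"

text \<open>The direction is the normalized difference x - \<open>xtilde S\<close>: the box
  constraints fix its signs, and since both vectors are nonnegative, comparing l1 norms means
  comparing sums. The value 1 from index n on supplies the appended coordinate.\<close>

lemma bin_l1_fail_imp_descent:
  assumes "bin_l1_fail m n S A"
  shows "\<exists>w\<in>descent_hats n S. \<forall>i<m. (\<Sum>j<n. A (i, j) * w j) = 0"
proof -
  obtain x where x: "\<And>j. j < n \<Longrightarrow> 0 \<le> x j \<and> x j \<le> 1"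
      "\<And>i. i < m \<Longrightarrow> (\<Sum>j<n. A (i, j) * x j) = (\<Sum>j<n. A (i, j) * xtilde S j)"
      "\<exists>j<n. x j \<noteq> xtilde S j" "(\<Sum>j<n. \<bar>x j\<bar>) \<le> (\<Sum>j<n. \<bar>xtilde S j\<bar>)"
    using assms unfolding bin_l1_fail_def by blast
  define d where "d j = x j - xtilde S j" for j
  define r where "r = sqrt (\<Sum>j<n. (d j)\<^sup>2)"
  obtain j0 where j0: "j0 < n" "d j0 \<noteq> 0" using x(3) by (auto simp: d_def)
  have pos: "(\<Sum>j<n. (d j)\<^sup>2) > 0" using j0 by (intro sum_pos2[of _ j0]) auto
  then have r: "r > 0" "r\<^sup>2 = (\<Sum>j<n. (d j)\<^sup>2)" by (auto simp: r_def)
  define w where "w j = (if j < n then d j / r else 1)" for j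
  have wd: "(\<Sum>j<n. c j * w j) = (\<Sum>j<n. c j * d j) / r" for c
    by (simp add: w_def sum_divide_distrib)
  have "(\<Sum>j<n. (w j)\<^sup>2) = (\<Sum>j<n. (d j)\<^sup>2) / r\<^sup>2"
    by (simp add: w_def power_divide sum_divide_distrib)
  also have "\<dots> = 1" using r by (metis divide_self_if less_irrefl pos)
  finally have "w \<in> unit_hats n" by (simp add: unit_hats_def) (simp add: w_def)
  moreover have "\<forall>j<n. if j \<in> S then w j \<le> 0 else w j \<ge> 0"
    using x(1) r by (auto simp: w_def d_def xtilde_def divide_nonpos_pos)
  moreover have "(\<Sum>j<n. w j) \<le> 0"
  proof -
    have "(\<Sum>j<n. \<bar>x j\<bar>) = (\<Sum>j<n. x j)" using x(1) by (intro sum.cong) auto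
    moreover have "(\<Sum>j<n. \<bar>xtilde S j\<bar>) = (\<Sum>j<n. xtilde S j)" by (intro sum.cong) (auto simp: xtilde_def)
    ultimately have "(\<Sum>j<n. d j) \<le> 0" using x(4) by (simp add: d_def sum_subtractf)
    then show ?thesis using wd[of "\<lambda>_. 1"] r by (simp add: divide_nonpos_pos)
  qed
  moreover have "(\<Sum>j<n. A (i, j) * w j) = 0" if "i < m" for i
    unfolding wd using x(2)[OF that] by (simp add: d_def right_diff_distrib sum_subtractf)
  ultimately show ?thesis unfolding descent_hats_def by blast
qed

text \<open>The coefficient of |w j| in (- x - \<nu>) w j under the sign constraint on w j, replaced
  by 0 when it is negative.\<close>

definition dual_gap :: "nat set \<Rightarrow> real \<Rightarrow> nat \<Rightarrow> real \<Rightarrow> real" where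
  "dual_gap S \<nu> j x = (if j \<in> S then max 0 (x + \<nu>) else max 0 (- x - \<nu>))"

text \<open>Weak duality: - \<nu> times the sum of w is nonnegative and may be added; then z |w j|
  <= g (w j)^2 + z^2 / (4 g) holds entrywise, and the unit length sums the first terms to g.\<close>

lemma descent_dual_bound:
  assumes w: "w \<in> descent_hats n S" and "\<nu> \<ge> 0" "g > 0"
  shows "- (\<Sum>j<n. h j * w j) \<le> g + (\<Sum>j<n. (dual_gap S \<nu> j (h j))\<^sup>2) / (4 * g)"
proof -
  have sgn: "\<And>j. j < n \<Longrightarrow> if j \<in> S then w j \<le> 0 else w j \<ge> 0" and s: "(\<Sum>j<n. w j) \<le> 0"
    and u: "(\<Sum>j<n. (w j)\<^sup>2) = 1"
    using w by (auto simp: descent_hats_def unit_hats_def)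
  have "- (\<Sum>j<n. h j * w j) \<le> - (\<Sum>j<n. h j * w j) - \<nu> * (\<Sum>j<n. w j)"
    using s \<open>\<nu> \<ge> 0\<close> by (simp add: mult_nonneg_nonpos)
  also have "\<dots> = (\<Sum>j<n. (- h j - \<nu>) * w j)"
    by (simp add: sum_distrib_left left_diff_distrib sum_subtractf sum_negf)
  also have "\<dots> \<le> (\<Sum>j<n. g * (w j)\<^sup>2 + (dual_gap S \<nu> j (h j))\<^sup>2 / (4 * g))"
  proof (rule sum_mono)
    fix j assume "j \<in> {..<n}"
    then have j: "if j \<in> S then w j \<le> 0 else w j \<ge> 0" using sgn by simp
    let ?z = "dual_gap S \<nu> j (h j)"
    have "(- h j - \<nu>) * w j \<le> ?z * \<bar>w j\<bar>"
    proof (cases "j \<in> S")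
      case True
      then have "(- h j - \<nu>) * w j = (h j + \<nu>) * \<bar>w j\<bar>" using j by (simp add: algebra_simps)
      also have "\<dots> \<le> ?z * \<bar>w j\<bar>" using True by (intro mult_right_mono) (auto simp: dual_gap_def)
      finally show ?thesis .
    next
      case False
      then have "(- h j - \<nu>) * w j = (- h j - \<nu>) * \<bar>w j\<bar>" using j by simp
      also have "\<dots> \<le> ?z * \<bar>w j\<bar>" using False by (intro mult_right_mono) (auto simp: dual_gap_def)
      finally show ?thesis .
    qed
    also have "\<dots> \<le> g * (w j)\<^sup>2 + ?z\<^sup>2 / (4 * g)"
    proof -
      have "0 \<le> (2 * g * \<bar>w j\<bar> - ?z)\<^sup>2" by simp
      also have "\<dots> = 4 * g * (g * (w j)\<^sup>2) + ?z\<^sup>2 - 4 * g * (?z * \<bar>w j\<bar>)"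
        by (simp add: power2_diff power_mult_distrib) (simp add: power2_eq_square)
      finally have "4 * g * (?z * \<bar>w j\<bar>) \<le> 4 * g * (g * (w j)\<^sup>2) + ?z\<^sup>2" by simp
      then have "4 * g * (?z * \<bar>w j\<bar>) \<le> 4 * g * (g * (w j)\<^sup>2 + ?z\<^sup>2 / (4 * g))"
        using \<open>g > 0\<close> by (simp add: distrib_left)
      then show ?thesis using \<open>g > 0\<close> by (simp del: times_divide_eq_right add: mult_le_cancel_left_pos)
    qed
    finally show "(- h j - \<nu>) * w j \<le> g * (w j)\<^sup>2 + ?z\<^sup>2 / (4 * g)" .
  qed
  also have "\<dots> = g + (\<Sum>j<n. (dual_gap S \<nu> j (h j))\<^sup>2) / (4 * g)"
    using u by (simp add: sum.distrib sum_distrib_left[symmetric] sum_divide_distrib[symmetric])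
  finally show ?thesis .
qed

text \<open>Off \<open>S\<close> a reflection of x gives the excess over \<nu>; on \<open>S\<close>
  it is already the excess over - \<nu>. Hence \<open>w2\<close> belongs to the support and
  \<open>w1\<close> to its complement.\<close>

lemma nn_integral_dual_gap:
  assumes a: "0 \<le> a" "a < 1"
  shows "(\<integral>\<^sup>+x. ennreal (exp (a / 2 * (dual_gap S \<nu> j x)\<^sup>2)) \<partial>std_gauss) = ennreal (excess_mgf a (if j \<in> S then - \<nu> else \<nu>))"
  using nn_integral_excess[OF a, of "- \<nu>"] nn_integral_excess[OF a, of \<nu>]
    nn_integral_std_gauss_minus[of "\<lambda>x. ennreal (exp (a / 2 * (max 0 (x - \<nu>))\<^sup>2))"]
  by (simp add: dual_gap_def)

text \<open>The exact exponential rate of \<open>E exp (- c sqrt n |g|)\<close> for a Gaussian vector \<open>g\<close> of dimension \<open>\<alpha> n\<close>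
  is the supremum over \<open>r > 0\<close> of the left-hand side, attained where \<open>r\<^sup>2 + c r = \<alpha>\<close>.\<close>
lemma I_sph_ge:
  assumes "c > 0" "\<alpha> > 0" "r > 0"
  shows "- c * r / 2 - \<alpha> / 2 * ln (1 + c / r) \<le> I_sph \<alpha> c"
proof -
  \<comment> \<open>The positive root of R^2 + c R = \<alpha>, where the supremum is attained;
    \<open>gamma_hat\<close> equals - R / 2.\<close>
  define R where "R = (sqrt (c\<^sup>2 + 4 * \<alpha>) - c) / 2"
  have gt: "sqrt (c\<^sup>2 + 4 * \<alpha>) > c" using assms by (intro real_less_rsqrt) auto
  then have R: "R > 0" by (simp add: R_def)
  have RR: "R * (R + c) = \<alpha>"
  proof -
    have "R * (R + c) = ((sqrt (c\<^sup>2 + 4 * \<alpha>))\<^sup>2 - c\<^sup>2) / 4"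
      by (simp add: R_def power2_eq_square field_simps)
    also have "\<dots> = \<alpha>" using assms by simp
    finally show ?thesis .
  qed
  have gh: "gamma_hat \<alpha> c = - R / 2" by (simp add: gamma_hat_def R_def field_simps)
  have I: "I_sph \<alpha> c = - c * R / 2 - \<alpha> / 2 * ln (1 + c / R)"
    unfolding I_sph_def gh using R by (simp add: field_simps)
  have pos: "1 + c / R > 0" "1 + c / r > 0" using assms R by (simp_all add: add_pos_pos)
  then have "ln (1 + c / R) - ln (1 + c / r) = ln ((1 + c / R) / (1 + c / r))"
    by (simp add: ln_div)
  also have "\<dots> \<le> (1 + c / R) / (1 + c / r) - 1"
    using pos by (intro ln_le_minus_one divide_pos_pos)
  also have "\<dots> = c * (r - R) / (R * (r + c))"
  proof -
    have "1 + c / R = (R + c) / R" "1 + c / r = (r + c) / r" using assms R by (auto simp: field_simps)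
    moreover have "r + c > 0" using assms by simp
    ultimately show ?thesis using assms R by (simp add: divide_simps) (simp add: algebra_simps)
  qed
  finally have "\<alpha> / 2 * (ln (1 + c / R) - ln (1 + c / r)) \<le> \<alpha> / 2 * (c * (r - R) / (R * (r + c)))"
    using assms by (intro mult_left_mono) auto
  also have "\<dots> = c / 2 * (r - R) * ((R + c) / (r + c))"
  proof -
    have "R * (R + c) / 2 * (c * d / (R * t)) = c / 2 * d * ((R + c) / t)" for d t
      using R by (simp add: divide_simps)
    then show ?thesis unfolding RR .
  qed
  also have "\<dots> \<le> c / 2 * (r - R)"
  proof -
    have "(r - R) * ((R + c) / (r + c)) \<le> r - R"
    proof -
      have "(r - R) - (r - R) * ((R + c) / (r + c)) = (r - R)\<^sup>2 / (r + c)"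
        using assms by (simp add: field_simps power2_eq_square)
      moreover have "(r - R)\<^sup>2 / (r + c) \<ge> 0" using assms by simp
      ultimately show ?thesis by linarith
    qed
    from mult_left_mono[OF this, of "c / 2"] show ?thesis using assms by (simp only: mult.assoc)
  qed
  finally show ?thesis unfolding I by (simp add: algebra_simps)
qed

section \<open>The exponential bound\<close>

text \<open>The tangent of - c sqrt x at x = r^2, r = l d, is - c r / 2 - (c / r) x / 2: a constant
  and a multiple of x, each taken from here and from the slope. A grid of fixed size keeps the
  number of terms independent of n.\<close>

definition tangent_offset :: "real \<Rightarrow> real \<Rightarrow> nat \<Rightarrow> nat \<Rightarrow> real" where
  "tangent_offset c d L l = (if l = 0 then - c * (real L * d) else c * d - c * (real l * d) / 2)"

definition tangent_slope :: "real \<Rightarrow> real \<Rightarrow> nat \<Rightarrow> real" where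
  "tangent_slope c d l = (if l = 0 then 0 else c / (real l * d))"

text \<open>The convex function \<open>x \<mapsto> - c sqrt x\<close> is, up to \<open>c d\<close>, the maximum of its tangents at \<open>(l d)\<^sup>2\<close>,
  \<open>1 \<le> l \<le> L\<close>, as long as \<open>x \<le> (L d)\<^sup>2\<close>; the index \<open>l = 0\<close> takes care of larger \<open>x\<close>.\<close>
lemma exp_norm_le_tangents:
  assumes "c > 0" "d > 0" "n \<ge> 1" "x \<ge> 0"
  shows "exp (- (c * sqrt (real n)) * sqrt x) \<le>
    (\<Sum>l\<le>L. exp (real n * tangent_offset c d L l - tangent_slope c d l * x / 2))"
proof -
  \<comment> \<open>In terms of t the exponent is n times a function that does not involve
    n.\<close>
  define t where "t = sqrt (x / real n)"
  have n: "real n > 0" using assms by simp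
  have t: "t \<ge> 0" "x = real n * t\<^sup>2" using assms n by (auto simp: t_def)
  have "sqrt (real n) * sqrt x = real n * t"
    unfolding t(2) using n t(1) by (simp add: real_sqrt_mult)
  then have lhs: "- (c * sqrt (real n)) * sqrt x = real n * (- c * t)" by simp
  have "\<exists>l\<le>L. - c * t \<le> tangent_offset c d L l - tangent_slope c d l * t\<^sup>2 / 2"
  proof (cases "t > real L * d")
    case True
    then have "c * (real L * d) \<le> c * t" using assms by (intro mult_left_mono) auto
    then show ?thesis by (intro exI[of _ 0]) (simp add: tangent_offset_def tangent_slope_def)
  next
    case False
    show ?thesis
    proof (cases "t = 0")
      \<comment> \<open>Rounding t = 0 up would give the reserved index 0; the first tangent is used
        instead, or index 0 with offset 0 when L = 0.\<close>
      case True
      show ?thesis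
      proof (cases "L = 0")
        case True
        then show ?thesis using \<open>t = 0\<close> by (intro exI[of _ 0]) (simp add: tangent_offset_def tangent_slope_def)
      next
        case False
        then show ?thesis using \<open>t = 0\<close> assms by (intro exI[of _ 1]) (simp add: tangent_offset_def tangent_slope_def)
      qed
    next
      case t0: False
      \<comment> \<open>Rounding up to the grid: r = l d satisfies t <= r <= t + d, and t^2 / r <= r
        bounds the loss of this tangent by c (r - t) <= c d.\<close>
      define l where "l = nat \<lceil>t / d\<rceil>"
      have td: "t / d > 0" using t t0 assms by simp
      then have l1: "l \<ge> 1" unfolding l_def by linarith
      have l: "t / d \<le> real l" "real l < t / d + 1" using td unfolding l_def by linarith+
      define r where "r = real l * d"
      have r: "r > 0" "t \<le> r" "r \<le> t + d"
        using l l1 assms by (auto simp: r_def field_simps)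
      have "t / d \<le> real L" using False assms by (simp add: field_simps)
      then have lL: "l \<le> L" unfolding l_def by (simp add: ceiling_le_iff nat_le_iff)
      have "c / r * t\<^sup>2 \<le> c / r * r\<^sup>2" using assms r t by (intro mult_left_mono power_mono) auto
      also have "\<dots> = c * r" using r by (simp add: power2_eq_square)
      finally have "c / r * t\<^sup>2 \<le> c * r" .
      moreover have "c * r \<le> c * (t + d)" using assms r by (intro mult_left_mono) auto
      ultimately have "- c * t \<le> (c * d - c * r / 2) - c / r * t\<^sup>2 / 2" by (simp add: distrib_left)
      moreover have "tangent_offset c d L l = c * d - c * r / 2" "tangent_slope c d l = c / r"
        using l1 by (auto simp: tangent_offset_def tangent_slope_def r_def)
      ultimately show ?thesis using lL by (intro exI[of _ l]) simp
    qed
  qed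
  then obtain l where l: "l \<le> L" "- c * t \<le> tangent_offset c d L l - tangent_slope c d l * t\<^sup>2 / 2" by blast
  then have "real n * (- c * t) \<le> real n * (tangent_offset c d L l - tangent_slope c d l * t\<^sup>2 / 2)"
    using n by (intro mult_left_mono) auto
  also have "\<dots> = real n * tangent_offset c d L l - tangent_slope c d l * x / 2"
    by (simp add: t(2) right_diff_distrib)
  finally have "exp (- (c * sqrt (real n)) * sqrt x) \<le> exp (real n * tangent_offset c d L l - tangent_slope c d l * x / 2)"
    unfolding lhs by simp
  also have "\<dots> \<le> (\<Sum>l\<le>L. exp (real n * tangent_offset c d L l - tangent_slope c d l * x / 2))"
    using l(1) by (intro member_le_sum) auto
  finally show ?thesis .
qed

text \<open>This is the shape of the block \<open>False\<close>: column n above the corner carries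
  g, row m left of the corner carries h, and every other entry contributes 1.\<close>

lemma prod_cross:
  fixes A B :: "nat \<Rightarrow> 'a::comm_monoid_mult"
  shows "(\<Prod>k\<in>{..m} \<times> {..n}. if fst k < m \<and> snd k = n then A (fst k) else if fst k = m \<and> snd k < n then B (snd k) else 1)
    = (\<Prod>i<m. A i) * (\<Prod>j<n. B j)"
proof -
  let ?g = "\<lambda>i j. if i < m \<and> j = n then A i else if i = m \<and> j < n then B j else 1"
  have "(\<Prod>k\<in>{..m} \<times> {..n}. ?g (fst k) (snd k)) = (\<Prod>i\<le>m. \<Prod>j\<le>n. ?g i j)"
    by (simp add: prod.cartesian_product split_beta)
  also have "\<dots> = (\<Prod>i<m. \<Prod>j\<le>n. ?g i j) * (\<Prod>j\<le>n. ?g m j)"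
    by (simp add: lessThan_Suc_atMost[symmetric])
  also have "(\<Prod>i<m. \<Prod>j\<le>n. ?g i j) = (\<Prod>i<m. A i)"
    by (intro prod.cong refl) (simp add: lessThan_Suc_atMost[symmetric])
  also have "(\<Prod>j\<le>n. ?g m j) = (\<Prod>j<n. B j)"
    by (simp add: lessThan_Suc_atMost[symmetric])
  finally show ?thesis .
qed

text \<open>With |g|^2 in place of |g| and the dual bound in place of the maximum, the integrand
  factors over the entries: each entry of g gives 1 / sqrt (1 + t), each entry of h one of the two
  excess integrals.\<close>

lemma nn_integral_cross_prod:
  assumes S: "S \<subseteq> {..<n}" and a: "0 \<le> a" "a < 1" and t: "t \<ge> 0"
  shows "(\<integral>\<^sup>+\<omega>. ennreal (exp (- t * (\<Sum>i<m. (\<omega> (i, n))\<^sup>2) / 2) * exp (a / 2 * (\<Sum>j<n. (dual_gap S \<nu> j (\<omega> (m, j)))\<^sup>2))) \<partial>gauss_PiM ({..m} \<times> {..n}))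
    = ennreal ((1 / sqrt (1 + t)) ^ m * (excess_mgf a \<nu> ^ (n - card S) * excess_mgf a (- \<nu>) ^ card S))"
proof -
  interpret product_sigma_finite "\<lambda>_::nat \<times> nat. std_gauss" by (rule product_sigma_finite_std_gauss)
  let ?K = "{..m} \<times> {..n}"
  let ?W = "\<lambda>j. excess_mgf a (if j \<in> S then - \<nu> else \<nu>)"
  define \<phi> where "\<phi> k y = (if fst k < m \<and> snd k = n then exp (- t * y\<^sup>2 / 2)
    else if fst k = m \<and> snd k < n then exp (a / 2 * (dual_gap S \<nu> (snd k) y)\<^sup>2) else 1)" for k :: "nat \<times> nat" and y
  have gap_meas: "dual_gap S \<nu> j \<in> borel_measurable borel" for j
    unfolding dual_gap_def[abs_def] by measurable
  have \<phi>_meas: "(\<lambda>y. ennreal (\<phi> k y)) \<in> borel_measurable std_gauss" for k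
    unfolding \<phi>_def using gap_meas by measurable
  have "exp (- t * (\<Sum>i<m. (\<omega> (i, n))\<^sup>2) / 2) * exp (a / 2 * (\<Sum>j<n. (dual_gap S \<nu> j (\<omega> (m, j)))\<^sup>2)) = (\<Prod>k\<in>?K. \<phi> k (\<omega> k))" for \<omega>
  proof -
    have "(\<Prod>k\<in>?K. \<phi> k (\<omega> k)) = (\<Prod>k\<in>?K. if fst k < m \<and> snd k = n then exp (- t * (\<omega> (fst k, n))\<^sup>2 / 2)
        else if fst k = m \<and> snd k < n then exp (a / 2 * (dual_gap S \<nu> (snd k) (\<omega> (m, snd k)))\<^sup>2) else 1)"
      unfolding \<phi>_def by (intro prod.cong) auto
    also have "\<dots> = (\<Prod>i<m. exp (- t * (\<omega> (i, n))\<^sup>2 / 2)) * (\<Prod>j<n. exp (a / 2 * (dual_gap S \<nu> j (\<omega> (m, j)))\<^sup>2))"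
      by (rule prod_cross)
    finally show ?thesis
      by (simp add: exp_sum[symmetric] sum_distrib_left sum_divide_distrib sum_negf)
  qed
  then have "(\<integral>\<^sup>+\<omega>. ennreal (exp (- t * (\<Sum>i<m. (\<omega> (i, n))\<^sup>2) / 2) * exp (a / 2 * (\<Sum>j<n. (dual_gap S \<nu> j (\<omega> (m, j)))\<^sup>2))) \<partial>gauss_PiM ?K)
    = (\<integral>\<^sup>+\<omega>. (\<Prod>k\<in>?K. ennreal (\<phi> k (\<omega> k))) \<partial>gauss_PiM ?K)"
    by (simp add: prod_ennreal \<phi>_def)
  also have "\<dots> = (\<Prod>k\<in>?K. (\<integral>\<^sup>+y. ennreal (\<phi> k y) \<partial>std_gauss))"
    by (rule product_nn_integral_prod[OF _ \<phi>_meas]) simp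
  also have "\<dots> = (\<Prod>k\<in>?K. if fst k < m \<and> snd k = n then ennreal (1 / sqrt (1 + t))
      else if fst k = m \<and> snd k < n then ennreal (?W (snd k)) else 1)"
  proof (intro prod.cong refl)
    fix k
    interpret prob_space std_gauss by (rule prob_space_std_gauss)
    show "(\<integral>\<^sup>+y. ennreal (\<phi> k y) \<partial>std_gauss) = (if fst k < m \<and> snd k = n then ennreal (1 / sqrt (1 + t))
      else if fst k = m \<and> snd k < n then ennreal (?W (snd k)) else 1)"
    proof -
      have "(\<integral>\<^sup>+y. ennreal (if P then u y else if Q then v y else 1) \<partial>std_gauss) =
          (if P then \<integral>\<^sup>+y. ennreal (u y) \<partial>std_gauss else if Q then \<integral>\<^sup>+y. ennreal (v y) \<partial>std_gauss else 1)"
        for P Q and u v :: "real \<Rightarrow> real"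
        using emeasure_space_1 by simp
      then show ?thesis
        unfolding \<phi>_def by (simp only: nn_integral_std_gauss_exp_square[OF t] nn_integral_dual_gap[OF a])
    qed
  qed
  also have "\<dots> = (\<Prod>i<m. ennreal (1 / sqrt (1 + t))) * (\<Prod>j<n. ennreal (?W j))"
    by (rule prod_cross)
  also have "(\<Prod>j<n. ennreal (?W j)) = ennreal (\<Prod>j<n. ?W j)"
  proof (rule prod_ennreal)
    fix j show "0 \<le> ?W j" using excess_mgf_ge_1[OF a, of "if j \<in> S then - \<nu> else \<nu>"] by linarith
  qed
  also have "(\<Prod>j<n. ?W j) = excess_mgf a \<nu> ^ (n - card S) * excess_mgf a (- \<nu>) ^ card S"
  proof -
    have "(\<Prod>j<n. ?W j) = (\<Prod>j\<in>{..<n} - S. ?W j) * (\<Prod>j\<in>S. ?W j)"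
      using S by (intro prod.subset_diff) auto
    also have "(\<Prod>j\<in>{..<n} - S. ?W j) = excess_mgf a \<nu> ^ (n - card S)"
      using S by (simp add: card_Diff_subset finite_subset)
    finally show ?thesis by simp
  qed
  also have "(\<Prod>i<m. ennreal (1 / sqrt (1 + t))) = ennreal ((1 / sqrt (1 + t)) ^ m)"
    using t by (simp add: ennreal_power)
  also have "\<dots> * ennreal (excess_mgf a \<nu> ^ (n - card S) * excess_mgf a (- \<nu>) ^ card S) =
      ennreal ((1 / sqrt (1 + t)) ^ m * (excess_mgf a \<nu> ^ (n - card S) * excess_mgf a (- \<nu>) ^ card S))"
    using t by (intro ennreal_mult'[symmetric]) simp
  finally show ?thesis .
qed

lemma P_err_le:
  assumes S: "S \<subseteq> {..<n}" and n: "n \<ge> 1" and c: "c3 > 0" and \<nu>: "\<nu> \<ge> 0" and \<gamma>: "\<gamma> > c3 / 2" and d: "d > 0"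
  shows "P_err m n S * exp (c3\<^sup>2 * real n / 2) \<le> exp (c3 * sqrt (real n)) *
    (\<Sum>l\<le>L. 2 * exp (real n * (tangent_offset c3 d L l + c3 * \<gamma>)) *
      ((1 / sqrt (1 + tangent_slope c3 d l)) ^ m * (w1 c3 \<nu> \<gamma> ^ (n - card S) * w2 c3 \<nu> \<gamma> ^ card S)))"
proof -
  \<comment> \<open>The condition \<gamma> > c3 / 2 is a < 1, under which the excess integrals are
    finite.\<close>
  define a where "a = c3 / (2 * \<gamma>)"
  have \<gamma>0: "\<gamma> > 0" using c \<gamma> by simp
  have a: "0 \<le> a" "a < 1" using c \<gamma> \<gamma>0 by (auto simp: a_def field_simps)
  define c where "c = c3 * sqrt (real n)"
  have c0: "c \<ge> 0" using \<open>c3 > 0\<close> by (simp add: c_def)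
  have c2: "c\<^sup>2 = c3\<^sup>2 * real n" by (simp add: c_def power_mult_distrib)
  define U where "U h = exp (real n * (c3 * \<gamma>)) * exp (a / 2 * (\<Sum>j<n. (dual_gap S \<nu> j (h j))\<^sup>2))" for h
  let ?Ev = "{A \<in> space (gauss_mat m n). bin_l1_fail m n S A}"
  let ?K = "{..m} \<times> {..n}"
  interpret G: prob_space "gauss_mat m n" unfolding gauss_mat_def by (rule prob_space_gauss_PiM)
  have slope: "tangent_slope c3 d l \<ge> 0" for l using \<open>c3 > 0\<close> d by (simp add: tangent_slope_def)
  have wpos: "w1 c3 \<nu> \<gamma> \<ge> 0" "w2 c3 \<nu> \<gamma> \<ge> 0"
    unfolding w1_eq_excess_mgf w2_eq_excess_mgf a_def[symmetric]
    using excess_mgf_ge_1[OF a, of \<nu>] excess_mgf_ge_1[OF a, of "- \<nu>"] by auto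
  have U: "exp (- c * (\<Sum>j<n. h j * w j)) \<le> U h" if "w \<in> descent_hats n S" for w h
  proof -
    let ?Z = "\<Sum>j<n. (dual_gap S \<nu> j (h j))\<^sup>2"
    have rn: "sqrt (real n) > 0" using n by simp
    \<comment> \<open>The norm multiplier is g = \<gamma> sqrt n: with c = c3 sqrt n, the product c
      g is n c3 \<gamma>, and c / (4 g) is a / 2, free of n.\<close>
    have "- (\<Sum>j<n. h j * w j) \<le> \<gamma> * sqrt (real n) + ?Z / (4 * (\<gamma> * sqrt (real n)))"
      using that \<nu> \<gamma>0 rn by (intro descent_dual_bound) auto
    then have "c * - (\<Sum>j<n. h j * w j) \<le> c * (\<gamma> * sqrt (real n) + ?Z / (4 * (\<gamma> * sqrt (real n))))"
      using c0 by (rule mult_left_mono)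
    also have "\<dots> = real n * (c3 * \<gamma>) + a / 2 * ?Z"
    proof -
      have "c * (\<gamma> * sqrt (real n)) = c3 * \<gamma> * (sqrt (real n) * sqrt (real n))"
        by (simp only: c_def mult_ac)
      then have "c * (\<gamma> * sqrt (real n)) = real n * (c3 * \<gamma>)" by (simp add: mult_ac)
      moreover have "c * (?Z / (4 * (\<gamma> * sqrt (real n)))) = a / 2 * ?Z"
        using rn \<gamma>0 by (simp add: c_def a_def)
      ultimately show ?thesis by (simp only: distrib_left)
    qed
    finally show ?thesis unfolding U_def mult_exp_exp by simp
  qed
  have "emeasure (gauss_mat m n) ?Ev * ennreal (exp (c\<^sup>2 / 2)) \<le> ennreal (exp c) *
      (\<integral>\<^sup>+\<omega>. ennreal (2 * exp (- c * sqrt (\<Sum>i<m. (\<omega> (i, n))\<^sup>2)) * U (\<lambda>j. \<omega> (m, j))) \<partial>gauss_PiM ?K)"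
  proof (rule gordon_escape[OF _ c0 U])
    show "descent_hats n S \<subseteq> unit_hats n" by (auto simp: descent_hats_def)
  qed (auto intro: bin_l1_fail_imp_descent)
  also have "(\<integral>\<^sup>+\<omega>. ennreal (2 * exp (- c * sqrt (\<Sum>i<m. (\<omega> (i, n))\<^sup>2)) * U (\<lambda>j. \<omega> (m, j))) \<partial>gauss_PiM ?K)
    \<le> (\<integral>\<^sup>+\<omega>. (\<Sum>l\<le>L. ennreal (2 * exp (real n * (tangent_offset c3 d L l + c3 * \<gamma>))) *
      ennreal (exp (- tangent_slope c3 d l * (\<Sum>i<m. (\<omega> (i, n))\<^sup>2) / 2) * exp (a / 2 * (\<Sum>j<n. (dual_gap S \<nu> j (\<omega> (m, j)))\<^sup>2)))) \<partial>gauss_PiM ?K)"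
  proof (rule nn_integral_mono)
    fix \<omega> :: "nat \<times> nat \<Rightarrow> real"
    let ?x = "\<Sum>i<m. (\<omega> (i, n))\<^sup>2" and ?y = "exp (a / 2 * (\<Sum>j<n. (dual_gap S \<nu> j (\<omega> (m, j)))\<^sup>2))"
    have "exp (- c * sqrt ?x) \<le> (\<Sum>l\<le>L. exp (real n * tangent_offset c3 d L l - tangent_slope c3 d l * ?x / 2))"
      unfolding c_def by (rule exp_norm_le_tangents[OF \<open>c3 > 0\<close> d n]) (simp add: sum_nonneg)
    then have "2 * exp (- c * sqrt ?x) * U (\<lambda>j. \<omega> (m, j)) \<le>
        2 * (\<Sum>l\<le>L. exp (real n * tangent_offset c3 d L l - tangent_slope c3 d l * ?x / 2)) * U (\<lambda>j. \<omega> (m, j))"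
      by (intro mult_right_mono mult_left_mono) (auto simp: U_def)
    also have "\<dots> = (\<Sum>l\<le>L. 2 * exp (real n * (tangent_offset c3 d L l + c3 * \<gamma>)) * (exp (- tangent_slope c3 d l * ?x / 2) * ?y))"
    proof -
      have distrib: "2 * sum e T * u = (\<Sum>l\<in>T. 2 * e l * u)" for e :: "nat \<Rightarrow> real" and T u
        by (simp add: sum_distrib_left sum_distrib_right)
      have "2 * exp (N * A - s * x / 2) * (exp (N * g) * y) = 2 * exp (N * (A + g)) * (exp (- s * x / 2) * y)" for N A s x g y :: real
      proof -
        have "exp (N * A - s * x / 2) * exp (N * g) = exp (N * (A + g)) * exp (- s * x / 2)"
          unfolding mult_exp_exp by (simp add: algebra_simps)
        then show ?thesis by (metis mult.assoc)
      qed
      then show ?thesis unfolding distrib U_def by (intro sum.cong refl)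
    qed
    finally have "ennreal (2 * exp (- c * sqrt ?x) * U (\<lambda>j. \<omega> (m, j))) \<le> 
        ennreal (\<Sum>l\<le>L. 2 * exp (real n * (tangent_offset c3 d L l + c3 * \<gamma>)) * (exp (- tangent_slope c3 d l * ?x / 2) * ?y))"
      by (rule ennreal_leI)
    also have "\<dots> = (\<Sum>l\<le>L. ennreal (2 * exp (real n * (tangent_offset c3 d L l + c3 * \<gamma>))) * ennreal (exp (- tangent_slope c3 d l * ?x / 2) * ?y))"
      by (subst sum_ennreal[symmetric]) (auto simp: ennreal_mult intro!: sum.cong)
    finally show "ennreal (2 * exp (- c * sqrt ?x) * U (\<lambda>j. \<omega> (m, j))) \<le> \<dots>" .
  qed
  also have "\<dots> = (\<Sum>l\<le>L. ennreal (2 * exp (real n * (tangent_offset c3 d L l + c3 * \<gamma>))) *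
      ennreal ((1 / sqrt (1 + tangent_slope c3 d l)) ^ m * (w1 c3 \<nu> \<gamma> ^ (n - card S) * w2 c3 \<nu> \<gamma> ^ card S)))"
  proof -
    have gap_meas: "dual_gap S \<nu> j \<in> borel_measurable borel" for j
      unfolding dual_gap_def[abs_def] by measurable
    have meas: "(\<lambda>\<omega>. ennreal (exp (- tangent_slope c3 d l * (\<Sum>i<m. (\<omega> (i, n))\<^sup>2) / 2) * exp (a / 2 * (\<Sum>j<n. (dual_gap S \<nu> j (\<omega> (m, j)))\<^sup>2)))) \<in> borel_measurable (gauss_PiM ?K)" for l
    proof -
      have "(\<lambda>\<omega>. \<Sum>i<m. (\<omega> (i, n))\<^sup>2) \<in> borel_measurable (gauss_PiM ?K)"
        by (intro borel_measurable_sum borel_measurable_power measurable_gauss_PiM_component) auto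
      moreover have "(\<lambda>\<omega>. \<Sum>j<n. (dual_gap S \<nu> j (\<omega> (m, j)))\<^sup>2) \<in> borel_measurable (gauss_PiM ?K)"
        by (intro borel_measurable_sum borel_measurable_power measurable_compose[OF measurable_gauss_PiM_component gap_meas]) auto
      ultimately show ?thesis by measurable
    qed
    show ?thesis
      unfolding w1_eq_excess_mgf w2_eq_excess_mgf a_def[symmetric]
      by (subst nn_integral_sum[OF borel_measurable_times_ennreal[OF borel_measurable_const meas]])
         (simp only: nn_integral_cmult[OF meas] nn_integral_cross_prod[OF S a slope])
  qed
  also have "\<dots> = ennreal (\<Sum>l\<le>L. 2 * exp (real n * (tangent_offset c3 d L l + c3 * \<gamma>)) *
      ((1 / sqrt (1 + tangent_slope c3 d l)) ^ m * (w1 c3 \<nu> \<gamma> ^ (n - card S) * w2 c3 \<nu> \<gamma> ^ card S)))"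
    using wpos slope by (subst sum_ennreal[symmetric]) (auto simp: ennreal_mult intro!: sum.cong)
  finally have "ennreal (P_err m n S * exp (c\<^sup>2 / 2)) \<le> ennreal (exp c * (\<Sum>l\<le>L. 2 * exp (real n * (tangent_offset c3 d L l + c3 * \<gamma>)) *
      ((1 / sqrt (1 + tangent_slope c3 d l)) ^ m * (w1 c3 \<nu> \<gamma> ^ (n - card S) * w2 c3 \<nu> \<gamma> ^ card S))))"
    unfolding P_err_def G.emeasure_eq_measure by (simp add: ennreal_mult' mult_left_mono)
  then show ?thesis
    unfolding c2 unfolding c_def using wpos slope
    by (subst (asm) ennreal_le_iff) (auto intro!: mult_nonneg_nonneg sum_nonneg)
qed

text \<open>For l >= 1 this is \<open>I_sph_ge\<close> at r = l d. Index 0 has no tangent; there the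
  assumption puts the end L d of the grid far enough out that - c L d is at most
  \<open>I_sph\<close>.\<close>

lemma tangent_rate:
  assumes "c > 0" "\<alpha> > 0" "d > 0" "- I_sph \<alpha> c \<le> c * (real L * d)"
  shows "tangent_offset c d L l - \<alpha> / 2 * ln (1 + tangent_slope c d l) \<le> I_sph \<alpha> c + c * d"
proof (cases "l = 0")
  case True
  have "c * d > 0" using assms by simp
  then show ?thesis using True assms(4) by (simp add: tangent_offset_def tangent_slope_def)
next
  case False
  then show ?thesis
    using I_sph_ge[of c \<alpha> "real l * d"] assms by (simp add: tangent_offset_def tangent_slope_def)
qed

text \<open>The losses are of three kinds: c3 d in the rate, from the grid; c3 sqrt n, from
  smoothing the norm; and a constant C independent of n and of the support, from rounding m and n -
  k and from summing over the grid.\<close>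

lemma P_err_exponential_bound:
  assumes "0 < \<beta>" "\<beta> < 1" "0 < \<alpha>" and c: "c3 > 0" and \<nu>: "\<nu> \<ge> 0" and \<gamma>: "\<gamma> > c3 / 2" and d: "d > 0"
  obtains C where "\<And>n S. n \<ge> 1 \<Longrightarrow> S \<subseteq> {..<n} \<Longrightarrow> card S = nat \<lfloor>\<beta> * real n\<rfloor> \<Longrightarrow>
    P_err (nat \<lfloor>\<alpha> * real n\<rfloor>) n S \<le> exp (real n * (- c3\<^sup>2 / 2 + I_sph \<alpha> c3 + ((1 - \<beta>) * ln (w1 c3 \<nu> \<gamma>) + \<beta> * ln (w2 c3 \<nu> \<gamma>) + c3 * \<gamma>) + c3 * d)
      + c3 * sqrt (real n) + C)"
proof -
  have \<gamma>0: "\<gamma> > 0" using c \<gamma> by simp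
  have a: "0 \<le> c3 / (2 * \<gamma>)" "c3 / (2 * \<gamma>) < 1" using c \<gamma> \<gamma>0 by (auto simp: field_simps)
  let ?w1 = "w1 c3 \<nu> \<gamma>" and ?w2 = "w2 c3 \<nu> \<gamma>"
  have w: "?w1 \<ge> 1" "?w2 \<ge> 1"
    unfolding w1_eq_excess_mgf w2_eq_excess_mgf by (rule excess_mgf_ge_1[OF a])+
  obtain L :: nat where "real L > - I_sph \<alpha> c3 / (c3 * d)" using reals_Archimedean2 by blast
  then have L: "- I_sph \<alpha> c3 \<le> c3 * (real L * d)" using c d by (simp add: field_simps)
  \<comment> \<open>Losses at index l: the factor 2 of the smoothed maximum, half a logarithm
    because m may fall below \<alpha> n by up to 1, and \<open>ln w1\<close> because n - k may
    exceed (1 - \<beta>) n by up to 1. Rounding k down costs nothing, as \<open>ln w2\<close> is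
    nonnegative.\<close>
  define D where "D l = ln 2 + ln (1 + tangent_slope c3 d l) / 2 + ln ?w1" for l
  define C where "C = ln (\<Sum>l\<le>L. exp (D l))"
  let ?W = "(1 - \<beta>) * ln ?w1 + \<beta> * ln ?w2 + c3 * \<gamma>"
  have slope: "tangent_slope c3 d l \<ge> 0" for l using c d by (simp add: tangent_slope_def)
  have C: "exp C = (\<Sum>l\<le>L. exp (D l))"
    unfolding C_def by (rule exp_ln) (rule sum_pos, auto)
  show ?thesis
  proof (rule that[of C])
    fix n S assume n: "n \<ge> (1::nat)" and S: "S \<subseteq> {..<n}" "card S = nat \<lfloor>\<beta> * real n\<rfloor>"
    define m where "m = nat \<lfloor>\<alpha> * real n\<rfloor>"
    have "0 \<le> \<alpha> * real n" using assms by simp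
    then have m: "real m \<ge> \<alpha> * real n - 1" unfolding m_def by linarith
    have bn: "0 \<le> \<beta> * real n" using assms by simp
    have k: "real (card S) \<le> \<beta> * real n" "real (card S) \<ge> \<beta> * real n - 1"
      unfolding S(2) using bn by linarith+
    have "card S \<le> n" using card_mono[OF _ S(1)] by simp
    then have nk: "real (n - card S) \<le> (1 - \<beta>) * real n + 1"
      using k(2) by (simp add: of_nat_diff algebra_simps)
    have term_le: "2 * exp (real n * (tangent_offset c3 d L l + c3 * \<gamma>)) *
      ((1 / sqrt (1 + tangent_slope c3 d l)) ^ m * (?w1 ^ (n - card S) * ?w2 ^ card S))
      \<le> exp (real n * (I_sph \<alpha> c3 + ?W + c3 * d)) * exp (D l)" for l
    proof -
      let ?t = "tangent_slope c3 d l"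
      have t: "1 + ?t > 0" "ln (1 + ?t) \<ge> 0" using slope[of l] by auto
      have 1: "(1 / sqrt (1 + ?t)) ^ m = exp (- (real m / 2 * ln (1 + ?t)))"
      proof -
        have "1 / sqrt (1 + ?t) = exp (- (ln (1 + ?t) / 2))"
          using t by (simp add: exp_minus ln_sqrt[symmetric] inverse_eq_divide)
        then show ?thesis by (simp add: exp_of_nat_mult[symmetric])
      qed
      have 2: "?w1 ^ (n - card S) = exp (real (n - card S) * ln ?w1)" "?w2 ^ card S = exp (real (card S) * ln ?w2)"
        using w by (simp_all add: exp_of_nat_mult)
      have e1: "real (n - card S) * ln ?w1 \<le> ((1 - \<beta>) * real n + 1) * ln ?w1"
        using nk w by (intro mult_right_mono) auto
      have e2: "real (card S) * ln ?w2 \<le> (\<beta> * real n) * ln ?w2"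
        using k w by (intro mult_right_mono) auto
      have e3: "- (real m / 2 * ln (1 + ?t)) \<le> - ((\<alpha> * real n - 1) / 2 * ln (1 + ?t))"
        using mult_right_mono[OF m t(2)] by simp
      have e4: "real n * (tangent_offset c3 d L l - \<alpha> / 2 * ln (1 + ?t)) \<le> real n * (I_sph \<alpha> c3 + c3 * d)"
        using tangent_rate[OF c \<open>0 < \<alpha>\<close> d L] by (intro mult_left_mono) auto
      have "2 * exp (real n * (tangent_offset c3 d L l + c3 * \<gamma>)) *
        ((1 / sqrt (1 + ?t)) ^ m * (?w1 ^ (n - card S) * ?w2 ^ card S)) =
        exp (ln 2 + real n * (tangent_offset c3 d L l + c3 * \<gamma>) + (- (real m / 2 * ln (1 + ?t)) + (real (n - card S) * ln ?w1 + real (card S) * ln ?w2)))"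
        unfolding 1 2 by (simp only: exp_add exp_ln mult.assoc)
      also have "\<dots> \<le> exp (real n * (I_sph \<alpha> c3 + ?W + c3 * d) + D l)"
      proof (subst exp_le_cancel_iff)
        have "real n * (I_sph \<alpha> c3 + ?W + c3 * d) + D l - (ln 2 + real n * (tangent_offset c3 d L l + c3 * \<gamma>) + (- ((\<alpha> * real n - 1) / 2 * ln (1 + ?t)) + (((1 - \<beta>) * real n + 1) * ln ?w1 + (\<beta> * real n) * ln ?w2)))
          = real n * (I_sph \<alpha> c3 + c3 * d) - real n * (tangent_offset c3 d L l - \<alpha> / 2 * ln (1 + ?t))"
          unfolding D_def by (simp add: algebra_simps diff_divide_distrib)
        then show "ln 2 + real n * (tangent_offset c3 d L l + c3 * \<gamma>) + (- (real m / 2 * ln (1 + ?t)) + (real (n - card S) * ln ?w1 + real (card S) * ln ?w2))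
          \<le> real n * (I_sph \<alpha> c3 + ?W + c3 * d) + D l" using e1 e2 e3 e4 by linarith
      qed
      finally show ?thesis by (simp add: exp_add)
    qed
    have "P_err m n S * exp (c3\<^sup>2 * real n / 2) \<le> exp (c3 * sqrt (real n)) *
      (\<Sum>l\<le>L. 2 * exp (real n * (tangent_offset c3 d L l + c3 * \<gamma>)) *
        ((1 / sqrt (1 + tangent_slope c3 d l)) ^ m * (?w1 ^ (n - card S) * ?w2 ^ card S)))"
      by (rule P_err_le[OF S(1) n c \<nu> \<gamma> d])
    also have "\<dots> \<le> exp (c3 * sqrt (real n)) * (\<Sum>l\<le>L. exp (real n * (I_sph \<alpha> c3 + ?W + c3 * d)) * exp (D l))"
      by (intro mult_left_mono sum_mono term_le) auto
    also have "\<dots> = exp (c3 * sqrt (real n)) * (exp (real n * (I_sph \<alpha> c3 + ?W + c3 * d)) * exp C)"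
      unfolding C by (simp add: sum_distrib_left)
    finally have "P_err m n S \<le> exp (c3 * sqrt (real n)) * (exp (real n * (I_sph \<alpha> c3 + ?W + c3 * d)) * exp C) / exp (c3\<^sup>2 * real n / 2)"
      by (simp add: pos_le_divide_eq)
    also have "\<dots> = exp (c3 * sqrt (real n) + (real n * (I_sph \<alpha> c3 + ?W + c3 * d) + C) - c3\<^sup>2 * real n / 2)"
      by (simp only: exp_add exp_diff)
    also have "c3 * sqrt (real n) + (real n * (I_sph \<alpha> c3 + ?W + c3 * d) + C) - c3\<^sup>2 * real n / 2 =
        real n * (- c3\<^sup>2 / 2 + I_sph \<alpha> c3 + ?W + c3 * d) + c3 * sqrt (real n) + C"
      by (simp add: algebra_simps)
    finally show "P_err (nat \<lfloor>\<alpha> * real n\<rfloor>) n S \<le> exp (real n * (- c3\<^sup>2 / 2 + I_sph \<alpha> c3 + ?W + c3 * d) + c3 * sqrt (real n) + C)"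
      by (simp add: m_def)
  qed
qed

section \<open>Passage to the limit\<close>

lemma ln_ereal_div_le:
  assumes "n \<ge> 1" "p \<le> exp (real n * x)"
  shows "ln_ereal p / ereal (real n) \<le> ereal x"
proof (cases "p \<le> 0")
  case True
  then show ?thesis using assms by (simp add: ln_ereal_def)
next
  case False
  then have "ln p \<le> real n * x" using assms by (metis ln_exp ln_mono not_le)
  then show ?thesis using False assms by (simp add: ln_ereal_def field_simps)
qed

lemma limsup_P_err_le:
  assumes \<beta>: "0 < \<beta>" "\<beta> < \<alpha>" and \<alpha>: "\<alpha> \<le> 1"
    and S: "\<And>n. S n \<subseteq> {..<n}" "\<And>n. card (S n) = nat \<lfloor>\<beta> * real n\<rfloor>"
    and c: "c3 \<ge> 0" and \<nu>: "\<nu> \<ge> 0" and \<gamma>: "\<gamma> > c3 / 2"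
  shows "limsup (\<lambda>n. ln_ereal (P_err (nat \<lfloor>\<alpha> * real n\<rfloor>) n (S n)) / ereal (real n)) \<le>
    ereal (- c3\<^sup>2 / 2 + I_sph \<alpha> c3 + ((1 - \<beta>) * ln (w1 c3 \<nu> \<gamma>) + \<beta> * ln (w2 c3 \<nu> \<gamma>) + c3 * \<gamma>))"
    (is "?l \<le> ereal ?B")
proof (cases "c3 = 0")
  \<comment> \<open>The tangent construction requires c3 > 0. At c3 = 0 both \<open>w1\<close> and
    \<open>w2\<close> equal 1, the claimed bound is 0, and it follows from \<open>P_err\<close>
    being a probability.\<close>
  case True
  interpret G: prob_space "gauss_mat m n" for m n unfolding gauss_mat_def by (rule prob_space_gauss_PiM)
  have "w1 0 \<nu> \<gamma> = 1" "w2 0 \<nu> \<gamma> = 1" by (simp_all add: w1_def w2_def erfc_def)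
  then have "?B = 0" using True by (simp add: I_sph_def)
  moreover have "?l \<le> 0"
  proof (rule Limsup_bounded)
    show "\<forall>\<^sub>F n in sequentially. ln_ereal (P_err (nat \<lfloor>\<alpha> * real n\<rfloor>) n (S n)) / ereal (real n) \<le> 0"
      using eventually_ge_at_top[of 1]
    proof eventually_elim
      case (elim n)
      then show ?case
        using ln_ereal_div_le[of n "P_err (nat \<lfloor>\<alpha> * real n\<rfloor>) n (S n)" 0] G.prob_le_1 by (simp add: P_err_def zero_ereal_def)
    qed
  qed
  ultimately show ?thesis by (simp add: zero_ereal_def)
next
  case False
  then have c: "c3 > 0" using c by simp
  show ?thesis
  proof (rule ereal_le_epsilon2)
    fix e :: real assume e: "e > 0"
    show "?l \<le> ereal ?B + ereal e"
    proof -
      \<comment> \<open>With this grid step the loss c3 d in the rate is exactly e.\<close>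
      define d where "d = e / c3"
      have d: "d > 0" "c3 * d = e" using c e by (auto simp: d_def)
      have b1: "\<beta> < 1" and a0: "0 < \<alpha>" using \<beta> \<alpha> by auto
      obtain C where C: "\<And>n S. n \<ge> 1 \<Longrightarrow> S \<subseteq> {..<n} \<Longrightarrow> card S = nat \<lfloor>\<beta> * real n\<rfloor> \<Longrightarrow>
        P_err (nat \<lfloor>\<alpha> * real n\<rfloor>) n S \<le> exp (real n * (?B + e) + c3 * sqrt (real n) + C)"
        by (rule P_err_exponential_bound[OF \<beta>(1) b1 a0 c \<nu> \<gamma> d(1), unfolded d(2)]) blast
      have "?l \<le> limsup (\<lambda>n. ereal (?B + e + (c3 / sqrt (real n) + C / real n)))"
      proof (rule Limsup_mono)
        show "\<forall>\<^sub>F n in sequentially. ln_ereal (P_err (nat \<lfloor>\<alpha> * real n\<rfloor>) n (S n)) / ereal (real n)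
          \<le> ereal (?B + e + (c3 / sqrt (real n) + C / real n))"
          using eventually_ge_at_top[of 1]
        proof eventually_elim
          case (elim n)
          have "real n * (?B + e + (c3 / sqrt (real n) + C / real n)) = real n * (?B + e) + c3 * (real n / sqrt (real n)) + C"
            using elim by (simp add: distrib_left)
          also have "real n / sqrt (real n) = sqrt (real n)" by (simp add: real_div_sqrt)
          finally show ?case
            using C[OF elim S(1) S(2)] by (intro ln_ereal_div_le elim) simp
        qed
      qed
      also have "\<dots> = ereal (?B + e + (0 + 0))"
      proof -
        have 1: "(\<lambda>n. c3 / sqrt (real n)) \<longlonglongrightarrow> 0"
          by (intro real_tendsto_divide_at_top[OF tendsto_const] filterlim_compose[OF sqrt_at_top] filterlim_real_sequentially)
        have 2: "(\<lambda>n. C / real n) \<longlonglongrightarrow> 0" by (rule lim_const_over_n)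
        have "(\<lambda>n. ereal (?B + e + (c3 / sqrt (real n) + C / real n))) \<longlonglongrightarrow> ereal (?B + e + (0 + 0))"
          by (rule tendsto_ereal[OF tendsto_add[OF tendsto_const tendsto_add[OF 1 2]]])
        then show ?thesis by (intro lim_imp_Limsup) auto
      qed
      finally show "?l \<le> ereal ?B + ereal e" by simp
    qed
  qed
qed

theorem theorem4:
  fixes \<alpha> \<beta> :: real and S :: "nat \<Rightarrow> nat set"
  assumes "0 < \<beta>" and "\<beta> < \<alpha>" and "\<alpha> \<le> 1"
    and "\<And>n. S n \<subseteq> {..<n}"
    and "\<And>n. card (S n) = nat \<lfloor>\<beta> * real n\<rfloor>"
  shows "limsup (\<lambda>n. ln_ereal (P_err (nat \<lfloor>\<alpha> * real n\<rfloor>) n (S n)) / ereal (real n))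
           \<le> I_bin_ub \<alpha> \<beta>"
  unfolding I_bin_ub_def
proof (rule INF_greatest)
  fix c3 :: real assume c3: "c3 \<in> {0..}"
  let ?l = "limsup (\<lambda>n. ln_ereal (P_err (nat \<lfloor>\<alpha> * real n\<rfloor>) n (S n)) / ereal (real n))"
  let ?x = "- c3\<^sup>2 / 2 + I_sph \<alpha> c3"
  let ?y = "\<lambda>p. (1 - \<beta>) * ln (w1 c3 (fst p) (snd p)) + \<beta> * ln (w2 c3 (fst p) (snd p)) + c3 * snd p"
  \<comment> \<open>Moving the finite term to the left leaves a bare infimum on the right, so that
    addition never has to be interchanged with an infimum of extended reals.\<close>
  have "?l - ereal ?x \<le> (INF p \<in> {(\<nu>, \<gamma>). \<nu> \<ge> 0 \<and> \<gamma> > c3 / 2}. ereal (?y p))"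
  proof (rule INF_greatest)
    fix p :: "real \<times> real" assume "p \<in> {(\<nu>, \<gamma>). \<nu> \<ge> 0 \<and> \<gamma> > c3 / 2}"
    then have "?l \<le> ereal (?x + ?y p)"
      using limsup_P_err_le[OF assms, of c3 "fst p" "snd p"] c3 by (auto simp: add.assoc)
    then show "?l - ereal ?x \<le> ereal (?y p)" by (simp add: ereal_minus_le add.commute)
  qed
  then show "?l \<le> ereal ?x + (INF p \<in> {(\<nu>, \<gamma>). \<nu> \<ge> 0 \<and> \<gamma> > c3 / 2}. ereal (?y p))"
    by (simp add: ereal_minus_le add.commute)
qed

end
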